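(* Let $p>2$ be a prime, $\mathbf{F}$ a field of characteristic $p$, and $M\in\mathbf{F}^{2\times4}$. If $\gamma_{1234}(M)=0$, $\gamma_{1235}(M)\neq0$ and $\gamma_{1357}(M)=0$, then, with $h_1,h_2,N_M(y),N_M(z)$ as defined in the context, the set $\mathcal B:=\{x,h_1,h_2,N_M(y),N_M(z)\}$ is a SAGBI basis for $\mathbf{F}[V_M]^E$. Furthermore, $\mathbf{F}[V_M]^E$ is a complete intersection with relations coming from the subduction of the têtes-à-têtes $(N_M(y)^2,h_1^{p^2})$ and $(h_2^p,h_1^{(p^3+1)/2})$.
   Context: For $M=(c_{ij})\in\mathbf{F}^{2\times4}$, $E=\langle e_1,e_2,e_3,e_4\rangle\cong(\mathbf{Z}/p)^4$ acts on $\mathbf{F}[V_M]=\mathbf{F}[x,y,z]$ (on the right, by algebra automorphisms) by $x\cdot e_j=x$, $y\cdot e_j=y+c_{1j}x$, $z\cdot e_j=z+2c_{1j}y+(c_{1j}^2+c_{2j})x$; $\mathbf{F}[V_M]^E$ is the ring of invariants. For $f\in\mathbf{F}[V_M]$, $N_M(f)$ is the product of the distinct elements of the $E$-orbit of $f$. Minors: $\Gamma(M)$ is the $10\times4$ matrix whose row $2k+1$ is $(c_{11}^{p^k},\dots,c_{14}^{p^k})$ and whose row $2k+2$ is $(c_{21}^{p^k},\dots,c_{24}^{p^k})$, $k=0,\dots,4$; $\gamma_{ijk\ell}(M)$ is its $4\times4$ minor with rows $i,j,k,\ell$, written $\bar\gamma_{ijk\ell}$. Put $\delta:=y^2-xz$.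 Under the hypotheses of the claim, $\bar\gamma_{2357}\neq0$, $\mathrm{LT}(N_M(y))=y^{p^3}$, and one defines $$h_1:=\delta^p+\frac{\bar\gamma_{1245}}{\bar\gamma_{1235}}y^px^{p}+\frac{\bar\gamma_{1345}}{\bar\gamma_{1235}}\delta x^{2p-2}+\frac{\bar\gamma_{2345}}{\bar\gamma_{1235}}yx^{2p-1},$$ $$\widetilde{h_2}:=N_M(y)^2-h_1^{p^2}+\frac{2}{\bar\gamma_{1235}}\left(\bar\gamma_{1237}x^{p^3-p^2}h_1^{(p^2+p)/2}-\bar\gamma_{1257}x^{p^3-p}h_1^{(p^2+1)/2}\right),\qquad h_2:=\frac{\bar\gamma_{1235}\,\widetilde{h_2}}{2\bar\gamma_{2357}x^{p^3-1}}.$$ These are elements of $\mathbf{F}[V_M]^E$ with lead terms $y^{2p}$ and $y^{p^3+1}$ for $h_1$ and $h_2$ respectively. Conventions: graded reverse lexicographic order with $x<y<z$; $\mathrm{LM}$, $\mathrm{LT}$ denote lead monomial and lead term (with coefficient). A finite subset $\mathcal B=\{b_1,\dots,b_m\}$ of a subalgebra $A$ of a polynomial ring is a SAGBI basis for $A$ if the monomials $\mathrm{LM}(b_i)$ generate the algebra spanned by the lead monomials of the elements of $A$. A tête-à-tête is a pair $(b^I,b^J)$ of products of elements of $\mathcal B$ with $\mathrm{LM}(b^I)=\mathrm{LM}(b^J)$. Its subduction: choose a scalar $c$ with $\mathrm{LT}(b^I)=\mathrm{LT}(cb^J)$ and repeatedly cancel the lead term of $b^I-cb^J$ by scalar multiples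 of products of elements of $\mathcal B$; if this ends at zero, it expresses $b^I-cb^J$ as a polynomial in $\mathcal B$, giving a relation. "Relations coming from the subduction of" given têtes-à-têtes means that the kernel of the surjection from the polynomial ring on $m$ variables sending the variables to $b_1,\dots,b_m$ is generated by the relations so obtained. A complete intersection is an algebra having a presentation whose ideal of relations is generated by a regular sequence. *)

theory Defs
  imports
    "HOL-Library.Poly_Mapping"
    "HOL-Analysis.Determinants"
    "HOL-Algebra.Ideal"
    "HOL-Algebra.Product_Groups"
    "HOL-Computational_Algebra.Primes"
begin

section \<open>Multivariate polynomials\<close>

type_synonym 'v monom = "'v \<Rightarrow>\<^sub>0 nat"
type_synonym ('v, 'a) mpoly = "'v monom \<Rightarrow>\<^sub>0 'a"

definition Var :: "'v \<Rightarrow> ('v, 'a::comm_ring_1) mpoly" where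
  "Var v = Poly_Mapping.single (Poly_Mapping.single v 1) 1"

definition Const :: "'a \<Rightarrow> ('v, 'a::comm_ring_1) mpoly" where
  "Const c = Poly_Mapping.single 0 c"

definition monom_eval :: "('v \<Rightarrow> 'b::comm_ring_1) \<Rightarrow> 'v monom \<Rightarrow> 'b" where
  "monom_eval b m = (\<Prod>v\<in>Poly_Mapping.keys m. b v ^ Poly_Mapping.lookup m v)"

text \<open>The homomorphism of algebras that sends each variable \<open>v\<close> to \<open>b v\<close>.\<close>

definition subst :: "('v \<Rightarrow> ('w, 'a::comm_ring_1) mpoly) \<Rightarrow> ('v, 'a) mpoly \<Rightarrow> ('w, 'a) mpoly" where
  "subst b f = (\<Sum>m\<in>Poly_Mapping.keys f. Const (Poly_Mapping.lookup f m) * monom_eval b m)"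

text \<open>The quotient \<open>f / g\<close>, meaningful when \<open>g \<noteq> 0\<close> divides \<open>f\<close>.\<close>

definition exact_quot :: "('v, 'a::comm_ring_1) mpoly \<Rightarrow> ('v, 'a) mpoly \<Rightarrow> ('v, 'a) mpoly" where
  "exact_quot f g = (THE q. f = q * g)"

inductive_set alg_gen :: "('v, 'a::comm_ring_1) mpoly set \<Rightarrow> ('v, 'a) mpoly set"
  for S :: "('v, 'a) mpoly set" where
  gen: "f \<in> S \<Longrightarrow> f \<in> alg_gen S"
| const: "Const c \<in> alg_gen S"
| add: "f \<in> alg_gen S \<Longrightarrow> g \<in> alg_gen S \<Longrightarrow> f + g \<in> alg_gen S"
| mult: "f \<in> alg_gen S \<Longrightarrow> g \<in> alg_gen S \<Longrightarrow> f * g \<in> alg_gen S"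

definition lin_span :: "('v, 'a::comm_ring_1) mpoly set \<Rightarrow> ('v, 'a) mpoly set" where
  "lin_span S = module.span (\<lambda>c f. Const c * f) S"


section \<open>Lead terms and SAGBI bases\<close>

definition mdeg :: "'v monom \<Rightarrow> nat" where
  "mdeg m = (\<Sum>v\<in>Poly_Mapping.keys m. Poly_Mapping.lookup m v)"

text \<open>Graded reverse lexicographic order, the variables being ordered as in the type \<open>'v\<close>:
  in equal degree, the monomial with the larger exponent at the smallest variable where the two
  differ is the smaller one.\<close>

definition grevlex_less :: "'v::linorder monom \<Rightarrow> 'v monom \<Rightarrow> bool" where
  "grevlex_less m n \<longleftrightarrow> mdeg m < mdeg n \<or> mdeg m = mdeg n \<and>
     (\<exists>v. Poly_Mapping.lookup m v > Poly_Mapping.lookup n v \<and>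
          (\<forall>w<v. Poly_Mapping.lookup m w = Poly_Mapping.lookup n w))"

text \<open>Exponent of the lead monomial; unspecified for the zero polynomial.\<close>

definition lead_exp :: "('v::linorder, 'a::comm_ring_1) mpoly \<Rightarrow> 'v monom" where
  "lead_exp f = (THE m. m \<in> Poly_Mapping.keys f \<and>
     (\<forall>n\<in>Poly_Mapping.keys f. n = m \<or> grevlex_less n m))"

definition LM :: "('v::linorder, 'a::comm_ring_1) mpoly \<Rightarrow> ('v, 'a) mpoly" where
  "LM f = Poly_Mapping.single (lead_exp f) 1"

definition LT :: "('v::linorder, 'a::comm_ring_1) mpoly \<Rightarrow> ('v, 'a) mpoly" where
  "LT f = Poly_Mapping.single (lead_exp f) (Poly_Mapping.lookup f (lead_exp f))"

definition sagbi_basis ::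
  "('v::linorder, 'a::comm_ring_1) mpoly set \<Rightarrow> ('v, 'a) mpoly set \<Rightarrow> bool" where
  "sagbi_basis B A \<longleftrightarrow> finite B \<and> B \<subseteq> A - {0} \<and>
     alg_gen (LM ` B) = lin_span (LM ` (A - {0}))"


section \<open>Presentations and complete intersections\<close>

definition mpoly_ring :: "nat \<Rightarrow> (nat, 'a::comm_ring_1) mpoly ring" where
  "mpoly_ring n = \<lparr>carrier = {f. \<forall>m\<in>Poly_Mapping.keys f. Poly_Mapping.keys m \<subseteq> {..<n}},
     monoid.mult = (*), one = 1, zero = 0, add = (+)\<rparr>"

definition relation_ideal :: "('v, 'a::comm_ring_1) mpoly list \<Rightarrow> (nat, 'a) mpoly set" where
  "relation_ideal bs = {f \<in> carrier (mpoly_ring (length bs)). subst ((!) bs) f = 0}"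

definition presents ::
  "('v, 'a::comm_ring_1) mpoly list \<Rightarrow> (nat, 'a) mpoly list \<Rightarrow> ('v, 'a) mpoly set \<Rightarrow> bool" where
  "presents bs rs A \<longleftrightarrow>
     subst ((!) bs) ` carrier (mpoly_ring (length bs)) = A \<and>
     relation_ideal bs = Idl\<^bsub>mpoly_ring (length bs)\<^esub> (set rs)"

definition regular_sequence :: "('r, 'm) ring_scheme \<Rightarrow> 'r list \<Rightarrow> bool" where
  "regular_sequence R rs \<longleftrightarrow> set rs \<subseteq> carrier R \<and>
     (\<forall>i<length rs. \<forall>f\<in>carrier R.
        rs ! i \<otimes>\<^bsub>R\<^esub> f \<in> Idl\<^bsub>R\<^esub> (set (take i rs)) \<longrightarrow> f \<in> Idl\<^bsub>R\<^esub> (set (take i rs))) \<and>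
     Idl\<^bsub>R\<^esub> (set rs) \<noteq> carrier R"

definition complete_intersection :: "('v, 'a::comm_ring_1) mpoly set \<Rightarrow> bool" where
  "complete_intersection A \<longleftrightarrow>
     (\<exists>bs rs. presents bs rs A \<and> regular_sequence (mpoly_ring (length bs)) rs)"


section \<open>Tete-a-tetes and subduction\<close>

text \<open>\<open>subducts bs f P\<close>: repeatedly cancelling the lead term of \<open>f\<close> by scalar multiples of
  products of elements of \<open>bs\<close> may end at zero, and \<open>P\<close>, in variables indexed by the positions
  of \<open>bs\<close>, is the polynomial expression for \<open>f\<close> so obtained.\<close>

inductive subducts ::
  "('v::linorder, 'a::comm_ring_1) mpoly list \<Rightarrow> ('v, 'a) mpoly \<Rightarrow> (nat, 'a) mpoly \<Rightarrow> bool"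
  for bs :: "('v, 'a) mpoly list" where
  zero: "subducts bs 0 0"
| step: "f \<noteq> 0 \<Longrightarrow> Poly_Mapping.keys K \<subseteq> {..<length bs} \<Longrightarrow>
    LT f = LT (Const c * monom_eval ((!) bs) K) \<Longrightarrow>
    subducts bs (f - Const c * monom_eval ((!) bs) K) P \<Longrightarrow>
    subducts bs f (Poly_Mapping.single K c + P)"

definition tete_a_tete ::
  "('v::linorder, 'a::comm_ring_1) mpoly list \<Rightarrow> nat monom \<Rightarrow> nat monom \<Rightarrow> bool" where
  "tete_a_tete bs I J \<longleftrightarrow>
     Poly_Mapping.keys I \<subseteq> {..<length bs} \<and> Poly_Mapping.keys J \<subseteq> {..<length bs} \<and>
     LM (monom_eval ((!) bs) I) = LM (monom_eval ((!) bs) J)"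

text \<open>The choices made during subduction are not unique, so this is a relation: \<open>R\<close> is one of
  the relations that a subduction to zero of the given tete-a-tete may yield.\<close>

definition subduction_relation ::
  "('v::linorder, 'a::comm_ring_1) mpoly list \<Rightarrow> nat monom \<Rightarrow> nat monom \<Rightarrow> (nat, 'a) mpoly \<Rightarrow> bool"
where
  "subduction_relation bs I J R \<longleftrightarrow> tete_a_tete bs I J \<and>
     (\<exists>c P. LT (monom_eval ((!) bs) I) = LT (Const c * monom_eval ((!) bs) J) \<and>
            subducts bs (monom_eval ((!) bs) I - Const c * monom_eval ((!) bs) J) P \<and>
            R = Poly_Mapping.single I 1 - Poly_Mapping.single J c - P)"


section \<open>The representation and its invariants\<close>

text \<open>The polynomial ring in \<open>x < y < z\<close>: the variables are indexed by the elements
  \<open>0 < 1 < 2\<close> of the three-element numeral type.\<close>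

abbreviation X :: "(3, 'a::comm_ring_1) mpoly" where "X \<equiv> Var 0"
abbreviation Y :: "(3, 'a::comm_ring_1) mpoly" where "Y \<equiv> Var 1"
abbreviation Z :: "(3, 'a::comm_ring_1) mpoly" where "Z \<equiv> Var 2"

text \<open>Right action of the generator \<open>e\<^sub>j\<close>; the entry \<open>c\<^sub>i\<^sub>j\<close> of the matrix is \<open>M $ i $ j\<close>.\<close>

definition act_gen :: "'a::field ^ 4 ^ 2 \<Rightarrow> 4 \<Rightarrow> (3, 'a) mpoly \<Rightarrow> (3, 'a) mpoly" where
  "act_gen M j = subst (\<lambda>v.
     if v = 0 then X
     else if v = 1 then Y + Const (M $ 1 $ j) * X
     else Z + Const (2 * M $ 1 $ j) * Y + Const ((M $ 1 $ j)\<^sup>2 + M $ 2 $ j) * X)"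

definition E_grp :: "nat \<Rightarrow> (4 \<Rightarrow> int) monoid" where
  "E_grp p = product_group UNIV (\<lambda>_. integer_mod_group p)"

text \<open>The action of \<open>g = e\<^sub>1\<^bsup>g 1\<^esup> \<cdots> e\<^sub>4\<^bsup>g 4\<^esup>\<close>. In characteristic \<open>p > 2\<close> the automorphisms
  \<open>act_gen M j\<close> commute and have \<open>p\<close>-th power the identity.\<close>

definition act :: "'a::field ^ 4 ^ 2 \<Rightarrow> (3, 'a) mpoly \<Rightarrow> (4 \<Rightarrow> int) \<Rightarrow> (3, 'a) mpoly" where
  "act M f g = (act_gen M 4 ^^ nat (g 4)) ((act_gen M 3 ^^ nat (g 3))
     ((act_gen M 2 ^^ nat (g 2)) ((act_gen M 1 ^^ nat (g 1)) f)))"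

definition invariants :: "nat \<Rightarrow> 'a::field ^ 4 ^ 2 \<Rightarrow> (3, 'a) mpoly set" where
  "invariants p M = {f. \<forall>g\<in>carrier (E_grp p). act M f g = f}"

definition orbit_prod :: "nat \<Rightarrow> 'a::field ^ 4 ^ 2 \<Rightarrow> (3, 'a) mpoly \<Rightarrow> (3, 'a) mpoly" where
  "orbit_prod p M f = \<Prod> (act M f ` carrier (E_grp p))"


section \<open>Minors and the invariants \<open>h\<^sub>1\<close> and \<open>h\<^sub>2\<close>\<close>

text \<open>Row \<open>r\<close> of \<open>\<Gamma>(M)\<close>, where the rows are numbered from 1.\<close>

definition Gamma_row :: "nat \<Rightarrow> 'a::field ^ 4 ^ 2 \<Rightarrow> nat \<Rightarrow> 'a ^ 4" where
  "Gamma_row p M r = (\<chi> j. (M $ (if odd r then 1 else 2) $ j) ^ (p ^ ((r - 1) div 2)))"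

definition \<gamma> :: "nat \<Rightarrow> 'a::field ^ 4 ^ 2 \<Rightarrow> nat \<Rightarrow> nat \<Rightarrow> nat \<Rightarrow> nat \<Rightarrow> 'a" where
  "\<gamma> p M i j k l =
     det (vector [Gamma_row p M i, Gamma_row p M j, Gamma_row p M k, Gamma_row p M l] :: 'a ^ 4 ^ 4)"

definition \<delta> :: "(3, 'a::field) mpoly" where
  "\<delta> = Y\<^sup>2 - X * Z"

definition h1 :: "nat \<Rightarrow> 'a::field ^ 4 ^ 2 \<Rightarrow> (3, 'a) mpoly" where
  "h1 p M = \<delta> ^ p
     + Const (\<gamma> p M 1 2 4 5 / \<gamma> p M 1 2 3 5) * Y ^ p * X ^ p
     + Const (\<gamma> p M 1 3 4 5 / \<gamma> p M 1 2 3 5) * \<delta> * X ^ (2 * p - 2)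
     + Const (\<gamma> p M 2 3 4 5 / \<gamma> p M 1 2 3 5) * Y * X ^ (2 * p - 1)"

definition h2_tilde :: "nat \<Rightarrow> 'a::field ^ 4 ^ 2 \<Rightarrow> (3, 'a) mpoly" where
  "h2_tilde p M = (orbit_prod p M Y)\<^sup>2 - h1 p M ^ (p\<^sup>2)
     + Const (2 / \<gamma> p M 1 2 3 5) *
       (Const (\<gamma> p M 1 2 3 7) * X ^ (p ^ 3 - p\<^sup>2) * h1 p M ^ ((p\<^sup>2 + p) div 2)
        - Const (\<gamma> p M 1 2 5 7) * X ^ (p ^ 3 - p) * h1 p M ^ ((p\<^sup>2 + 1) div 2))"

definition h2 :: "nat \<Rightarrow> 'a::field ^ 4 ^ 2 \<Rightarrow> (3, 'a) mpoly" where
  "h2 p M = exact_quot (Const (\<gamma> p M 1 2 3 5) * h2_tilde p M)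
     (Const (2 * \<gamma> p M 2 3 5 7) * X ^ (p ^ 3 - 1))"

end

theory Submission
  imports Defs "HOL-Library.Product_Lexorder" "HOL-Computational_Algebra.Polynomial"
begin

text \<open>
  Put \<open>\<delta> = y\<^sup>2 - x z\<close>. The group acts on \<open>F[x, y, \<delta>]\<close> by the
  translations \<open>y \<mapsto> y + a x\<close>, \<open>\<delta> \<mapsto> \<delta> - b x\<^sup>2\<close>, where
  \<open>(a, b)\<close> runs through an additive group of shifts in the plane. The conditions on the minors imply that
  there are \<open>p\<^sup>4\<close> shifts, with \<open>p\<^sup>3\<close> different first components, and that over
  each first component there are \<open>p\<close> shifts (\<open>card_A\<close>, \<open>card_fibre\<close>).

  \<^emph>\<open>Inverting \<open>x\<close>.\<close> Over \<open>F[x, h\<^sub>1, N(y)]\<close> the ring \<open>F[x, y,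
  \<delta>]\<close> is spanned by the monomials \<open>y\<^sup>i \<delta>\<^sup>j\<close> with \<open>i <
  p\<^sup>3\<close> and \<open>j < p\<close>, because \<open>h\<^sub>1\<close> is monic of degree \<open>p\<close> in
  \<open>\<delta>\<close> and \<open>N(y)\<close> is monic of degree \<open>p\<^sup>3\<close> in \<open>y\<close>. If
  an invariant is expanded in this way, the expansion takes the same value at all \<open>p\<^sup>4\<close> translates
  of \<open>(y, \<delta>)\<close>, and interpolation shows that the invariant equals its constant coefficient
  (\<open>interpolation\<close>, \<open>invariant_Fil\<close>). Since \<open>x z = y\<^sup>2 - \<delta>\<close>, every
  invariant of \<open>F[x, y, z]\<close> is carried into \<open>F[x, h\<^sub>1, N(y)]\<close> by a power of
  \<open>x\<close>.

  \<^emph>\<open>Dividing by \<open>x\<close>.\<close> Let \<open>N\<close> be the span of the normal monomials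
  \<open>x\<^sup>a h\<^sub>1\<^sup>b h\<^sub>2\<^sup>c N(y)\<^sup>d N(z)\<^sup>e\<close>, those with \<open>c <
  p\<close> and \<open>d < 2\<close>. Their lead monomials \<open>x\<^sup>a y\<^sup>m z\<^sup>n\<close>, where
  \<open>m = 2pb + (p\<^sup>3 + 1)c + p\<^sup>3 d\<close> and \<open>n = p\<^sup>4 e\<close>, are pairwise distinct.
  Hence the lead monomial of an element of \<open>N\<close> is that of one of its normal monomials, and an element of
  \<open>N\<close> that is divisible by \<open>x\<close> remains in \<open>N\<close> after division by
  \<open>x\<close> (\<open>N_div_X\<close>). On the other hand \<open>N\<close> contains \<open>F[x, h\<^sub>1,
  N(y)]\<close>. Indeed, by its definition \<open>h\<^sub>2\<close> expresses \<open>N(y)\<^sup>2\<close> through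
  normal monomials, which puts the powers of \<open>N(y)\<close> with exponent below \<open>2p\<close> into
  \<open>N\<close>. For the higher ones it suffices that, up to a power of \<open>x\<close>, the norm \<open>N(z)\<close> is a monic polynomial of degree
  \<open>2p\<close> in \<open>N(y)\<close> over \<open>F[x, h\<^sub>1]\<close>. This is seen by giving weight 2 to
  \<open>y\<close> and weight 3 to \<open>\<delta>\<close> (\<open>NZ_monic_in_NY\<close>). Together, the invariants
  are exactly \<open>N\<close> (\<open>invariants_eq_N\<close>). The SAGBI property follows, and with it the fact that
  every invariant, in particular every difference that comes from a tete-a-tete, subducts to zero.

  \<^emph>\<open>Relations.\<close> Order the monomials in five variables \<open>t\<^sub>0, \<dots>,
  t\<^sub>4\<close>, which stand for the generators, by the lead monomials of their values, and break ties by the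
  exponents of \<open>t\<^sub>2\<close> and \<open>t\<^sub>3\<close>. Whatever choices are made in the subductions,
  the two relations have the lead monomials \<open>t\<^sub>3\<^sup>2\<close> and \<open>t\<^sub>2\<^sup>p\<close>.
  Division by them leaves a combination of normal monomials, and such a combination is a relation only if it is zero;
  so they generate all relations. Their lead monomials are coprime, so they form a regular sequence.
\<close>

abbreviation "lookup \<equiv> Poly_Mapping.lookup"
abbreviation "keys \<equiv> Poly_Mapping.keys"
abbreviation "single \<equiv> Poly_Mapping.single"

section \<open>Substitution into multivariate polynomials\<close>

lemma monom_eval_superset:
  assumes "finite S" "keys m \<subseteq> S"
  shows "monom_eval b m = (\<Prod>v\<in>S. b v ^ lookup m v)"
  unfolding monom_eval_def
  by (rule prod.mono_neutral_left) (use assms in \<open>auto simp: in_keys_iff\<close>)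

lemma monom_eval_add: "monom_eval b (m + n) = monom_eval b m * monom_eval b n"
proof -
  let ?S = "keys m \<union> keys n"
  have "keys (m + n) \<subseteq> ?S" by (rule Poly_Mapping.keys_add)
  then show ?thesis
    by (simp add: monom_eval_superset[where S = ?S] lookup_add power_add prod.distrib)
qed

lemma monom_eval_0 [simp]: "monom_eval b 0 = 1"
  by (simp add: monom_eval_def)

lemma monom_eval_single [simp]: "monom_eval b (single v k) = b v ^ k"
  by (simp add: monom_eval_superset[where S = "{v}"])

lemma monom_eval_lessThan:
  "keys m \<subseteq> {..<n} \<Longrightarrow> monom_eval b m = (\<Prod>i<n. b i ^ lookup m i)" for n :: nat
  by (rule monom_eval_superset) auto

lemma poly_mapping_sum_singles: "f = (\<Sum>m\<in>keys f. single m (lookup f m))"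
proof (rule poly_mapping_eqI)
  fix k
  show "lookup f k = lookup (\<Sum>m\<in>keys f. single m (lookup f m)) k"
    by (cases "k \<in> keys f")
       (auto simp: lookup_sum lookup_single when_def sum.delta in_keys_iff)
qed

lemma mpoly_induct [case_names zero plus single]:
  fixes f :: "'b \<Rightarrow>\<^sub>0 'a::comm_monoid_add"
  assumes "P 0" "\<And>f g. P f \<Longrightarrow> P g \<Longrightarrow> P (f + g)" "\<And>m c. P (single m c)"
  shows "P f"
proof -
  have "P (\<Sum>m\<in>A. single m (lookup f m))" if "finite A" for A
    using that by induction (auto intro: assms)
  then show ?thesis
    using poly_mapping_sum_singles[of f] by (metis finite_keys)
qed

lemma Const_0 [simp]: "Const 0 = 0" by (simp add: Const_def)
lemma Const_1 [simp]: "Const 1 = 1" by (simp add: Const_def)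
lemma Const_add: "Const (a + b) = Const a + Const b" by (simp add: Const_def single_add)
lemma Const_mult: "Const (a * b) = Const a * Const b" by (simp add: Const_def mult_single)
lemma Const_uminus: "Const (- a) = - Const a" by (simp add: Const_def single_uminus)
lemma Const_minus: "Const (a - b) = Const a - Const b" by (simp add: Const_def single_diff)
lemma Const_power: "Const (a ^ n) = Const a ^ n" by (induction n) (simp_all add: Const_mult)
lemma Const_eq_0_iff [simp]: "Const a = 0 \<longleftrightarrow> a = 0"
  by (metis Const_0 Const_def lookup_single_eq)
lemma Const_inject [simp]: "Const a = Const b \<longleftrightarrow> a = b"
  by (metis Const_def lookup_single_eq)
lemma Const_mult_single: "Const a * single m b = single m (a * b)"
  by (simp add: Const_def mult_single)

lemma lookup_Const_mult: "lookup (Const a * f) m = a * lookup f m"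
  by (induction f rule: mpoly_induct)
     (simp_all add: Const_mult_single lookup_single when_def lookup_add distrib_left)

lemma subst_superset:
  assumes "finite S" "keys f \<subseteq> S"
  shows "subst b f = (\<Sum>m\<in>S. Const (lookup f m) * monom_eval b m)"
  unfolding subst_def
  by (rule sum.mono_neutral_left) (use assms in \<open>auto simp: in_keys_iff\<close>)

lemma subst_0 [simp]: "subst b 0 = 0" by (simp add: subst_def)

lemma subst_add: "subst b (f + g) = subst b f + subst b g"
proof -
  let ?S = "keys f \<union> keys g"
  have "keys (f + g) \<subseteq> ?S" by (rule Poly_Mapping.keys_add)
  then show ?thesis
    by (simp add: subst_superset[where S = ?S] lookup_add Const_add distrib_right sum.distrib)
qed

lemma subst_single: "subst b (single m c) = Const c * monom_eval b m"
  by (simp add: subst_superset[where S = "{m}"])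

lemma subst_mult: "subst b (f * g) = subst b f * subst b g"
proof (induction f rule: mpoly_induct)
  case (single m c)
  show ?case
    by (induction g rule: mpoly_induct)
       (simp_all add: subst_single mult_single monom_eval_add Const_mult subst_add distrib_left
         mult.assoc mult.left_commute)
qed (simp_all add: subst_add distrib_right)

lemma subst_Const [simp]: "subst b (Const c) = Const c"
  using subst_single[of b 0 c] by (simp add: Const_def)

lemma subst_1 [simp]: "subst b 1 = 1"
  using subst_Const[of b 1] by simp

lemma subst_Var [simp]: "subst b (Var v) = b v"
  by (simp add: Var_def subst_single)

lemma subst_uminus: "subst b (- f) = - subst b f"
  by (metis add.right_inverse add_eq_0_iff subst_0 subst_add)

lemma subst_diff: "subst b (f - g) = subst b f - subst b g"
  by (metis diff_add_cancel eq_diff_eq subst_add)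

lemma subst_power: "subst b (f ^ n) = subst b f ^ n"
  by (induction n) (simp_all add: subst_mult)

lemma subst_prod: "subst b (prod f A) = (\<Prod>x\<in>A. subst b (f x))"
  by (induction A rule: infinite_finite_induct) (simp_all add: subst_mult)

lemma subst_sum: "subst b (sum f A) = (\<Sum>x\<in>A. subst b (f x))"
  by (induction A rule: infinite_finite_induct) (simp_all add: subst_add)

lemma single_monom_eval: "single m 1 = monom_eval Var m"
proof -
  have "single (\<Sum>v\<in>A. single v (k v)) (1::'b) = (\<Prod>v\<in>A. Var v ^ k v)" if "finite A" for A and k :: "'a \<Rightarrow> nat"
    using that
  proof induction
    case (insert x F)
    have "single (single x j) (1::'b) = Var x ^ j" for j
    proof (induction j)
      case (Suc j)
      have "single (single x (Suc j)) (1::'b) = single (single x 1) 1 * single (single x j) 1"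
        by (simp add: mult_single flip: single_add)
      with Suc show ?case by (simp add: Var_def)
    qed simp
    moreover have "single (m + n) (1::'b) = single m 1 * single n 1" for m n :: "'a monom"
      by (simp add: mult_single)
    ultimately show ?case using insert by simp
  qed simp
  from this[of "keys m" "lookup m"] show ?thesis
    by (simp add: monom_eval_def poly_mapping_sum_singles[of m, symmetric])
qed

lemma subst_monom_eval: "subst a (monom_eval b m) = monom_eval (\<lambda>v. subst a (b v)) m"
  by (simp add: monom_eval_def subst_prod subst_power)

lemma subst_subst: "subst a (subst b f) = subst (\<lambda>v. subst a (b v)) f"
  by (induction f rule: mpoly_induct)
     (simp_all add: subst_add subst_single subst_mult subst_monom_eval)

lemma subst_Var_id: "subst Var f = f"
  by (induction f rule: mpoly_induct)
     (simp_all add: subst_add subst_single Const_mult_single flip: single_monom_eval)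

lemma in_keys_addD: "k \<in> keys (f + g) \<Longrightarrow> k \<in> keys f \<or> k \<in> keys g"
  using Poly_Mapping.keys_add[of f g] by blast

lemma in_keys_sumE:
  assumes "k \<in> keys (sum g I)"
  obtains i where "i \<in> I" "k \<in> keys (g i)"
  using assms by (metis in_keys_iff lookup_sum sum.neutral)

lemma in_keys_multE:
  assumes "k \<in> keys (f * g)"
  obtains m n where "m \<in> keys f" "n \<in> keys g" "k = m + n"
  using assms Poly_Mapping.keys_mult[of f g] by blast

interpretation mp: module "\<lambda>c f. Const c * f :: ('v, 'a::comm_ring_1) mpoly"
  by standard (simp_all add: algebra_simps Const_add Const_mult)

lemma lin_span_eq: "lin_span S = mp.span S"
  by (simp add: lin_span_def)


section \<open>Lead monomials with respect to an additive key\<close>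

text \<open>A monomial order is given by a key with values in a well-order. The set \<open>S\<close> singles out the
  monomials in the variables under consideration: the key used below for polynomials in the generators is injective
  only on the monomials that involve no other variables.\<close>

locale monomial_key =
  fixes key :: "'v monom \<Rightarrow> 'k::wellorder" and S :: "'v monom set"
  assumes key_inj: "inj_on key S"
    and add_closed: "m \<in> S \<Longrightarrow> n \<in> S \<Longrightarrow> m + n \<in> S"
    and key_mono: "m \<in> S \<Longrightarrow> n \<in> S \<Longrightarrow> k \<in> S \<Longrightarrow> key m < key n \<Longrightarrow> key (m + k) < key (n + k)"
begin

definition leads :: "('v, 'a::comm_ring_1) mpoly \<Rightarrow> 'v monom \<Rightarrow> bool" where
  "leads f m \<longleftrightarrow> keys f \<subseteq> S \<and> m \<in> keys f \<and> (\<forall>n\<in>keys f. n \<noteq> m \<longrightarrow> key n < key m)"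

lemma leads_exists:
  assumes "f \<noteq> 0" "keys f \<subseteq> S"
  obtains m where "leads f m"
proof -
  have ne: "keys f \<noteq> {}" using assms by simp
  then obtain m where m: "m \<in> keys f" "key m = Max (key ` keys f)"
    by (metis (no_types, lifting) Max_in finite_imageI finite_keys image_iff image_is_empty)
  have "key n < key m" if "n \<in> keys f" "n \<noteq> m" for n
  proof -
    have "key n \<le> key m" using that m by simp
    moreover have "key n \<noteq> key m" using that m assms(2) key_inj by (metis inj_onD subsetD)
    ultimately show ?thesis by simp
  qed
  with m assms that show ?thesis unfolding leads_def by blast
qed

lemma leads_unique: "leads f m \<Longrightarrow> leads f n \<Longrightarrow> m = n"
  unfolding leads_def by (metis less_asym)

lemma leads_lookup: "leads f m \<Longrightarrow> lookup f m \<noteq> 0"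
  by (simp add: leads_def in_keys_iff)

lemma leads_nonzero: "leads f m \<Longrightarrow> f \<noteq> 0"
  by (auto simp: leads_def)

lemma leads_in: "leads f m \<Longrightarrow> m \<in> S"
  by (auto simp: leads_def)

lemma leads_le: "leads f m \<Longrightarrow> n \<in> keys f \<Longrightarrow> key n \<le> key m"
  by (metis leads_def order.order_iff_strict)

lemma leads_single: "m \<in> S \<Longrightarrow> c \<noteq> 0 \<Longrightarrow> leads (single m c) m"
  by (simp add: leads_def)

text \<open>A product of two terms that are not both lead terms has a smaller key than the product of the lead terms,
  so nothing cancels the latter.\<close>

lemma lead_product:
  fixes f g :: "('v, 'a::idom) mpoly"
  assumes f: "leads f m" and g: "leads g n"
  shows "leads (f * g) (m + n)" "lookup (f * g) (m + n) = lookup f m * lookup g n"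
proof -
  define f' where "f' = f - single m (lookup f m)"
  define g' where "g' = g - single n (lookup g n)"
  have kf: "k \<in> S \<and> key k < key m" if "k \<in> keys f'" for k
    using that f unfolding f'_def leads_def
    by (auto simp: in_keys_iff lookup_minus lookup_single when_def split: if_splits)
  have kg: "k \<in> S \<and> key k < key n" if "k \<in> keys g'" for k
    using that g unfolding g'_def leads_def
    by (auto simp: in_keys_iff lookup_minus lookup_single when_def split: if_splits)
  have mS: "m \<in> S" "n \<in> S" using f g leads_in by auto
  define h where "h = single m (lookup f m) * g' + f' * single n (lookup g n) + f' * g'"
  have fg: "f * g = single (m + n) (lookup f m * lookup g n) + h"
    unfolding h_def mult_single[symmetric] by (simp add: f'_def g'_def algebra_simps)
  have kh: "k \<in> S \<and> key k < key (m + n)" if k: "k \<in> keys h" for k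
  proof -
    consider "k \<in> keys (single m (lookup f m) * g')" | "k \<in> keys (f' * single n (lookup g n))"
      | "k \<in> keys (f' * g')"
      using k unfolding h_def by (auto dest!: in_keys_addD)
    then show ?thesis
    proof cases
      case 1
      then obtain l where l: "l \<in> keys g'" "k = m + l"
        by (auto elim!: in_keys_multE split: if_splits)
      then show ?thesis using kg[of l] mS key_mono[of l n m] add_closed by (simp add: add.commute)
    next
      case 2
      then obtain l where "l \<in> keys f'" "k = l + n"
        by (auto elim!: in_keys_multE split: if_splits)
      then show ?thesis using kf[of l] mS key_mono[of l m n] add_closed by simp
    next
      case 3
      then obtain l r where lr: "l \<in> keys f'" "r \<in> keys g'" "k = l + r"
        by (auto elim!: in_keys_multE)
      have "key (l + r) < key (m + r)" using lr kf kg mS key_mono by blast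
      also have "key (m + r) < key (m + n)"
        using lr kg[of r] mS key_mono[of r n m] by (simp add: add.commute)
      finally show ?thesis using lr kf kg add_closed by blast
    qed
  qed
  have nh: "lookup h (m + n) = 0"
    using kh[of "m + n"] by (auto simp: in_keys_iff)
  show *: "lookup (f * g) (m + n) = lookup f m * lookup g n"
    by (simp add: fg lookup_add nh)
  have nz: "lookup f m * lookup g n \<noteq> 0" using f g leads_lookup by auto
  have sub: "k = m + n \<or> k \<in> keys h" if "k \<in> keys (f * g)" for k
    using that nz unfolding fg by (auto dest!: in_keys_addD split: if_splits)
  show "leads (f * g) (m + n)"
    unfolding leads_def using sub kh add_closed[OF mS] nz * by (auto simp: in_keys_iff)
qed

lemma lead_power:
  fixes f :: "('v, 'a::idom) mpoly"
  assumes "leads f m" "0 \<in> S"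
  shows "leads (f ^ k) (\<Sum>i<k. m) \<and> lookup (f ^ k) (\<Sum>i<k. m) = lookup f m ^ k"
proof (induction k)
  case 0
  have "leads (1 :: ('v, 'a) mpoly) 0" using leads_single[of 0 "1::'a"] assms(2) by simp
  then show ?case by simp
next
  case (Suc k)
  then show ?case using lead_product[OF assms(1), of "f ^ k" "\<Sum>i<k. m"] by (simp add: add.commute)
qed

lemma lead_prod:
  fixes f :: "'i \<Rightarrow> ('v, 'a::idom) mpoly"
  assumes "finite I" "0 \<in> S" "\<And>i. i \<in> I \<Longrightarrow> leads (f i) (m i)"
  shows "leads (prod f I) (sum m I) \<and> lookup (prod f I) (sum m I) = (\<Prod>i\<in>I. lookup (f i) (m i))"
  using assms(1,3)
proof (induction I)
  case empty
  have "leads (1 :: ('v, 'a) mpoly) 0" using leads_single[of 0 "1::'a"] assms(2) by simp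
  then show ?case by simp
next
  case (insert x F)
  then show ?case using lead_product[of "f x" "m x" "prod f F" "sum m F"] by auto
qed

text \<open>Summands with pairwise distinct lead monomials cannot cancel, so one of them leads the sum.\<close>

lemma leads_sum_distinct:
  fixes g :: "'i \<Rightarrow> ('v, 'a::comm_ring_1) mpoly"
  assumes "finite I" "I \<noteq> {}" and g: "\<And>i. i \<in> I \<Longrightarrow> leads (g i) (m i)" and inj: "inj_on m I"
  obtains i where "i \<in> I" "leads (sum g I) (m i)" "lookup (sum g I) (m i) = lookup (g i) (m i)"
proof -
  obtain i where i: "i \<in> I" "key (m i) = Max ((key \<circ> m) ` I)"
  proof -
    have "Max ((key \<circ> m) ` I) \<in> (key \<circ> m) ` I" using assms(1,2) by (intro Max_in) auto
    then show ?thesis using that by (metis comp_apply imageE)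
  qed
  have jlt: "key (m j) < key (m i)" if "j \<in> I" "j \<noteq> i" for j
  proof -
    have "key (m j) \<le> key (m i)" using that i assms(1) by (simp add: image_image)
    moreover have "key (m j) \<noteq> key (m i)"
    proof
      assume "key (m j) = key (m i)"
      then have "m j = m i"
        using inj_onD[OF key_inj] leads_in[OF g[OF that(1)]] leads_in[OF g[OF i(1)]] by blast
      then show False using inj_onD[OF inj] that i(1) by blast
    qed
    ultimately show ?thesis by simp
  qed
  have lt: "k \<in> S \<and> key k < key (m i)" if "j \<in> I" "j \<noteq> i" "k \<in> keys (g j)" for j k
  proof
    show "k \<in> S" using that g[OF that(1)] by (auto simp: leads_def)
    show "key k < key (m i)"
      using leads_le[OF g[OF that(1)] that(3)] jlt[OF that(1,2)]
      by (rule order.strict_trans1)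
  qed
  define h where "h = sum g (I - {i})"
  have gi: "sum g I = g i + h" using i assms(1) by (simp add: h_def sum.remove)
  have kh: "k \<in> S \<and> key k < key (m i)" if "k \<in> keys h" for k
  proof -
    from that obtain j where "j \<in> I - {i}" "k \<in> keys (g j)"
      unfolding h_def by (elim in_keys_sumE)
    then show ?thesis using lt[of j k] by auto
  qed
  then have nh: "lookup h (m i) = 0" by (auto simp: in_keys_iff)
  have "leads (sum g I) (m i)"
    unfolding leads_def
  proof (intro conjI ballI impI subsetI)
    show "k \<in> S" if "k \<in> keys (sum g I)" for k
      using that kh g[OF i(1)] unfolding gi leads_def by (auto dest!: in_keys_addD)
    show "m i \<in> keys (sum g I)"
      using g[OF i(1)] nh by (simp add: gi in_keys_iff lookup_add leads_def)
    show "key k < key (m i)" if "k \<in> keys (sum g I)" "k \<noteq> m i" for k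
      using that kh g[OF i(1)] unfolding gi leads_def by (auto dest!: in_keys_addD)
  qed
  moreover have "lookup (sum g I) (m i) = lookup (g i) (m i)" by (simp add: gi lookup_add nh)
  ultimately show ?thesis using that i by blast
qed

end


section \<open>Lead monomials in three variables\<close>

lemma UNIV_three: "(UNIV :: 3 set) = {0, 1, 2}"
  using UNIV_3 by auto

lemma three_less: "(0::3) < 1" "(1::3) < 2" "(0::3) < 2"
  by (simp_all add: less_bit1_def bit1.Rep_0 bit1.Rep_1 bit1.Rep_numeral)

lemma three_distinct [simp]: "(0::3) \<noteq> 1" "(0::3) \<noteq> 2" "(1::3) \<noteq> 2" "(1::3) \<noteq> 0" "(2::3) \<noteq> 0" "(2::3) \<noteq> 1"
  using three_less by auto

lemma three_cases [case_names zero one two]: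
  fixes v :: 3 obtains "v = 0" | "v = 1" | "v = 2"
  using UNIV_three by (metis UNIV_I insertE empty_iff)

lemma all_three: "(\<forall>v::3. P v) \<longleftrightarrow> P 0 \<and> P 1 \<and> P 2"
  by (metis UNIV_I UNIV_three emptyE insertE)

lemma mdeg_superset: "finite S \<Longrightarrow> keys m \<subseteq> S \<Longrightarrow> mdeg m = (\<Sum>v\<in>S. lookup m v)"
  unfolding mdeg_def by (rule sum.mono_neutral_left) (auto simp: in_keys_iff)

lemma mdeg_add: "mdeg (m + n) = mdeg m + mdeg n"
proof -
  have "keys (m + n) \<subseteq> keys m \<union> keys n" by (rule Poly_Mapping.keys_add)
  then show ?thesis
    by (simp add: mdeg_superset[where S = "keys m \<union> keys n"] lookup_add sum.distrib)
qed

lemma mdeg_single [simp]: "mdeg (single v k) = k"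
  by (simp add: mdeg_superset[where S = "{v}"])

lemma mdeg_three: "mdeg (m :: 3 monom) = lookup m 0 + lookup m 1 + lookup m 2"
proof -
  have "mdeg m = sum (lookup m) UNIV" by (rule mdeg_superset) auto
  also have "\<dots> = lookup m 0 + (lookup m 1 + lookup m 2)" unfolding UNIV_three by simp
  finally show ?thesis by simp
qed

text \<open>Among monomials of equal degree, a smaller exponent of \<open>x\<close> means a larger total exponent of
  \<open>y\<close> and \<open>z\<close>, so the graded reverse lexicographic order compares these additive data
  lexicographically.\<close>

definition gkey :: "3 monom \<Rightarrow> nat \<times> nat \<times> nat" where
  "gkey m = (mdeg m, lookup m 1 + lookup m 2, lookup m 2)"

lemma monom_three_eqI:
  "lookup m 0 = lookup n 0 \<Longrightarrow> lookup m 1 = lookup n 1 \<Longrightarrow> lookup m 2 = lookup n 2 \<Longrightarrow> m = n"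
  for m n :: "3 monom"
  using all_three[of "\<lambda>v. lookup m v = lookup n v"] by (blast intro: poly_mapping_eqI)

interpretation G: monomial_key gkey UNIV
proof
  show "inj_on gkey UNIV"
  proof (rule inj_onI)
    fix m n assume "gkey m = gkey n"
    then have "mdeg m = mdeg n" "lookup m 1 + lookup m 2 = lookup n 1 + lookup n 2" "lookup m 2 = lookup n 2"
      by (simp_all add: gkey_def)
    then show "m = n" by (intro monom_three_eqI) (simp_all add: mdeg_three)
  qed
  show "gkey (m + k) < gkey (n + k)" if "gkey m < gkey n" for m n k
    using that by (simp add: gkey_def mdeg_add lookup_add less_prod_def' algebra_simps)
qed simp

lemma grevlex_less_iff: "grevlex_less m n \<longleftrightarrow> gkey m < gkey n"
proof -
  have e: "(\<exists>v. Q v) \<longleftrightarrow> Q 0 \<or> Q 1 \<or> Q 2" for Q :: "3 \<Rightarrow> bool"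
  proof
    assume "\<exists>v. Q v"
    then obtain v where "Q v" ..
    then show "Q 0 \<or> Q 1 \<or> Q 2" by (cases v rule: three_cases) simp_all
  qed auto
  have l: "(w < 0) = False" "(w < 1) = (w = 0)" "(w < 2) = (w = 0 \<or> w = 1)" for w :: 3
    using three_less by (cases w rule: three_cases; auto)+
  show ?thesis
    unfolding grevlex_less_def gkey_def less_prod_def' e l mdeg_three by auto
qed

lemma lead_exp_eqI: "G.leads f m \<Longrightarrow> lead_exp f = m"
  unfolding lead_exp_def grevlex_less_iff
proof (rule the_equality)
  assume l: "G.leads f m"
  then show "m \<in> keys f \<and> (\<forall>n\<in>keys f. n = m \<or> gkey n < gkey m)"
    unfolding G.leads_def by blast
  show "n = m" if "n \<in> keys f \<and> (\<forall>k\<in>keys f. k = n \<or> gkey k < gkey n)" for n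
    using that l unfolding G.leads_def by (metis less_asym)
qed

lemma leads_lead_exp: "f \<noteq> 0 \<Longrightarrow> G.leads f (lead_exp f)"
  by (rule G.leads_exists[of f]) (auto simp: lead_exp_eqI)

lemma LM_eq: "G.leads f m \<Longrightarrow> LM f = single m 1"
  by (simp add: LM_def lead_exp_eqI)

lemma LT_eq: "G.leads f m \<Longrightarrow> LT f = single m (lookup f m)"
  by (simp add: LT_def lead_exp_eqI)

lemma Var_nonzero [simp]: "Var v \<noteq> (0 :: ('v, 'a::comm_ring_1) mpoly)"
  by (metis Var_def lookup_single_eq lookup_zero zero_neq_one)

lemma X_power: "X ^ n = (single (single 0 n) 1 :: (3, 'a::comm_ring_1) mpoly)"
  and Y_power: "Y ^ n = (single (single 1 n) 1 :: (3, 'a::comm_ring_1) mpoly)"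
  and Z_power: "Z ^ n = (single (single 2 n) 1 :: (3, 'a::comm_ring_1) mpoly)"
  by (simp_all add: single_monom_eval)

definition homog :: "nat \<Rightarrow> ('v, 'a::comm_ring_1) mpoly \<Rightarrow> bool" where
  "homog n f \<longleftrightarrow> (\<forall>m\<in>keys f. mdeg m = n)"

lemma homog_add: "homog n f \<Longrightarrow> homog n g \<Longrightarrow> homog n (f + g)"
  unfolding homog_def by (auto dest!: in_keys_addD)

lemma homog_uminus: "homog n f \<Longrightarrow> homog n (- f)"
  by (simp add: homog_def in_keys_iff)

lemma homog_diff: "homog n f \<Longrightarrow> homog n g \<Longrightarrow> homog n (f - g)"
  using homog_add[OF _ homog_uminus, of n f g] by simp

lemma homog_mult: "homog m f \<Longrightarrow> homog n g \<Longrightarrow> homog (m + n) (f * g)"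
  unfolding homog_def by (auto elim!: in_keys_multE simp: mdeg_add)

lemma homog_Const: "homog 0 (Const c)"
  by (simp add: homog_def Const_def mdeg_def)

lemma homog_Var: "homog 1 (Var v)"
  by (simp add: homog_def Var_def)

lemma homog_Const_mult: "homog n f \<Longrightarrow> homog n (Const c * f)"
  using homog_mult[OF homog_Const] by force

lemma homog_power: "homog n f \<Longrightarrow> homog (k * n) (f ^ k)"
proof (induction k)
  case 0
  then show ?case using homog_Const[of 1] by simp
next
  case (Suc k)
  then show ?case using homog_mult[of n f "k * n" "f ^ k"] by simp
qed

lemma homog_Var_power: "homog k (Var v ^ k)"
  using homog_power[OF homog_Var, of k] by simp

lemma homog_prod: "finite I \<Longrightarrow> (\<And>i. i \<in> I \<Longrightarrow> homog n (f i)) \<Longrightarrow> homog (card I * n) (prod f I)"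
proof (induction I rule: finite_induct)
  case empty
  then show ?case using homog_Const[of 1] by simp
next
  case (insert x F)
  then show ?case using homog_mult[of n "f x" "card F * n" "prod f F"] by simp
qed

lemma homog_X_power_cancel:
  assumes "homog (n + k) (f * X ^ k)"
  shows "homog n (f :: (3, 'a::idom) mpoly)"
  unfolding homog_def
proof
  fix m assume m: "m \<in> keys f"
  have "lookup (f * X ^ k) (m + single 0 k) = lookup f m"
    unfolding X_power
    by (induction f rule: mpoly_induct)
       (simp_all add: distrib_right lookup_add mult_single lookup_single when_def)
  with m have "m + single 0 k \<in> keys (f * X ^ k)" by (simp add: in_keys_iff)
  with assms have "mdeg (m + single 0 k) = n + k" by (auto simp: homog_def)
  then show "mdeg m = n" by (simp add: mdeg_add)
qed

lemma X_dvd_keys: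
  assumes "X dvd (f :: (3, 'a::comm_ring_1) mpoly)" "m \<in> keys f"
  shows "lookup m 0 > 0"
  using assms by (auto simp: dvd_def Var_def elim!: in_keys_multE split: if_splits simp: lookup_add)

text \<open>Reducing modulo \<open>x\<close> determines the lead term of a homogeneous polynomial that
  \<open>x\<close> does not divide.\<close>

lemma leads_Y_power:
  fixes f :: "(3, 'a::comm_ring_1) mpoly"
  assumes "homog n f" "X dvd f - Y ^ n"
  shows "G.leads f (single 1 n)" "lookup f (single 1 n) = 1"
proof -
  define h where "h = f - Y ^ n"
  have f: "f = Y ^ n + h" by (simp add: h_def)
  have h0: "lookup m 0 > 0" if "m \<in> keys h" for m
    using that X_dvd_keys assms(2) unfolding h_def by blast
  have "lookup h (single 1 n) = 0"
    using h0[of "single 1 n"] by (auto simp: in_keys_iff lookup_single)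
  then show l: "lookup f (single 1 n) = 1" by (simp add: f lookup_add Y_power)
  have "gkey m < gkey (single 1 n)" if "m \<in> keys f" "m \<noteq> single 1 n" for m
  proof -
    have "m \<in> keys h" using that unfolding f by (auto simp: Y_power dest!: in_keys_addD split: if_splits)
    moreover have "mdeg m = n" using that assms(1) by (auto simp: homog_def)
    ultimately show ?thesis
      using h0[of m] by (simp add: gkey_def less_prod_def' lookup_single mdeg_three[of m])
  qed
  with l show "G.leads f (single 1 n)" by (auto simp: G.leads_def in_keys_iff)
qed


section \<open>The group action as translations\<close>

definition translate :: "'a \<Rightarrow> 'a \<Rightarrow> (3, 'a::field) mpoly \<Rightarrow> (3, 'a) mpoly" where
  "translate a b = subst (\<lambda>v. if v = 0 then X else if v = 1 then Y + Const a * X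
     else Z + Const (2 * a) * Y + Const (a\<^sup>2 + b) * X)"

lemma translate_Var [simp]:
  "translate a b X = X" "translate a b Y = Y + Const a * X"
  "translate a b Z = Z + Const (2 * a) * Y + Const (a\<^sup>2 + b) * X"
  by (simp_all add: translate_def)

lemma translate_Const [simp]: "translate a b (Const c) = Const c" by (simp add: translate_def)
lemma translate_one [simp]: "translate a b 1 = 1" by (simp add: translate_def)
lemma translate_zero [simp]: "translate a b 0 = 0" by (simp add: translate_def)
lemma translate_add: "translate a b (f + g) = translate a b f + translate a b g" by (simp add: translate_def subst_add)
lemma translate_diff: "translate a b (f - g) = translate a b f - translate a b g" by (simp add: translate_def subst_diff)
lemma translate_mult: "translate a b (f * g) = translate a b f * translate a b g" by (simp add: translate_def subst_mult)
lemma translate_power: "translate a b (f ^ n) = translate a b f ^ n" by (simp add: translate_def subst_power)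
lemma translate_sum: "translate a b (sum f A) = (\<Sum>x\<in>A. translate a b (f x))" by (simp add: translate_def subst_sum)
lemma translate_prod: "translate a b (prod f A) = (\<Prod>x\<in>A. translate a b (f x))" by (simp add: translate_def subst_prod)
lemmas translate_simps = translate_add translate_diff translate_mult translate_power

lemma translate_translate: "translate a' b' (translate a b f) = translate (a + a') (b + b') f"
proof -
  have "translate a' b' (translate a b (Var v)) = translate (a + a') (b + b') (Var v)" for v
  proof (cases v rule: three_cases)
    case zero
    then show ?thesis by simp
  next
    case one
    then show ?thesis by (simp add: translate_simps Const_add distrib_right add.commute)
  next
    case two
    have "(a + a')\<^sup>2 + (b + b') = (a'\<^sup>2 + b') + (2 * a) * a' + (a\<^sup>2 + b)"
      by (simp add: power2_sum)
    then have e: "Const ((a + a')\<^sup>2 + (b + b')) = Const (a'\<^sup>2 + b') + Const (2 * a) * Const a' + Const (a\<^sup>2 + b)"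
      by (simp only: Const_add Const_mult)
    have u: "Const (2 * (a + a')) = Const (2 * a) + Const (2 * a')"
      by (simp only: Const_add Const_mult distrib_left)
    have r: "z + u' * y + e' * x + u * (y + w * x) + e * x = z + (u + u') * y + (e' + u * w + e) * x"
      for z u' y e' x u w e :: "(3, 'a) mpoly"
      by (simp add: algebra_simps)
    show ?thesis
      unfolding two translate_Var translate_add translate_mult translate_Const e u by (rule r)
  qed
  then show ?thesis
    unfolding translate_def subst_subst by (simp add: translate_def)
qed

lemma translate_0_0: "translate 0 0 f = f"
proof -
  have "(\<lambda>v. if v = 0 then X else if v = 1 then Y + Const 0 * X
     else Z + Const (2 * 0) * Y + Const (0\<^sup>2 + 0) * X) = (Var :: 3 \<Rightarrow> (3, 'a) mpoly)"
  proof (rule ext)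
    show "(if v = 0 then X else if v = 1 then Y + Const 0 * X
     else Z + Const (2 * 0) * Y + Const (0\<^sup>2 + 0) * X) = (Var v :: (3, 'a) mpoly)" for v
      by (cases v rule: three_cases) simp_all
  qed
  then show ?thesis unfolding translate_def using subst_Var_id by metis
qed

lemma translate_funpow: "(translate a b ^^ n) f = translate (of_nat n * a) (of_nat n * b) f"
  by (induction n) (simp_all add: translate_0_0 translate_translate algebra_simps)

lemma shifted_discriminant:
  "(y + a * x) * (y + a * x) - x * (z + (a + a) * y + (a * a + b) * x) = y * y - x * z - b * (x * x)"
  for x y z a b :: "'b::comm_ring_1"
  by (simp add: algebra_simps)

text \<open>This is why \<open>\<delta>\<close> is a better coordinate than \<open>z\<close>: it is merely
  translated.\<close>

lemma translate_delta: "translate a b \<delta> = \<delta> - Const b * X\<^sup>2"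
proof -
  have c: "Const (2 * a) = Const a + Const a" "Const (a * a + b) = Const a * Const a + Const b"
    by (simp_all only: mult_2 power2_eq_square Const_add Const_mult)
  show ?thesis
    unfolding \<delta>_def translate_diff translate_mult translate_power translate_Var c power2_eq_square by (rule shifted_discriminant)
qed

text \<open>Up to powers of \<open>x\<close> and a sign, the group element \<open>g\<close> translates \<open>(y,
  \<delta>)\<close> by the vector with components \<open>shift M g 1\<close> and \<open>shift M g 2\<close>.\<close>

definition shift :: "'a::field ^ 4 ^ 2 \<Rightarrow> (4 \<Rightarrow> int) \<Rightarrow> 2 \<Rightarrow> 'a" where
  "shift M g i = (\<Sum>j\<in>UNIV. of_int (g j) * M $ i $ j)"

definition shifts :: "nat \<Rightarrow> 'a::field ^ 4 ^ 2 \<Rightarrow> ('a \<times> 'a) set" where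
  "shifts p M = (\<lambda>g. (shift M g 1, shift M g 2)) ` carrier (E_grp p)"

lemma carrier_E_grp: "p > 0 \<Longrightarrow> carrier (E_grp p) = {g. \<forall>j. 0 \<le> g j \<and> g j < int p}"
  by (simp add: E_grp_def carrier_integer_mod_group PiE_def Pi_def extensional_def)

lemma act_eq_translate:
  assumes "p > 0" "g \<in> carrier (E_grp p)"
  shows "act M f g = translate (shift M g 1) (shift M g 2) f"
proof -
  have ag: "act_gen M j = translate (M $ 1 $ j) (M $ 2 $ j)" for j
    by (simp add: act_gen_def translate_def)
  have "of_nat (nat (g j)) = (of_int (g j) :: 'a)" for j
    using assms carrier_E_grp by (auto simp: of_nat_nat)
  then show ?thesis
    unfolding act_def ag translate_funpow translate_translate shift_def sum_4 by simp
qed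

lemma invariants_iff:
  assumes "p > 0"
  shows "f \<in> invariants p M \<longleftrightarrow> (\<forall>(a, b)\<in>shifts p M. translate a b f = f)"
  using act_eq_translate[OF assms, of _ M f] by (auto simp: invariants_def shifts_def)

lemma orbit_prod_eq:
  assumes "p > 0"
  shows "orbit_prod p M f = \<Prod> ((\<lambda>(a, b). translate a b f) ` shifts p M)"
  unfolding orbit_prod_def shifts_def image_image
  using act_eq_translate[OF assms, of _ M f] by (auto intro!: arg_cong[where f = "\<lambda>A. \<Prod>A"] image_cong)


section \<open>Minors and linear algebra over the prime field\<close>

lemma vector_four [simp]:
  "(vector [a, b, c, d] :: 'b::zero ^ 4) $ 1 = a" "(vector [a, b, c, d] :: 'b ^ 4) $ 2 = b"
  "(vector [a, b, c, d] :: 'b ^ 4) $ 3 = c" "(vector [a, b, c, d] :: 'b ^ 4) $ 4 = d"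
  unfolding vector_def by simp_all

lemma det_4:
  fixes A :: "'b::comm_ring_1 ^ 4 ^ 4"
  shows "det A =
    A$1$1 * (A$2$2 * (A$3$3 * A$4$4 - A$3$4 * A$4$3) - A$2$3 * (A$3$2 * A$4$4 - A$3$4 * A$4$2)
      + A$2$4 * (A$3$2 * A$4$3 - A$3$3 * A$4$2))
  - A$1$2 * (A$2$1 * (A$3$3 * A$4$4 - A$3$4 * A$4$3) - A$2$3 * (A$3$1 * A$4$4 - A$3$4 * A$4$1)
      + A$2$4 * (A$3$1 * A$4$3 - A$3$3 * A$4$1))
  + A$1$3 * (A$2$1 * (A$3$2 * A$4$4 - A$3$4 * A$4$2) - A$2$2 * (A$3$1 * A$4$4 - A$3$4 * A$4$1)
      + A$2$4 * (A$3$1 * A$4$2 - A$3$2 * A$4$1))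
  - A$1$4 * (A$2$1 * (A$3$2 * A$4$3 - A$3$3 * A$4$2) - A$2$2 * (A$3$1 * A$4$3 - A$3$3 * A$4$1)
      + A$2$3 * (A$3$1 * A$4$2 - A$3$2 * A$4$1))"
proof -
  have f: "finite {2::4, 3, 4}" "1 \<notin> {2::4, 3, 4}" "finite {3::4, 4}" "2 \<notin> {3::4, 4}"
    "finite {4::4}" "3 \<notin> {4::4}"
    by auto
  show ?thesis
    unfolding det_def UNIV_4
    unfolding sum_over_permutations_insert[OF f(1,2)]
    unfolding sum_over_permutations_insert[OF f(3,4)]
    unfolding sum_over_permutations_insert[OF f(5,6)]
    unfolding permutes_sing
    by (simp add: sign_swap_id permutation_swap_id permutation_compose sign_compose sign_id swap_id_eq algebra_simps)
qed

text \<open>This is the expansion of a determinant of size five, whose rows are the five vectors with the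
  \<open>j\<close>-th entry repeated, along the repeated column.\<close>

lemma minors_relation:
  fixes r s t u v :: "'b::comm_ring_1 ^ 4"
  shows "r $ j * det (vector [s, t, u, v] :: 'b ^ 4 ^ 4) - s $ j * det (vector [r, t, u, v] :: 'b ^ 4 ^ 4)
    + t $ j * det (vector [r, s, u, v] :: 'b ^ 4 ^ 4) - u $ j * det (vector [r, s, t, v] :: 'b ^ 4 ^ 4)
    + v $ j * det (vector [r, s, t, u] :: 'b ^ 4 ^ 4) = 0"
  using exhaust_4[of j] unfolding det_4 vector_four by (elim disjE) (simp_all add: algebra_simps)


lemma CHAR_mpoly: "CHAR(('v, 'a::field) mpoly) = CHAR('a)"
proof (rule CHAR_eqI)
  have e: "of_nat n = (Const (of_nat n) :: ('v, 'a) mpoly)" for n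
    by (simp add: Const_def)
  show "of_nat CHAR('a) = (0 :: ('v, 'a) mpoly)" by (simp add: e)
  show "CHAR('a) dvd n" if "of_nat n = (0 :: ('v, 'a) mpoly)" for n
    using that by (simp add: e of_nat_eq_0_iff_char_dvd)
qed

lemma of_int_power_CHAR:
  fixes n :: int
  assumes "prime p" "CHAR('a::comm_ring_1) = p"
  shows "(of_int n :: 'a) ^ p = of_int n"
proof -
  have nat: "(of_nat k :: 'a) ^ p = of_nat k" for k
    using assms prime_gt_0_nat[of p] by (induction k) (simp_all add: freshmans_dream zero_power)
  show ?thesis
  proof (cases "n \<ge> 0")
    case True
    then show ?thesis using nat[of "nat n"] by simp
  next
    case False
    then have "(of_int n :: 'a) = - of_nat (nat (- n))" by simp
    moreover have "(- x :: 'a) ^ p = - (x ^ p)" for x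
      using minus_power_prime_CHAR[of p x] assms by simp
    ultimately show ?thesis using nat by simp
  qed
qed

lemma of_int_power_CHAR_power:
  fixes n :: int
  assumes "prime p" "CHAR('a::comm_ring_1) = p"
  shows "(of_int n :: 'a) ^ (p ^ k) = of_int n"
  by (induction k) (simp_all add: power_mult of_int_power_CHAR[OF assms])

locale rank_four_action =
  fixes p :: nat and M :: "'a::field ^ 4 ^ 2"
  assumes prime_p: "prime p" and p_gt_2: "p > 2" and char_p: "CHAR('a) = p"
    and \<gamma>1234: "\<gamma> p M 1 2 3 4 = 0" and \<gamma>1235: "\<gamma> p M 1 2 3 5 \<noteq> 0" and \<gamma>1357: "\<gamma> p M 1 3 5 7 = 0"
begin

abbreviation "W \<equiv> shifts p M"
abbreviation "A \<equiv> fst ` W"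

lemma p_pos: "p > 0" using p_gt_2 by simp

lemma odd_p: "odd p" using prime_p p_gt_2 prime_odd_nat by simp

lemma minus_power_p: "(- x :: 'b::comm_ring_1) ^ (p ^ k) = - (x ^ (p ^ k))"
  using odd_p by (simp add: power_minus_odd)

lemma freshman_mpoly: "(f + g :: ('v, 'a) mpoly) ^ (p ^ k) = f ^ (p ^ k) + g ^ (p ^ k)"
  using freshmans_dream'[of "p ^ k" k f g] prime_p char_p CHAR_mpoly[where ?'a = 'a and ?'v = 'v] by simp

lemma freshman_mpoly_diff: "(f - g :: ('v, 'a) mpoly) ^ (p ^ k) = f ^ (p ^ k) - g ^ (p ^ k)"
  using freshman_mpoly[of f "- g" k] by (simp add: minus_power_p)

lemma shift_diff: "shift M (\<lambda>j. g j - h j) i = shift M g i - shift M h i"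
  by (simp add: shift_def sum_subtractf algebra_simps)

text \<open>The Frobenius map is additive and fixes the integers, so it commutes with integral combinations of the
  columns.\<close>

lemma row_dot_odd: "(\<Sum>j\<in>UNIV. of_int (g j) * Gamma_row p M (2 * k + 1) $ j) = shift M g 1 ^ (p ^ k)"
  using freshmans_dream_sum'[of "p ^ k" k "\<lambda>j. of_int (g j) * M $ 1 $ j" UNIV] prime_p char_p
  by (simp add: Gamma_row_def shift_def power_mult_distrib of_int_power_CHAR_power)

lemma row_dot_even: "(\<Sum>j\<in>UNIV. of_int (g j) * Gamma_row p M (2 * k + 2) $ j) = shift M g 2 ^ (p ^ k)"
  using freshmans_dream_sum'[of "p ^ k" k "\<lambda>j. of_int (g j) * M $ 2 $ j" UNIV] prime_p char_p
  by (simp add: Gamma_row_def shift_def power_mult_distrib of_int_power_CHAR_power)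

lemma row_dot:
  "(\<Sum>j\<in>UNIV. of_int (g j) * Gamma_row p M 1 $ j) = shift M g 1"
  "(\<Sum>j\<in>UNIV. of_int (g j) * Gamma_row p M 2 $ j) = shift M g 2"
  "(\<Sum>j\<in>UNIV. of_int (g j) * Gamma_row p M 3 $ j) = shift M g 1 ^ p"
  "(\<Sum>j\<in>UNIV. of_int (g j) * Gamma_row p M 4 $ j) = shift M g 2 ^ p"
  "(\<Sum>j\<in>UNIV. of_int (g j) * Gamma_row p M 5 $ j) = shift M g 1 ^ (p\<^sup>2)"
  "(\<Sum>j\<in>UNIV. of_int (g j) * Gamma_row p M 7 $ j) = shift M g 1 ^ (p ^ 3)"
  using row_dot_odd[of g 0] row_dot_even[of g 0] row_dot_odd[of g 1] row_dot_even[of g 1]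
    row_dot_odd[of g 2] row_dot_odd[of g 3]
  by (simp_all flip: numeral_2_eq_2)

text \<open>The four rows form a square matrix whose determinant
  \<open>\<gamma>\<^sub>1\<^sub>2\<^sub>3\<^sub>5\<close> does not vanish.\<close>

lemma row_kernel:
  assumes "\<And>r. r \<in> {1, 2, 3, 5} \<Longrightarrow> (\<Sum>j\<in>UNIV. e j * Gamma_row p M r $ j) = 0"
  shows "e j = 0"
proof -
  define B :: "'a ^ 4 ^ 4" where "B = vector [Gamma_row p M 1, Gamma_row p M 2, Gamma_row p M 3, Gamma_row p M 5]"
  have "det B \<noteq> 0" using \<gamma>1235 by (simp add: \<gamma>_def B_def)
  then have inv: "invertible B" by (simp add: invertible_det_nz)
  have "\<forall>i. (B *v (\<chi> j. e j)) $ i = 0"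
    unfolding forall_4 using assms[of 1] assms[of 2] assms[of 3] assms[of 5]
    by (simp add: B_def matrix_vector_mult_def mult.commute)
  then have "B *v (\<chi> j. e j) = 0" by (simp add: vec_eq_iff)
  then have "(\<chi> j. e j) = (0 :: 'a ^ 4)"
    using inv matrix_left_invertible_ker[of B] by (auto simp: invertible_left_inverse)
  then show ?thesis by (simp add: vec_eq_iff)
qed

lemma shift_zero_imp:
  assumes "shift M g 1 = 0" "shift M g 2 = 0"
  shows "of_int (g j) = (0 :: 'a)"
  by (rule row_kernel) (use assms p_pos in \<open>auto simp: row_dot[simplified]\<close>)

lemma carrier_eqI:
  assumes "g \<in> carrier (E_grp p)" "h \<in> carrier (E_grp p)" "of_int (g j - h j) = (0 :: 'a)"
  shows "g j = h j"
proof -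
  have "int p dvd g j - h j" using assms(3) of_int_eq_0_iff_char_dvd[where ?'a = 'a, of "g j - h j"] char_p by simp
  moreover have "0 \<le> g j" "g j < int p" "0 \<le> h j" "h j < int p"
    using assms carrier_E_grp[OF p_pos] by auto
  ultimately show ?thesis
    using zdvd_imp_le[of "int p" "g j - h j"] zdvd_imp_le[of "int p" "h j - g j"]
    by (smt (verit) dvd_diff_commute)
qed

text \<open>The representation is faithful: if both shifts of an integral combination of the columns vanish, then by
  \<open>row_dot\<close> its coefficient vector lies in the kernel of the rows 1, 2, 3 and 5.\<close>

lemma shift_inj: "inj_on (\<lambda>g. (shift M g 1, shift M g 2)) (carrier (E_grp p))"
proof (rule inj_onI, rule ext)
  fix g h j
  assume gh: "g \<in> carrier (E_grp p)" "h \<in> carrier (E_grp p)"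
    and "(shift M g 1, shift M g 2) = (shift M h 1, shift M h 2)"
  then have "of_int (g j - h j) = (0 :: 'a)"
    using shift_zero_imp[of "\<lambda>j. g j - h j" j] by (simp add: shift_diff)
  then show "g j = h j" using gh carrier_eqI by blast
qed

lemma card_carrier: "card (carrier (E_grp p)) = p ^ 4" and finite_carrier: "finite (carrier (E_grp p))"
proof -
  have e: "carrier (E_grp p) = PiE UNIV (\<lambda>_. {0..<int p})"
    unfolding carrier_E_grp[OF p_pos] by (rule Set.set_eqI) (simp only: PiE_iff mem_Collect_eq
        atLeastLessThan_iff extensional_UNIV UNIV_I simp_thms ball_simps Ball_def)
  have "card (PiE UNIV (\<lambda>_ :: 4. {0..<int p})) = (\<Prod>i\<in>(UNIV :: 4 set). card {0..<int p})"
    by (rule card_PiE) simp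
  also have "\<dots> = p ^ 4" unfolding prod_constant by simp
  finally show "card (carrier (E_grp p)) = p ^ 4" unfolding e .
  show "finite (carrier (E_grp p))" unfolding e by (rule finite_PiE) simp_all
qed

lemma card_W: "card W = p ^ 4" and finite_W: "finite W"
  using card_image[OF shift_inj] card_carrier finite_carrier by (simp_all add: shifts_def)

lemma W_add:
  assumes "(a, b) \<in> W" "(a', b') \<in> W"
  shows "(a + a', b + b') \<in> W"
proof -
  from assms obtain g h where gh: "a = shift M g 1" "b = shift M g 2" "a' = shift M h 1" "b' = shift M h 2"
    unfolding shifts_def by blast
  \<comment> \<open>Exponents of group elements are reduced modulo \<open>p\<close>, which does not change their images in the field.\<close>
  define k where "k = (\<lambda>j. (g j + h j) mod int p)"
  have "of_int (k j) = (of_int (g j) + of_int (h j) :: 'a)" for j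
  proof -
    have "(of_int (g j + h j) :: 'a) = of_int (int p * ((g j + h j) div int p) + k j)"
      by (simp add: k_def)
    also have "\<dots> = of_int (k j)" using char_p of_nat_CHAR[where ?'a = 'a] by simp
    finally show ?thesis by simp
  qed
  then have "shift M k i = shift M g i + shift M h i" for i
    by (simp add: shift_def distrib_right sum.distrib)
  moreover have "k \<in> carrier (E_grp p)"
    using p_pos by (simp add: carrier_E_grp k_def)
  ultimately show ?thesis unfolding shifts_def gh by (metis (no_types, lifting) rev_image_eqI)
qed

lemma W_zero: "(0, 0) \<in> W"
  unfolding shifts_def using p_pos
  by (intro image_eqI[of _ _ "\<lambda>_. 0"]) (auto simp: shift_def carrier_E_grp)

text \<open>The difference of two group elements with the same first shift is killed by rows 1, 3 and 5. By
  \<open>row_kernel\<close> their common kernel is at most a line, so a difference \<open>e\<close> is a multiple of a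
  fixed difference \<open>d\<close>, and a single coordinate, which takes at most \<open>p\<close> values, determines
  a group element.\<close>

lemma card_fibre_le: "card (W `` {a}) \<le> p"
proof -
  define F where "F = {g \<in> carrier (E_grp p). shift M g 1 = a}"
  have fF: "finite F" using finite_carrier by (simp add: F_def)
  have WF: "W `` {a} = (\<lambda>g. shift M g 2) ` F" by (auto simp: F_def shifts_def)
  have "card F \<le> p"
  proof (cases "\<exists>g h. g \<in> F \<and> h \<in> F \<and> g \<noteq> h")
    case False
    then have "card F \<le> 1" using fF by (metis card_le_Suc0_iff_eq One_nat_def)
    then show ?thesis using p_pos by simp
  next
    case True
    then obtain g h where gh: "g \<in> F" "h \<in> F" "g \<noteq> h" by blast
    define d where "d = (\<lambda>j. g j - h j)"
    have d1: "shift M d 1 = 0" using gh by (simp add: d_def shift_diff F_def)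
    obtain i where "g i \<noteq> h i" using gh(3) by (auto simp: fun_eq_iff)
    then have i: "(of_int (d i) :: 'a) \<noteq> 0"
      using gh(1,2) carrier_eqI[of g h i] unfolding d_def F_def by blast
    have d2: "shift M d 2 \<noteq> 0" using shift_zero_imp[OF d1] i by blast
    have "inj_on (\<lambda>g. g i) F"
    proof (rule inj_onI, rule ext)
      fix k l j assume kl: "k \<in> F" "l \<in> F" "k i = l i"
      define e where "e = (\<lambda>j. k j - l j)"
      have e1: "shift M e 1 = 0" using kl by (simp add: e_def shift_diff F_def)
      \<comment> \<open>With this factor, row 2 kills \<open>e - c d\<close> as well.\<close>
      define c where "c = shift M e 2 / shift M d 2"
      have z: "of_int (e j) - c * of_int (d j) = 0" for j
      proof (rule row_kernel)
        fix r :: nat assume r: "r \<in> {1, 2, 3, 5}"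
        have "(\<Sum>j\<in>UNIV. (of_int (e j) - c * of_int (d j)) * Gamma_row p M r $ j)
          = (\<Sum>j\<in>UNIV. of_int (e j) * Gamma_row p M r $ j) - c * (\<Sum>j\<in>UNIV. of_int (d j) * Gamma_row p M r $ j)"
          by (simp add: left_diff_distrib sum_subtractf sum_distrib_left mult.assoc)
        also have "\<dots> = 0"
          using r d1 e1 d2 p_pos row_dot[of e] row_dot[of d] by (auto simp: c_def power_0_left)
        finally show "(\<Sum>j\<in>UNIV. (of_int (e j) - c * of_int (d j)) * Gamma_row p M r $ j) = 0" .
      qed
      have "c = 0" using z[of i] i kl by (simp add: e_def)
      then have "of_int (k j - l j) = (0 :: 'a)" using z[of j] by (simp add: e_def)
      then show "k j = l j" using kl carrier_eqI by (simp add: F_def)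
    qed
    moreover have "(\<lambda>g. g i) ` F \<subseteq> {0..<int p}" using carrier_E_grp[OF p_pos] by (auto simp: F_def)
    ultimately show ?thesis using card_inj_on_le[of "\<lambda>g. g i" F "{0..<int p}"] by simp
  qed
  then show ?thesis unfolding WF using card_image_le[OF fF, of "\<lambda>g. shift M g 2"] by linarith
qed

lemma weighted_minors_relation:
  fixes r s t u v :: "'a ^ 4"
  shows "(\<Sum>j\<in>UNIV. of_int (g j) * r $ j) * det (vector [s, t, u, v] :: 'a ^ 4 ^ 4)
    - (\<Sum>j\<in>UNIV. of_int (g j) * s $ j) * det (vector [r, t, u, v] :: 'a ^ 4 ^ 4)
    + (\<Sum>j\<in>UNIV. of_int (g j) * t $ j) * det (vector [r, s, u, v] :: 'a ^ 4 ^ 4)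
    - (\<Sum>j\<in>UNIV. of_int (g j) * u $ j) * det (vector [r, s, t, v] :: 'a ^ 4 ^ 4)
    + (\<Sum>j\<in>UNIV. of_int (g j) * v $ j) * det (vector [r, s, t, u] :: 'a ^ 4 ^ 4) = 0"
proof -
  have "0 = (\<Sum>j\<in>UNIV. of_int (g j) * (r $ j * det (vector [s, t, u, v] :: 'a ^ 4 ^ 4)
    - s $ j * det (vector [r, t, u, v] :: 'a ^ 4 ^ 4) + t $ j * det (vector [r, s, u, v] :: 'a ^ 4 ^ 4)
    - u $ j * det (vector [r, s, t, v] :: 'a ^ 4 ^ 4) + v $ j * det (vector [r, s, t, u] :: 'a ^ 4 ^ 4)))"
    unfolding minors_relation by simp
  then show ?thesis
    by (simp only: distrib_left right_diff_distrib sum.distrib sum_subtractf sum_distrib_right mult.assoc)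
qed

text \<open>The vanishing of \<open>\<gamma>\<^sub>1\<^sub>2\<^sub>3\<^sub>4\<close> removes the term
  \<open>a\<^sup>q\<close> with \<open>q = p\<^sup>2\<close> from the relation between the rows 1 to 5. What remains
  is the invariance of \<open>h\<^sub>1\<close>.\<close>

lemma shift_relation:
  assumes "(a, b) \<in> W"
  shows "b ^ p = \<gamma> p M 1 2 4 5 / \<gamma> p M 1 2 3 5 * a ^ p - \<gamma> p M 1 3 4 5 / \<gamma> p M 1 2 3 5 * b
    + \<gamma> p M 2 3 4 5 / \<gamma> p M 1 2 3 5 * a"
proof -
  obtain g where "a = shift M g 1" "b = shift M g 2" using assms by (auto simp: shifts_def)
  then have "a * \<gamma> p M 2 3 4 5 - b * \<gamma> p M 1 3 4 5 + a ^ p * \<gamma> p M 1 2 4 5 - b ^ p * \<gamma> p M 1 2 3 5 = 0"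
    using weighted_minors_relation[of g "Gamma_row p M 1" "Gamma_row p M 2" "Gamma_row p M 3"
      "Gamma_row p M 4" "Gamma_row p M 5"] \<gamma>1234
    unfolding row_dot \<gamma>_def by simp
  then show ?thesis using \<gamma>1235 by (simp add: field_simps)
qed

text \<open>The vanishing of \<open>\<gamma>\<^sub>1\<^sub>3\<^sub>5\<^sub>7\<close> removes the second row from the
  relation between the rows 1, 2, 3, 5 and 7, which leaves a polynomial equation for the first shift alone.\<close>

lemma first_shift_relation:
  assumes "a \<in> A"
  shows "a ^ (p ^ 3) = \<gamma> p M 1 2 3 7 / \<gamma> p M 1 2 3 5 * a ^ (p\<^sup>2) - \<gamma> p M 1 2 5 7 / \<gamma> p M 1 2 3 5 * a ^ p
    - \<gamma> p M 2 3 5 7 / \<gamma> p M 1 2 3 5 * a"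
proof -
  obtain g where "a = shift M g 1" using assms by (auto simp: shifts_def)
  then have "a * \<gamma> p M 2 3 5 7 + a ^ p * \<gamma> p M 1 2 5 7 - a ^ (p\<^sup>2) * \<gamma> p M 1 2 3 7 + a ^ (p ^ 3) * \<gamma> p M 1 2 3 5 = 0"
    using weighted_minors_relation[of g "Gamma_row p M 1" "Gamma_row p M 2" "Gamma_row p M 3"
      "Gamma_row p M 5" "Gamma_row p M 7"] \<gamma>1357
    unfolding row_dot \<gamma>_def by simp
  then have "a ^ (p ^ 3) = (\<gamma> p M 1 2 3 7 * a ^ (p\<^sup>2) - \<gamma> p M 1 2 5 7 * a ^ p - \<gamma> p M 2 3 5 7 * a) / \<gamma> p M 1 2 3 5"
    using \<gamma>1235 by (simp add: nonzero_eq_divide_eq algebra_simps)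
  then show ?thesis by (simp add: diff_divide_distrib)
qed

text \<open>The first shifts are roots of this polynomial of degree \<open>p\<^sup>3\<close>, and there are at most
  \<open>p\<close> shifts over each of them. As there are \<open>p\<^sup>4\<close> shifts, both bounds must be
  attained.\<close>

definition additive_poly :: "'a poly" where
  "additive_poly = monom 1 (p ^ 3) + monom (- (\<gamma> p M 1 2 3 7 / \<gamma> p M 1 2 3 5)) (p\<^sup>2)
    + monom (\<gamma> p M 1 2 5 7 / \<gamma> p M 1 2 3 5) p + monom (\<gamma> p M 2 3 5 7 / \<gamma> p M 1 2 3 5) 1"

lemma p_powers_less: "1 < p" "p < p\<^sup>2" "p\<^sup>2 < p ^ 3" "p < p ^ 3" "1 < p ^ 3" "1 < p\<^sup>2"
proof -
  have s: "p ^ i < p ^ j" if "i < j" for i j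
    using that p_gt_2 by (intro power_strict_increasing) simp_all
  show "1 < p" "p < p\<^sup>2" "p\<^sup>2 < p ^ 3" "p < p ^ 3" "1 < p ^ 3" "1 < p\<^sup>2"
    using s[of 0 1] s[of 1 2] s[of 2 3] s[of 1 3] s[of 0 3] s[of 0 2] by simp_all
qed

lemma finite_A: "finite A" using finite_W by simp

lemma card_A_le: "card A \<le> p ^ 3"
proof -
  have c: "coeff additive_poly (p ^ 3) = 1"
    using p_powers_less by (simp add: additive_poly_def)
  have d: "degree additive_poly \<le> p ^ 3"
    unfolding additive_poly_def using p_powers_less
    by (intro degree_add_le order_trans[OF degree_monom_le]) simp_all
  have nz: "additive_poly \<noteq> 0" using c by auto
  have "A \<subseteq> {a. poly additive_poly a = 0}"
    using first_shift_relation by (auto simp: additive_poly_def poly_monom algebra_simps)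
  then have "card A \<le> card {a. poly additive_poly a = 0}"
    by (intro card_mono poly_roots_finite nz)
  also have "\<dots> \<le> degree additive_poly" by (rule card_poly_roots_bound[OF nz])
  finally show ?thesis using d by simp
qed

lemma sum_fibres: "(\<Sum>a\<in>A. card (W `` {a})) = p ^ 4"
proof -
  have "W = Sigma A (\<lambda>a. W `` {a})" by force
  then have "card W = (\<Sum>a\<in>A. card (W `` {a}))"
    using card_SigmaI[of A "\<lambda>a. W `` {a}"] finite_A finite_W finite_Image by metis
  then show ?thesis using card_W by simp
qed

lemma card_A: "card A = p ^ 3"
proof -
  have "p ^ 4 \<le> (\<Sum>a\<in>A. p)"
    unfolding sum_fibres[symmetric] by (rule sum_mono) (rule card_fibre_le)
  then have "p * p ^ 3 \<le> p * card A" by (simp add: eval_nat_numeral mult.commute)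
  then have "p ^ 3 \<le> card A" using p_pos by simp
  then show ?thesis using card_A_le by simp
qed

lemma card_fibre:
  assumes "a \<in> A"
  shows "card (W `` {a}) = p"
proof (rule ccontr)
  assume "card (W `` {a}) \<noteq> p"
  then have "card (W `` {a}) < p" using card_fibre_le[of a] by simp
  then have "(\<Sum>a\<in>A. card (W `` {a})) < (\<Sum>a\<in>A. p)"
    using assms by (intro sum_strict_mono_ex1 finite_A) (auto intro: card_fibre_le)
  then show False unfolding sum_fibres by (simp add: card_A eval_nat_numeral)
qed


section \<open>The orbit products\<close>

abbreviation "NY \<equiv> orbit_prod p M Y"
abbreviation "NZ \<equiv> orbit_prod p M Z"

lemma Const_add_X_inject: "Y + Const a * X = Y + Const b * X \<longleftrightarrow> a = b" for a b :: 'a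
  by (simp add: Var_def Const_def mult_single) (metis lookup_single_eq)

lemma NY_prod: "NY = (\<Prod>a\<in>A. Y + Const a * X)"
proof -
  have "(\<lambda>(a, b). translate a b Y) ` W = (\<lambda>a. Y + Const a * X) ` A"
    by (force simp: image_image)
  moreover have "inj_on (\<lambda>a :: 'a. Y + Const a * X) A"
    by (rule inj_onI) (simp only: Const_add_X_inject)
  ultimately show ?thesis
    unfolding orbit_prod_eq[OF p_pos] by (simp add: prod.reindex)
qed

lemma two_nonzero: "(2 :: 'a) \<noteq> 0"
proof
  assume "(2 :: 'a) = 0"
  then have "of_nat 2 = (0 :: 'a)" by simp
  then have "p dvd 2" using of_nat_eq_0_iff_char_dvd[where ?'a = 'a, of 2] char_p by simp
  then show False using p_gt_2 by (auto dest: dvd_imp_le)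
qed

lemma NZ_prod: "NZ = (\<Prod>(a, b)\<in>W. translate a b Z)"
proof -
  have "inj_on (\<lambda>(a, b). translate a b Z) W"
  proof (rule inj_onI, clarify)
    fix a b a' b' :: 'a
    assume e: "translate a b Z = translate a' b' Z"
    have s: "single v (Suc 0) = single w (Suc 0) \<longleftrightarrow> v = w" for v w :: 3
      by (metis lookup_single_eq lookup_single_not_eq nat.distinct(1))
    have l: "lookup (translate a b Z) (single 1 1) = 2 * a" "lookup (translate a b Z) (single 0 1) = a\<^sup>2 + b"
      for a b :: 'a
      unfolding translate_Var
      by (simp_all add: Var_def Const_def mult_single lookup_add lookup_single when_def s)
    have "2 * a = 2 * a'" "a\<^sup>2 + b = a'\<^sup>2 + b'" using l[of a b] l[of a' b'] unfolding e by simp_all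
    then show "a = a' \<and> b = b'" using two_nonzero by simp
  qed
  then show ?thesis
    unfolding orbit_prod_eq[OF p_pos] by (simp add: prod.reindex case_prod_beta')
qed

text \<open>The elements \<open>- a x\<close>, with \<open>a\<close> a first shift, are its roots; so its value at
  \<open>y\<close> is the product of the translates of \<open>y\<close>.\<close>

definition homogenised_additive_poly :: "(3, 'a) mpoly poly" where
  "homogenised_additive_poly = monom 1 (p ^ 3)
    + monom (Const (- (\<gamma> p M 1 2 3 7 / \<gamma> p M 1 2 3 5)) * X ^ (p ^ 3 - p\<^sup>2)) (p\<^sup>2)
    + monom (Const (\<gamma> p M 1 2 5 7 / \<gamma> p M 1 2 3 5) * X ^ (p ^ 3 - p)) p
    + monom (Const (\<gamma> p M 2 3 5 7 / \<gamma> p M 1 2 3 5) * X ^ (p ^ 3 - 1)) 1"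

lemma homogenised_additive_poly_eq: "homogenised_additive_poly = (\<Prod>a\<in>A. [:Const a * X, 1:])"
proof (rule poly_eqI_degree_lead_coeff[where n = "p ^ 3" and A = "(\<lambda>a. - (Const a * X)) ` A"])
  have dp: "degree (\<Prod>a\<in>A. [:Const a * X, 1:]) = p ^ 3"
    using card_A by (subst degree_prod_eq_sum_degree) simp_all
  moreover have "lead_coeff (\<Prod>a\<in>A. [:Const a * X, 1 :: (3, 'a) mpoly:]) = 1"
    by (simp add: lead_coeff_prod)
  ultimately show "coeff homogenised_additive_poly (p ^ 3) = coeff (\<Prod>a\<in>A. [:Const a * X, 1:]) (p ^ 3)"
    using p_powers_less by (simp add: homogenised_additive_poly_def)
  show "degree (\<Prod>a\<in>A. [:Const a * X, 1:]) \<le> p ^ 3" using dp by simp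
  have "inj_on (\<lambda>a :: 'a. - (Const a * X :: (3, 'a) mpoly)) A"
    by (rule inj_onI) (use Const_add_X_inject in simp)
  then show "p ^ 3 \<le> card ((\<lambda>a. - (Const a * X :: (3, 'a) mpoly)) ` A)" by (simp add: card_image card_A)
  show "degree homogenised_additive_poly \<le> p ^ 3"
    unfolding homogenised_additive_poly_def using p_powers_less
    by (intro degree_add_le order_trans[OF degree_monom_le]) simp_all
  fix z assume "z \<in> (\<lambda>a. - (Const a * X)) ` A"
  then obtain a where a: "a \<in> A" "z = - (Const a * X)" by blast
  have m: "(- (Const a * X)) ^ (p ^ k) * X ^ (p ^ 3 - p ^ k) = - (Const (a ^ (p ^ k)) * X ^ (p ^ 3))"
    if "k \<le> 3" for k
  proof -
    have "p ^ k \<le> p ^ 3" using that p_pos by (intro power_increasing) simp_all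
    then have "(X :: (3, 'a) mpoly) ^ (p ^ 3) = X ^ (p ^ k) * X ^ (p ^ 3 - p ^ k)" by (simp flip: power_add)
    then show ?thesis unfolding minus_power_p by (simp add: power_mult_distrib Const_power)
  qed
  have X: "X * X ^ (p ^ 3 - Suc 0) = (X :: (3, 'a) mpoly) ^ (p ^ 3)"
    using p_powers_less power_minus_mult[of "p ^ 3" "X :: (3, 'a) mpoly"] by (simp add: mult.commute)
  have "poly homogenised_additive_poly z = (- (Const a * X)) ^ (p ^ 3) * X ^ (p ^ 3 - p ^ 3)
    + Const (- (\<gamma> p M 1 2 3 7 / \<gamma> p M 1 2 3 5)) * ((- (Const a * X)) ^ (p ^ 2) * X ^ (p ^ 3 - p ^ 2))
    + Const (\<gamma> p M 1 2 5 7 / \<gamma> p M 1 2 3 5) * ((- (Const a * X)) ^ (p ^ 1) * X ^ (p ^ 3 - p ^ 1))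
    + Const (\<gamma> p M 2 3 5 7 / \<gamma> p M 1 2 3 5) * ((- (Const a * X)) ^ (p ^ 0) * X ^ (p ^ 3 - p ^ 0))"
    unfolding homogenised_additive_poly_def a by (simp add: poly_monom mult_ac)
  also have "\<dots> = - (Const (a ^ (p ^ 3) + (- (\<gamma> p M 1 2 3 7 / \<gamma> p M 1 2 3 5)) * a ^ (p\<^sup>2)
    + \<gamma> p M 1 2 5 7 / \<gamma> p M 1 2 3 5 * a ^ p + \<gamma> p M 2 3 5 7 / \<gamma> p M 1 2 3 5 * a) * X ^ (p ^ 3))"
    using m[of 3] m[of 2] m[of 1] X unfolding Const_add Const_mult by (simp add: algebra_simps)
  also have "\<dots> = 0" using first_shift_relation[OF a(1)] by (simp add: algebra_simps)
  also have "0 = poly (\<Prod>a\<in>A. [:Const a * X, 1:]) z"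
    unfolding poly_prod using a finite_A by (intro prod_zero[symmetric]) auto
  finally show "poly homogenised_additive_poly z = poly (\<Prod>a\<in>A. [:Const a * X, 1:]) z" .
qed

lemma NY_expand: "NY = Y ^ (p ^ 3) + Const (- (\<gamma> p M 1 2 3 7 / \<gamma> p M 1 2 3 5)) * X ^ (p ^ 3 - p\<^sup>2) * Y ^ (p\<^sup>2)
    + Const (\<gamma> p M 1 2 5 7 / \<gamma> p M 1 2 3 5) * X ^ (p ^ 3 - p) * Y ^ p
    + Const (\<gamma> p M 2 3 5 7 / \<gamma> p M 1 2 3 5) * X ^ (p ^ 3 - 1) * Y"
proof -
  have "NY = poly (\<Prod>a\<in>A. [:Const a * X, 1:]) Y" by (simp add: NY_prod poly_prod add.commute)
  then show ?thesis
    unfolding homogenised_additive_poly_eq[symmetric] homogenised_additive_poly_def by (simp add: poly_monom)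
qed

text \<open>The additive polynomial has distinct roots, so its linear coefficient does not vanish.\<close>

lemma \<gamma>2357: "\<gamma> p M 2 3 5 7 \<noteq> 0"
proof
  assume z: "\<gamma> p M 2 3 5 7 = 0"
  define q where "q = (\<Prod>a\<in>A - {0}. [:Const a * X, 1 :: (3, 'a) mpoly:])"
  have "0 \<in> A" using W_zero by force
  then have "homogenised_additive_poly = [:0, 1:] * q"
    unfolding homogenised_additive_poly_eq q_def using finite_A by (simp add: prod.remove)
  then have "coeff homogenised_additive_poly 1 = coeff q 0" by simp
  also have "coeff q 0 = poly q 0" by (simp add: poly_0_coeff_0)
  also have "\<dots> = (\<Prod>a\<in>A - {0}. Const a * X)" by (simp add: q_def poly_prod)
  also have "\<dots> \<noteq> 0" using finite_A by simp
  finally have "coeff homogenised_additive_poly 1 \<noteq> 0" .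
  moreover have "coeff homogenised_additive_poly 1 = 0"
    using p_powers_less z by (simp add: homogenised_additive_poly_def)
  ultimately show False by simp
qed

end


section \<open>The generators and their lead monomials\<close>

text \<open>The lead terms below are found by reduction modulo powers of \<open>x\<close>, which removes most terms of
  \<open>h\<^sub>1\<close> and of the norm of \<open>y\<close>.\<close>

definition xcong :: "nat \<Rightarrow> (3, 'a::comm_ring_1) mpoly \<Rightarrow> (3, 'a) mpoly \<Rightarrow> bool" where
  "xcong n f g \<longleftrightarrow> X ^ n dvd f - g"

lemma xcong_refl: "xcong n f f" by (simp add: xcong_def)

lemma xcong_trans: "xcong n f g \<Longrightarrow> xcong n g h \<Longrightarrow> xcong n f h"
  unfolding xcong_def using dvd_add[of "X ^ n" "f - g" "g - h"] by simp

lemma xcong_add: "xcong n f g \<Longrightarrow> xcong n f' g' \<Longrightarrow> xcong n (f + f') (g + g')"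
  unfolding xcong_def using dvd_add[of "X ^ n" "f - g" "f' - g'"] by (simp add: algebra_simps)

lemma xcong_diff: "xcong n f g \<Longrightarrow> xcong n f' g' \<Longrightarrow> xcong n (f - f') (g - g')"
  unfolding xcong_def using dvd_diff[of "X ^ n" "f - g" "f' - g'"] by (simp add: algebra_simps)

lemma xcong_mult_left: "xcong n f g \<Longrightarrow> xcong n (h * f) (h * g)"
  unfolding xcong_def by (metis dvd_mult right_diff_distrib)

lemma xcong_mult: "xcong n f g \<Longrightarrow> xcong n f' g' \<Longrightarrow> xcong n (f * f') (g * g')"
  using xcong_trans[of n "f * f'" "f * g'" "g * g'"] xcong_mult_left[of n f' g' f] xcong_mult_left[of n f g g']
  by (simp add: mult.commute)

lemma xcong_power: "xcong n f g \<Longrightarrow> xcong n (f ^ k) (g ^ k)"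
  by (induction k) (simp_all add: xcong_refl xcong_mult)

lemma xcong_X_power_mult: "xcong n f g \<Longrightarrow> xcong (m + n) (X ^ m * f) (X ^ m * g)"
  unfolding xcong_def by (metis mult_dvd_mono dvd_refl power_add right_diff_distrib)

lemma exact_quot_eqI:
  assumes "f = q * g" "g \<noteq> 0"
  shows "exact_quot f g = (q :: ('v::linorder, 'a::idom) mpoly)"
  unfolding exact_quot_def by (rule the_equality) (use assms in auto)

lemma homog_cong: "homog m f \<Longrightarrow> m = n \<Longrightarrow> homog n f" by simp

text \<open>The cancellation in the definition of \<open>h\<^sub>2\<close>: the terms with \<open>u\<close> and
  \<open>v\<close> of the norm of \<open>y\<close> are compensated by the correction terms.\<close>

lemma tails_cancel:
  "s + ((- u * xa * ya + v * xb * yb + w * xc * yc) + (- u * xa * ya + v * xb * yb + w * xc * yc)) * y - s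
    + ((u + u) * (xa * (y * ya)) - (v + v) * (xb * (y * yb))) = (w + w) * xc * (y * yc)"
  for s u v w xa xb xc ya yb yc y :: "'b::comm_ring_1"
  by (simp add: algebra_simps)

context rank_four_action
begin

text \<open>The shifts form a group, so a translation by a shift permutes the orbit.\<close>

lemma orbit_prod_invariant:
  assumes "(a, b) \<in> W"
  shows "translate a b (orbit_prod p M f) = orbit_prod p M f"
proof -
  define B where "B = (\<lambda>(a, b). translate a b f) ` W"
  have fB: "finite B" using finite_W by (simp add: B_def)
  have inj: "inj_on (translate a b) B"
    by (rule inj_on_inverseI[of _ "translate (- a) (- b)"]) (simp add: translate_translate translate_0_0)
  have "translate a b ` B \<subseteq> B"
  proof
    fix g assume "g \<in> translate a b ` B"
    then obtain a' b' where "(a', b') \<in> W" "g = translate a b (translate a' b' f)"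
      unfolding B_def by auto
    then show "g \<in> B" using W_add[of a' b' a b] assms unfolding B_def translate_translate by force
  qed
  then have im: "translate a b ` B = B" using endo_inj_surj[OF fB _ inj] by blast
  have "translate a b (\<Prod>B) = (\<Prod>g\<in>B. translate a b g)" by (simp add: translate_prod)
  also have "\<dots> = \<Prod>(translate a b ` B)" using prod.reindex[OF inj, of "\<lambda>g. g"] by simp
  finally show ?thesis unfolding orbit_prod_eq[OF p_pos] B_def[symmetric] im .
qed

lemma h1_invariant:
  assumes "(a, b) \<in> W"
  shows "translate a b (h1 p M) = h1 p M"
proof -
  let ?\<alpha> = "\<gamma> p M 1 2 4 5 / \<gamma> p M 1 2 3 5" and ?\<beta> = "\<gamma> p M 1 3 4 5 / \<gamma> p M 1 2 3 5"
    and ?\<kappa> = "\<gamma> p M 2 3 4 5 / \<gamma> p M 1 2 3 5"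
  have d: "(\<delta> - Const b * X\<^sup>2) ^ p = \<delta> ^ p - Const (b ^ p) * X ^ (2 * p)"
    using freshman_mpoly_diff[of \<delta> "Const b * X\<^sup>2" 1]
    by (simp add: power_mult_distrib Const_power flip: power_mult)
  have y: "(Y + Const a * X) ^ p = Y ^ p + Const (a ^ p) * X ^ p"
    using freshman_mpoly[of Y "Const a * X" 1] by (simp add: power_mult_distrib Const_power)
  have x: "X ^ p * X ^ p = X ^ (2 * p)" "X\<^sup>2 * X ^ (2 * p - 2) = X ^ (2 * p)" "X * X ^ (2 * p - 1) = (X :: (3, 'a) mpoly) ^ (2 * p)"
  proof -
    have "p + p = 2 * p" "2 + (2 * p - 2) = 2 * p" "1 + (2 * p - 1) = 2 * p" using p_gt_2 by simp_all
    then show "X ^ p * X ^ p = X ^ (2 * p)" "X\<^sup>2 * X ^ (2 * p - 2) = X ^ (2 * p)"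
      "X * X ^ (2 * p - 1) = (X :: (3, 'a) mpoly) ^ (2 * p)"
      by (metis power_add power_one_right)+
  qed
  have "translate a b (h1 p M) - h1 p M = (- Const (b ^ p)) * X ^ (2 * p) + Const (?\<alpha> * a ^ p) * (X ^ p * X ^ p)
    - Const (?\<beta> * b) * (X\<^sup>2 * X ^ (2 * p - 2)) + Const (?\<kappa> * a) * (X * X ^ (2 * p - 1))"
    unfolding h1_def translate_add translate_mult translate_power translate_Const translate_Var translate_delta d y
    unfolding Const_mult by (simp only: algebra_simps) simp
  also have "\<dots> = Const (- (b ^ p) + ?\<alpha> * a ^ p - ?\<beta> * b + ?\<kappa> * a) * X ^ (2 * p)"
    unfolding x Const_add Const_minus Const_uminus by (simp add: algebra_simps)
  also have "- (b ^ p) + ?\<alpha> * a ^ p - ?\<beta> * b + ?\<kappa> * a = 0"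
    using shift_relation[OF assms] by simp
  finally show ?thesis by simp
qed

lemma homog_h1: "homog (2 * p) (h1 p M)"
proof -
  have "homog (1 * 2) (Y\<^sup>2 :: (3, 'a) mpoly)" using homog_Var_power[of 2] by simp
  moreover have "homog (1 + 1) (X * Z :: (3, 'a) mpoly)" by (intro homog_mult homog_Var)
  ultimately have d: "homog 2 (\<delta> :: (3, 'a) mpoly)" unfolding \<delta>_def by (intro homog_diff) (simp_all add: numeral_2_eq_2)
  show ?thesis
    unfolding h1_def
  proof (intro homog_add)
    show "homog (2 * p) (\<delta> ^ p :: (3, 'a) mpoly)"
      by (rule homog_cong[OF homog_power[OF d]]) simp
    show "homog (2 * p) (Const c * Y ^ p * X ^ p)" for c :: 'a
      by (rule homog_cong[OF homog_mult[OF homog_Const_mult[OF homog_Var_power] homog_Var_power]]) simp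
    show "homog (2 * p) (Const c * \<delta> * X ^ (2 * p - 2))" for c :: 'a
      by (rule homog_cong[OF homog_mult[OF homog_Const_mult[OF d] homog_Var_power]]) (use p_gt_2 in simp)
    show "homog (2 * p) (Const c * Y * X ^ (2 * p - 1))" for c :: 'a
      by (rule homog_cong[OF homog_mult[OF homog_Const_mult[OF homog_Var] homog_Var_power]]) (use p_gt_2 in simp)
  qed
qed

text \<open>By additivity of the Frobenius map \<open>\<delta>\<^sup>p\<close> is \<open>y\<^sup>2\<^sup>p - x\<^sup>p
  z\<^sup>p\<close>, and the other terms of \<open>h\<^sub>1\<close> are divisible by \<open>x\<^sup>p\<close> as
  well, since \<open>2p - 2 \<ge> p\<close>.\<close>

lemma h1_xcong: "xcong p (h1 p M) (Y ^ (2 * p))"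
proof -
  have "\<delta> ^ p = (Y\<^sup>2) ^ p - (X * Z :: (3, 'a) mpoly) ^ p"
    using freshman_mpoly_diff[of "Y\<^sup>2" "X * Z" 1] by (simp add: \<delta>_def)
  then have "\<delta> ^ p - Y ^ (2 * p) = - (X ^ p * Z ^ p :: (3, 'a) mpoly)"
    by (simp add: power_mult_distrib power_mult)
  then have 1: "X ^ p dvd \<delta> ^ p - (Y ^ (2 * p) :: (3, 'a) mpoly)" by simp
  have 2: "X ^ p dvd (X :: (3, 'a) mpoly) ^ (2 * p - 2)" "X ^ p dvd (X :: (3, 'a) mpoly) ^ (2 * p - 1)"
    using p_gt_2 by (auto intro!: le_imp_power_dvd)
  have e: "h1 p M - Y ^ (2 * p) = (\<delta> ^ p - Y ^ (2 * p))
     + Const (\<gamma> p M 1 2 4 5 / \<gamma> p M 1 2 3 5) * Y ^ p * X ^ p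
     + Const (\<gamma> p M 1 3 4 5 / \<gamma> p M 1 2 3 5) * \<delta> * X ^ (2 * p - 2)
     + Const (\<gamma> p M 2 3 4 5 / \<gamma> p M 1 2 3 5) * Y * X ^ (2 * p - 1)"
    by (simp add: h1_def)
  show ?thesis unfolding xcong_def e by (intro dvd_add 1 dvd_mult 2 dvd_refl)
qed

text \<open>Raising to the power \<open>p\<^sup>k\<close> is additive, hence also multiplies the exponent of the
  modulus by \<open>p\<^sup>k\<close>.\<close>

lemma xcong_frobenius: "xcong n f g \<Longrightarrow> xcong (n * p ^ k) (f ^ (p ^ k)) (g ^ (p ^ k))" for f g :: "(3, 'a) mpoly"
  unfolding xcong_def using freshman_mpoly_diff[of f g k] dvd_power_same[of "X ^ n" "f - g" "p ^ k"]
  by (simp add: power_mult)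

lemma NY_tail: "X ^ (p ^ 3 - p\<^sup>2) dvd NY - Y ^ (p ^ 3)"
proof -
  have "X ^ (p ^ 3 - p\<^sup>2) dvd (X :: (3, 'a) mpoly) ^ (p ^ 3 - p)" "X ^ (p ^ 3 - p\<^sup>2) dvd (X :: (3, 'a) mpoly) ^ (p ^ 3 - 1)"
    using p_powers_less by (auto intro!: le_imp_power_dvd)
  then show ?thesis unfolding NY_expand by (simp add: dvd_add dvd_mult dvd_mult2)
qed

lemma homog_NY: "homog (p ^ 3) NY"
proof -
  have "homog (card A * 1) (\<Prod>a\<in>A. Y + Const a * X)"
    by (intro homog_prod finite_A homog_add homog_Var homog_Const_mult)
  then show ?thesis unfolding NY_prod card_A by simp
qed

text \<open>This makes the square of the tail of the norm of \<open>y\<close> vanish modulo \<open>x\<close> to the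
  power \<open>p\<^sup>3\<close>.\<close>

lemma two_p3_le: "p ^ 3 \<le> 2 * (p ^ 3 - p\<^sup>2)"
proof -
  have "2 * p\<^sup>2 \<le> p ^ 3" using p_gt_2 by (simp add: power3_eq_cube power2_eq_square)
  then show ?thesis by arith
qed

text \<open>Modulo \<open>x\<close> to the power \<open>p\<^sup>3\<close> all terms of the defining expression cancel
  except the one that comes from the linear coefficient of the additive polynomial.\<close>

lemma h2_tilde_xcong:
  "xcong (p ^ 3) (h2_tilde p M) (Const (2 * \<gamma> p M 2 3 5 7 / \<gamma> p M 1 2 3 5) * X ^ (p ^ 3 - 1) * Y ^ (p ^ 3 + 1))"
proof -
  \<comment> \<open>Since \<open>p\<close> is odd, the halved exponents in the definition are exact.\<close>
  obtain q where q: "p = 2 * q + 1" using odd_p oddE by blast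
  let ?u = "\<gamma> p M 1 2 3 7 / \<gamma> p M 1 2 3 5" and ?v = "\<gamma> p M 1 2 5 7 / \<gamma> p M 1 2 3 5"
    and ?w = "\<gamma> p M 2 3 5 7 / \<gamma> p M 1 2 3 5"
  define t where "t = NY - Y ^ (p ^ 3)"
  have t: "t = Const (- ?u) * X ^ (p ^ 3 - p\<^sup>2) * Y ^ (p\<^sup>2) + Const ?v * X ^ (p ^ 3 - p) * Y ^ p
    + Const ?w * X ^ (p ^ 3 - 1) * Y"
    by (simp add: t_def NY_expand)
  have ny: "xcong (p ^ 3) (NY\<^sup>2) (Y ^ (2 * p ^ 3) + (t + t) * Y ^ (p ^ 3))"
  proof -
    have r: "(y + s)\<^sup>2 - (y\<^sup>2 + (s + s) * y) = s * s" for y s :: "(3, 'a) mpoly"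
      by (simp add: power2_eq_square algebra_simps)
    have "NY = Y ^ (p ^ 3) + t" by (simp add: t_def)
    then have "NY\<^sup>2 - (Y ^ (2 * p ^ 3) + (t + t) * Y ^ (p ^ 3)) = t * t"
      using r[of "Y ^ (p ^ 3)" t] by (simp add: power_mult[symmetric] mult.commute[of "p ^ 3"])
    moreover have "X ^ (p ^ 3) dvd t * t"
    proof -
      have "X ^ (2 * (p ^ 3 - p\<^sup>2)) dvd t * t"
        unfolding mult_2 power_add t_def by (intro mult_dvd_mono NY_tail)
      moreover have "X ^ (p ^ 3) dvd (X :: (3, 'a) mpoly) ^ (2 * (p ^ 3 - p\<^sup>2))"
        by (rule le_imp_power_dvd[OF two_p3_le])
      ultimately show ?thesis by (rule dvd_trans[rotated])
    qed
    ultimately show ?thesis by (simp add: xcong_def)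
  qed
  have h: "xcong (p ^ 3) (h1 p M ^ (p\<^sup>2)) (Y ^ (2 * p ^ 3))"
    using xcong_frobenius[OF h1_xcong, of 2]
    by (simp add: power_mult[symmetric] power2_eq_square power3_eq_cube mult.assoc)
  have e1: "2 * p\<^sup>2 * (q + 1) = p ^ 3 + p\<^sup>2" "(p\<^sup>2 + p) div 2 = p * (q + 1)" "2 * p * ((p\<^sup>2 + 1) div 2) = p ^ 3 + p"
    unfolding q by (simp_all add: power2_eq_square power3_eq_cube algebra_simps)
  have "xcong (p\<^sup>2) ((h1 p M ^ p) ^ (q + 1)) ((Y ^ (2 * p\<^sup>2)) ^ (q + 1))"
    using xcong_power[OF xcong_frobenius[OF h1_xcong, of 1], of "q + 1"]
    by (simp only: power_mult[symmetric] power2_eq_square power_one_right mult.assoc)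
  then have "xcong (p\<^sup>2) (h1 p M ^ ((p\<^sup>2 + p) div 2)) (Y ^ (p ^ 3 + p\<^sup>2))"
    by (simp only: power_mult[symmetric] e1)
  then have a: "xcong (p ^ 3) (X ^ (p ^ 3 - p\<^sup>2) * h1 p M ^ ((p\<^sup>2 + p) div 2)) (X ^ (p ^ 3 - p\<^sup>2) * Y ^ (p ^ 3 + p\<^sup>2))"
    using xcong_X_power_mult[of "p\<^sup>2" _ _ "p ^ 3 - p\<^sup>2"] p_powers_less by simp
  have "xcong p (h1 p M ^ ((p\<^sup>2 + 1) div 2)) (Y ^ (p ^ 3 + p))"
    using xcong_power[OF h1_xcong, of "(p\<^sup>2 + 1) div 2"] by (simp only: power_mult[symmetric] e1)
  then have b: "xcong (p ^ 3) (X ^ (p ^ 3 - p) * h1 p M ^ ((p\<^sup>2 + 1) div 2)) (X ^ (p ^ 3 - p) * Y ^ (p ^ 3 + p))"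
    using xcong_X_power_mult[of p _ _ "p ^ 3 - p"] p_powers_less by simp
  have "xcong (p ^ 3) (h2_tilde p M) (Y ^ (2 * p ^ 3) + (t + t) * Y ^ (p ^ 3) - Y ^ (2 * p ^ 3)
    + Const (2 / \<gamma> p M 1 2 3 5) * (Const (\<gamma> p M 1 2 3 7) * (X ^ (p ^ 3 - p\<^sup>2) * Y ^ (p ^ 3 + p\<^sup>2))
        - Const (\<gamma> p M 1 2 5 7) * (X ^ (p ^ 3 - p) * Y ^ (p ^ 3 + p))))"
    unfolding h2_tilde_def mult.assoc[of _ "X ^ _"]
    by (intro xcong_add xcong_diff xcong_mult_left ny h a b)
  also have "Y ^ (2 * p ^ 3) + (t + t) * Y ^ (p ^ 3) - Y ^ (2 * p ^ 3)
    + Const (2 / \<gamma> p M 1 2 3 5) * (Const (\<gamma> p M 1 2 3 7) * (X ^ (p ^ 3 - p\<^sup>2) * Y ^ (p ^ 3 + p\<^sup>2))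
        - Const (\<gamma> p M 1 2 5 7) * (X ^ (p ^ 3 - p) * Y ^ (p ^ 3 + p)))
    = Const (2 * \<gamma> p M 2 3 5 7 / \<gamma> p M 1 2 3 5) * X ^ (p ^ 3 - 1) * Y ^ (p ^ 3 + 1)"
  proof -
    have c: "Const (2 / \<gamma> p M 1 2 3 5) * Const (\<gamma> p M 1 2 3 7) = Const ?u + Const ?u"
      "Const (2 / \<gamma> p M 1 2 3 5) * Const (\<gamma> p M 1 2 5 7) = Const ?v + Const ?v"
      "Const (2 * \<gamma> p M 2 3 5 7 / \<gamma> p M 1 2 3 5) = Const ?w + Const ?w"
      unfolding Const_mult[symmetric] Const_add[symmetric] by simp_all
    show ?thesis
      unfolding right_diff_distrib[of "Const (2 / \<gamma> p M 1 2 3 5)"] mult.assoc[symmetric, of "Const (2 / \<gamma> p M 1 2 3 5)"]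
      unfolding c t power_add power_one_right Const_uminus by (rule tails_cancel)
  qed
  finally show ?thesis .
qed

lemma h2_exists:
  obtains s where "h2 p M = Y ^ (p ^ 3 + 1) + X * s"
    and "Const (\<gamma> p M 1 2 3 5) * h2_tilde p M = h2 p M * (Const (2 * \<gamma> p M 2 3 5 7) * X ^ (p ^ 3 - 1))"
proof -
  obtain s where s: "h2_tilde p M
    = Const (2 * \<gamma> p M 2 3 5 7 / \<gamma> p M 1 2 3 5) * X ^ (p ^ 3 - 1) * Y ^ (p ^ 3 + 1) + X ^ (p ^ 3) * s"
    using h2_tilde_xcong unfolding xcong_def dvd_def by (metis diff_eq_eq add.commute)
  let ?c = "\<gamma> p M 1 2 3 5 / (2 * \<gamma> p M 2 3 5 7)"
  define r where "r = Const ?c * s"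
  have c: "Const (\<gamma> p M 1 2 3 5) * Const (2 * \<gamma> p M 2 3 5 7 / \<gamma> p M 1 2 3 5) = Const (2 * \<gamma> p M 2 3 5 7)"
    "Const (2 * \<gamma> p M 2 3 5 7) * Const ?c = Const (\<gamma> p M 1 2 3 5)"
    using \<gamma>1235 \<gamma>2357 two_nonzero unfolding Const_mult[symmetric] by simp_all
  have x: "(X :: (3, 'a) mpoly) ^ (p ^ 3) = X ^ (p ^ 3 - 1) * X"
    using power_minus_mult[of "p ^ 3" "X :: (3, 'a) mpoly"] p_pos by simp
  have "Const (\<gamma> p M 1 2 3 5) * h2_tilde p M
    = (Const (\<gamma> p M 1 2 3 5) * Const (2 * \<gamma> p M 2 3 5 7 / \<gamma> p M 1 2 3 5)) * X ^ (p ^ 3 - 1) * Y ^ (p ^ 3 + 1)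
      + Const (\<gamma> p M 1 2 3 5) * X ^ (p ^ 3) * s"
    by (simp only: s distrib_left mult.assoc)
  also have "\<dots> = Const (2 * \<gamma> p M 2 3 5 7) * X ^ (p ^ 3 - 1) * Y ^ (p ^ 3 + 1)
      + (Const (2 * \<gamma> p M 2 3 5 7) * Const ?c) * (X ^ (p ^ 3 - 1) * X) * s"
    by (simp only: c x)
  also have "\<dots> = (Y ^ (p ^ 3 + 1) + X * r) * (Const (2 * \<gamma> p M 2 3 5 7) * X ^ (p ^ 3 - 1))"
    unfolding r_def distrib_right by (simp only: mult_ac)
  finally have *: "Const (\<gamma> p M 1 2 3 5) * h2_tilde p M
    = (Y ^ (p ^ 3 + 1) + X * r) * (Const (2 * \<gamma> p M 2 3 5 7) * X ^ (p ^ 3 - 1))" .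
  have "h2 p M = Y ^ (p ^ 3 + 1) + X * r"
    unfolding h2_def by (rule exact_quot_eqI[OF *]) (use \<gamma>2357 two_nonzero in simp)
  with * that show ?thesis by metis
qed

lemma homog_h2_tilde: "homog (2 * p ^ 3) (h2_tilde p M)"
proof -
  \<comment> \<open>Since \<open>p\<close> is odd, the halved exponents in the definition are exact.\<close>
  obtain q where q: "p = 2 * q + 1" using odd_p oddE by blast
  have e: "2 * p * ((p\<^sup>2 + p) div 2) = p ^ 3 + p\<^sup>2" "2 * p * ((p\<^sup>2 + 1) div 2) = p ^ 3 + p"
    unfolding q by (simp_all add: power2_eq_square power3_eq_cube algebra_simps)
  have "homog (2 * p ^ 3) (NY\<^sup>2)" by (rule homog_power[OF homog_NY])
  moreover have "homog (2 * p ^ 3) (h1 p M ^ (p\<^sup>2))"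
    using homog_power[OF homog_h1, of "p\<^sup>2"] by (simp add: power2_eq_square power3_eq_cube mult_ac)
  moreover have "homog (2 * p ^ 3) (Const c * X ^ (p ^ 3 - p\<^sup>2) * h1 p M ^ ((p\<^sup>2 + p) div 2))" for c
    by (rule homog_cong[OF homog_mult[OF homog_Const_mult[OF homog_Var_power] homog_power[OF homog_h1]]])
      (use p_powers_less e in \<open>simp add: mult.commute[of _ "2 * p"]\<close>)
  moreover have "homog (2 * p ^ 3) (Const c * X ^ (p ^ 3 - p) * h1 p M ^ ((p\<^sup>2 + 1) div 2))" for c
    by (rule homog_cong[OF homog_mult[OF homog_Const_mult[OF homog_Var_power] homog_power[OF homog_h1]]])
      (use p_powers_less e in \<open>simp add: mult.commute[of _ "2 * p"]\<close>)
  ultimately show ?thesis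
    unfolding h2_tilde_def by (intro homog_add homog_diff homog_Const_mult)
qed

lemma homog_h2: "homog (p ^ 3 + 1) (h2 p M)"
proof -
  obtain s where s: "Const (\<gamma> p M 1 2 3 5) * h2_tilde p M = h2 p M * (Const (2 * \<gamma> p M 2 3 5 7) * X ^ (p ^ 3 - 1))"
    using h2_exists by metis
  have c: "Const (1 / (2 * \<gamma> p M 2 3 5 7)) * Const (2 * \<gamma> p M 2 3 5 7) = (1 :: (3, 'a) mpoly)"
    using \<gamma>2357 two_nonzero unfolding Const_mult[symmetric] by simp
  have "h2 p M * X ^ (p ^ 3 - 1) = h2 p M * ((Const (1 / (2 * \<gamma> p M 2 3 5 7)) * Const (2 * \<gamma> p M 2 3 5 7)) * X ^ (p ^ 3 - 1))"
    by (simp only: c mult_1)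
  also have "\<dots> = Const (1 / (2 * \<gamma> p M 2 3 5 7)) * (Const (\<gamma> p M 1 2 3 5) * h2_tilde p M)"
    unfolding s by (simp only: mult_ac)
  finally have "homog (2 * p ^ 3) (h2 p M * X ^ (p ^ 3 - 1))"
    using homog_h2_tilde by (simp add: homog_Const_mult)
  moreover have "p ^ 3 + 1 + (p ^ 3 - 1) = 2 * p ^ 3" using p_powers_less by simp
  ultimately show ?thesis by (metis homog_X_power_cancel)
qed

lemma h2_invariant:
  assumes "(a, b) \<in> W"
  shows "translate a b (h2 p M) = h2 p M"
proof -
  let ?d = "Const (2 * \<gamma> p M 2 3 5 7) * X ^ (p ^ 3 - 1)"
  obtain s where s: "Const (\<gamma> p M 1 2 3 5) * h2_tilde p M = h2 p M * ?d"
    using h2_exists by metis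
  have "translate a b (h2_tilde p M) = h2_tilde p M"
    unfolding h2_tilde_def
    by (simp only: translate_simps translate_Const translate_Var h1_invariant[OF assms] orbit_prod_invariant[OF assms])
  then have "translate a b (h2 p M * ?d) = h2 p M * ?d"
    unfolding s[symmetric] by (simp only: translate_mult translate_Const)
  then have "translate a b (h2 p M) * ?d = h2 p M * ?d"
    by (simp only: translate_simps translate_Const translate_Var)
  moreover have "?d \<noteq> 0" using \<gamma>2357 two_nonzero by simp
  ultimately show ?thesis by (metis mult_right_cancel)
qed

lemma leads_X: "G.leads X (single 0 1)" "lookup (X :: (3, 'a) mpoly) (single 0 1) = 1"
  by (simp_all add: Var_def G.leads_def)

lemma leads_h1: "G.leads (h1 p M) (single 1 (2 * p))" "lookup (h1 p M) (single 1 (2 * p)) = 1"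
proof -
  have "X dvd (X :: (3, 'a) mpoly) ^ p" using p_pos by (simp add: dvd_power)
  then have "X dvd h1 p M - Y ^ (2 * p)" using h1_xcong unfolding xcong_def by (rule dvd_trans)
  then show "G.leads (h1 p M) (single 1 (2 * p))" "lookup (h1 p M) (single 1 (2 * p)) = 1"
    using leads_Y_power[OF homog_h1] by blast+
qed

lemma leads_h2: "G.leads (h2 p M) (single 1 (p ^ 3 + 1))" "lookup (h2 p M) (single 1 (p ^ 3 + 1)) = 1"
proof -
  obtain s where "h2 p M = Y ^ (p ^ 3 + 1) + X * s" using h2_exists by metis
  then have "X dvd h2 p M - Y ^ (p ^ 3 + 1)" by simp
  then show "G.leads (h2 p M) (single 1 (p ^ 3 + 1))" "lookup (h2 p M) (single 1 (p ^ 3 + 1)) = 1"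
    using leads_Y_power[OF homog_h2] by blast+
qed

lemma leads_NY: "G.leads NY (single 1 (p ^ 3))" "lookup NY (single 1 (p ^ 3)) = 1"
proof -
  have "X dvd (X :: (3, 'a) mpoly) ^ (p ^ 3 - p\<^sup>2)" using p_powers_less by (simp add: dvd_power)
  then have "X dvd NY - Y ^ (p ^ 3)" using NY_tail by (rule dvd_trans)
  then show "G.leads NY (single 1 (p ^ 3))" "lookup NY (single 1 (p ^ 3)) = 1"
    using leads_Y_power[OF homog_NY] by blast+
qed

lemma leads_translate_Z:
  "G.leads (translate a b Z) (single 2 1)" "lookup (translate a b Z) (single 2 1) = (1 :: 'a)"
proof -
  have s: "single v (Suc 0) = single w (Suc 0) \<longleftrightarrow> v = w" for v w :: 3
    by (metis lookup_single_eq lookup_single_not_eq nat.distinct(1))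
  show l: "lookup (translate a b Z) (single 2 1) = (1 :: 'a)"
    unfolding translate_Var
    by (simp add: Var_def Const_def mult_single lookup_add lookup_single when_def s)
  have "n = single 2 1 \<or> n = single 1 1 \<or> n = single 0 1" if "n \<in> keys (translate a b Z)" for n
    using that unfolding translate_Var
    by (auto dest!: in_keys_addD simp: Var_def Const_def mult_single split: if_splits)
  then show "G.leads (translate a b Z) (single 2 1)"
    using l by (force simp: G.leads_def in_keys_iff gkey_def less_prod_def' lookup_single)
qed

lemma leads_NZ: "G.leads NZ (single 2 (p ^ 4))" "lookup NZ (single 2 (p ^ 4)) = 1"
proof -
  have "NZ = (\<Prod>w\<in>W. translate (fst w) (snd w) Z)" unfolding NZ_prod by (simp only: case_prod_beta')
  moreover have "(\<Sum>w\<in>I. single 2 1) = (single 2 (card I) :: 3 monom)" if "finite I" for I :: "('a \<times> 'a) set"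
    using that by (induction I rule: finite_induct)
      (simp_all only: simp_thms sum.empty card.empty single_zero sum.insert card_insert_disjoint single_add[symmetric] plus_1_eq_Suc)
  from this[OF finite_W] have "(\<Sum>w\<in>W. single 2 1) = (single 2 (p ^ 4) :: 3 monom)" unfolding card_W .
  ultimately show "G.leads NZ (single 2 (p ^ 4))" "lookup NZ (single 2 (p ^ 4)) = 1"
    using G.lead_prod[OF finite_W UNIV_I leads_translate_Z(1), of fst snd]
    by (simp_all only: leads_translate_Z(2) prod.neutral_const simp_thms)
qed

end


section \<open>Invariants after inverting \<open>x\<close>\<close>

lemma span_mult_closed:
  assumes "\<And>b. b \<in> S \<Longrightarrow> q * b \<in> mp.span T" "f \<in> mp.span S"
  shows "q * f \<in> mp.span T"
  using assms(2)
proof (induction rule: mp.span_induct_alt)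
  case base
  show ?case by (simp add: mp.span_zero)
next
  case (step c x y)
  have "q * (Const c * x + y) = Const c * (q * x) + q * y" by (simp add: algebra_simps)
  with step show ?case by (simp add: mp.span_add mp.span_scale assms(1))
qed

lemma span_mult:
  assumes "\<And>a b. a \<in> S \<Longrightarrow> b \<in> T \<Longrightarrow> a * b \<in> mp.span U" "f \<in> mp.span S" "g \<in> mp.span T"
  shows "f * g \<in> mp.span U"
proof -
  have "g * a \<in> mp.span U" if "a \<in> S" for a
    using span_mult_closed[of T a U g] assms(1)[OF that] assms(3) by (simp add: mult.commute)
  then show ?thesis using span_mult_closed[of S g U f] assms(2) by (simp add: mult.commute)
qed

text \<open>The polynomial minus the constant \<open>g\<close> has degree less than \<open>n\<close> and at least
  \<open>n\<close> roots.\<close>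

lemma constant_coefficient_eq:
  fixes c :: "nat \<Rightarrow> 'b::idom"
  assumes "card R = n" "n > 0" and g: "\<And>t. t \<in> R \<Longrightarrow> (\<Sum>j<n. c j * t ^ j) = g"
  shows "c 0 = g"
proof -
  define q where "q = (\<Sum>j<n. monom (c j) j)"
  have "degree q \<le> n - 1"
    unfolding q_def by (intro degree_sum_le) (auto intro: order_trans[OF degree_monom_le])
  then have "q = [:g:]"
    using assms by (intro poly_eqI_degree[of R]) (auto simp: q_def poly_sum poly_monom)
  moreover have "coeff q 0 = c 0"
    using assms(2) by (simp add: q_def coeff_sum when_def)
  ultimately show ?thesis by simp
qed

context rank_four_action
begin

text \<open>The grid of points is not a product, but it fibres over the first shifts with fibres of \<open>p\<close>
  elements: first compare coefficients in \<open>\<delta>\<close> over each first shift, and then compare coefficients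
  in \<open>y\<close>.\<close>

lemma interpolation:
  assumes g: "\<And>a b. (a, b) \<in> W \<Longrightarrow>
    g = (\<Sum>j<p. (\<Sum>i<p ^ 3. r i j * (Y + Const a * X) ^ i) * (\<delta> - Const b * X\<^sup>2) ^ j)"
  shows "r 0 0 = (g :: (3, 'a) mpoly)"
proof -
  have "(\<Sum>i<p ^ 3. r i 0 * (Y + Const a * X) ^ i) = g" if a: "a \<in> A" for a
  proof (rule constant_coefficient_eq[where c = "\<lambda>j. \<Sum>i<p ^ 3. r i j * (Y + Const a * X) ^ i"])
    have "inj_on (\<lambda>b :: 'a. \<delta> - Const b * X\<^sup>2) (W `` {a})" by (rule inj_onI) simp
    then show "card ((\<lambda>b. \<delta> - Const b * X\<^sup>2) ` (W `` {a})) = p"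
      using card_fibre[OF a] by (simp only: card_image)
    show "(\<Sum>j<p. (\<Sum>i<p ^ 3. r i j * (Y + Const a * X) ^ i) * t ^ j) = g"
      if "t \<in> (\<lambda>b. \<delta> - Const b * X\<^sup>2) ` (W `` {a})" for t
      using that g by auto
  qed (rule p_pos)
  moreover have "inj_on (\<lambda>a :: 'a. Y + Const a * X) A"
    by (rule inj_onI) (simp only: Const_add_X_inject)
  then have "card ((\<lambda>a. Y + Const a * X) ` A) = p ^ 3" using card_A by (simp only: card_image)
  ultimately show ?thesis
    using p_pos by (intro constant_coefficient_eq[where c = "\<lambda>i. r i 0" and R = "(\<lambda>a. Y + Const a * X) ` A" and n = "p ^ 3"]) auto
qed

text \<open>The weights 2 of \<open>y\<close> and 3 of \<open>\<delta>\<close> are chosen such that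
  \<open>\<delta>\<^sup>p\<close> dominates \<open>y\<^sup>p\<close> in \<open>h\<^sub>1\<close>, while
  \<open>y\<^sup>2\<close> dominates \<open>\<delta>\<close> in \<open>x z\<close>.\<close>

definition xyd_monom :: "nat \<Rightarrow> nat \<Rightarrow> nat \<Rightarrow> nat \<Rightarrow> nat \<Rightarrow> (3, 'a) mpoly" where
  "xyd_monom k s t i j = X ^ k * h1 p M ^ s * NY ^ t * Y ^ i * \<delta> ^ j"

definition weight :: "nat \<Rightarrow> nat \<Rightarrow> nat \<Rightarrow> nat \<Rightarrow> nat" where
  "weight s t i j = 3 * (p * s + j) + 2 * (p ^ 3 * t + i)"

text \<open>\<open>Fil n\<close> is the part of weight at most \<open>n\<close> of \<open>F[x, y, \<delta>]\<close>,
  where \<open>h\<^sub>1\<close> and the norm of \<open>y\<close> carry the weights of \<open>\<delta>\<^sup>p\<close>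
  and of \<open>y\<close> to the power \<open>p\<^sup>3\<close>. In \<open>Fil_reduced n\<close> the exponents of
  \<open>y\<close> and \<open>\<delta>\<close> are bounded, and \<open>Fil_base n\<close> is the part that lies in
  \<open>F[x, h\<^sub>1, N(y)]\<close>.\<close>

definition Fil :: "nat \<Rightarrow> (3, 'a) mpoly set" where
  "Fil n = mp.span {xyd_monom k s t i j |k s t i j. weight s t i j \<le> n}"

definition Fil_reduced :: "nat \<Rightarrow> (3, 'a) mpoly set" where
  "Fil_reduced n = mp.span {xyd_monom k s t i j |k s t i j. weight s t i j \<le> n \<and> i < p ^ 3 \<and> j < p}"

definition Fil_base :: "nat \<Rightarrow> (3, 'a) mpoly set" where
  "Fil_base n = mp.span {X ^ k * h1 p M ^ s * NY ^ t |k s t. 3 * p * s + 2 * p ^ 3 * t \<le> n}"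

lemma xyd_monom_mult:
  "xyd_monom k s t i j * xyd_monom k' s' t' i' j' = xyd_monom (k + k') (s + s') (t + t') (i + i') (j + j')"
  by (simp add: xyd_monom_def power_add mult_ac)

lemma weight_add: "weight (s + s') (t + t') (i + i') (j + j') = weight s t i j + weight s' t' i' j'"
  by (simp add: weight_def algebra_simps)

lemma Fil_mono: "m \<le> n \<Longrightarrow> Fil m \<subseteq> Fil n"
  unfolding Fil_def by (rule mp.span_mono) force

lemma Fil_monom: "weight s t i j \<le> n \<Longrightarrow> xyd_monom k s t i j \<in> Fil n"
  unfolding Fil_def by (rule mp.span_base) blast

lemma Fil_add: "f \<in> Fil n \<Longrightarrow> g \<in> Fil n \<Longrightarrow> f + g \<in> Fil n"
  unfolding Fil_def by (rule mp.span_add)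

lemma Fil_diff: "f \<in> Fil n \<Longrightarrow> g \<in> Fil n \<Longrightarrow> f - g \<in> Fil n"
  unfolding Fil_def by (rule mp.span_diff)

lemma Fil_Const_mult: "f \<in> Fil n \<Longrightarrow> Const c * f \<in> Fil n"
  unfolding Fil_def by (rule mp.span_scale)

lemma Fil_zero: "0 \<in> Fil n"
  unfolding Fil_def by (rule mp.span_zero)

lemma Fil_mult: "f \<in> Fil m \<Longrightarrow> g \<in> Fil n \<Longrightarrow> f * g \<in> Fil (m + n)"
  unfolding Fil_def
proof (erule (1) span_mult[rotated], clarify)
  fix k s t i j k' s' t' i' j'
  assume "weight s t i j \<le> m" "weight s' t' i' j' \<le> n"
  then have "weight (s + s') (t + t') (i + i') (j + j') \<le> m + n" unfolding weight_add by simp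
  then show "xyd_monom k s t i j * xyd_monom k' s' t' i' j' \<in> mp.span {xyd_monom k s t i j |k s t i j. weight s t i j \<le> m + n}"
    unfolding xyd_monom_mult by (intro mp.span_base) blast
qed

text \<open>Since \<open>h\<^sub>1\<close> is monic in \<open>\<delta>\<close> and the norm of \<open>y\<close> is
  monic in \<open>y\<close>, high powers of \<open>\<delta>\<close> and \<open>y\<close> can be eliminated without
  increasing the weight.\<close>

lemma delta_power_eq: "\<delta> ^ p = h1 p M - Const (\<gamma> p M 1 2 4 5 / \<gamma> p M 1 2 3 5) * Y ^ p * X ^ p
     - Const (\<gamma> p M 1 3 4 5 / \<gamma> p M 1 2 3 5) * \<delta> * X ^ (2 * p - 2)
     - Const (\<gamma> p M 2 3 4 5 / \<gamma> p M 1 2 3 5) * Y * X ^ (2 * p - 1)"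
  by (simp add: h1_def)

lemma Y_power_eq: "Y ^ (p ^ 3) = NY - Const (- (\<gamma> p M 1 2 3 7 / \<gamma> p M 1 2 3 5)) * X ^ (p ^ 3 - p\<^sup>2) * Y ^ (p\<^sup>2)
    - Const (\<gamma> p M 1 2 5 7 / \<gamma> p M 1 2 3 5) * X ^ (p ^ 3 - p) * Y ^ p
    - Const (\<gamma> p M 2 3 5 7 / \<gamma> p M 1 2 3 5) * X ^ (p ^ 3 - 1) * Y"
  by (simp add: NY_expand)

lemma xyd_monom_reduced: "weight s t i j \<le> n \<Longrightarrow> xyd_monom k s t i j \<in> Fil_reduced n"
proof (induction "3 * j + 2 * i" arbitrary: k s t i j rule: less_induct)
  case less
  have IH: "xyd_monom k' s' t' i' j' \<in> Fil_reduced n"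
    if "3 * j' + 2 * i' < 3 * j + 2 * i" "weight s' t' i' j' \<le> weight s t i j" for k' s' t' i' j'
    using less.hyps[OF that(1)] that(2) less.prems by simp
  have sc: "Const c * f \<in> Fil_reduced n" if "f \<in> Fil_reduced n" for c f
    using that unfolding Fil_reduced_def by (rule mp.span_scale)
  have df: "f - g \<in> Fil_reduced n" if "f \<in> Fil_reduced n" "g \<in> Fil_reduced n" for f g
    using that unfolding Fil_reduced_def by (rule mp.span_diff)
  consider "i < p ^ 3" "j < p" | "p \<le> j" | "p ^ 3 \<le> i" by linarith
  then show ?case
  proof cases
    case 1
    then show ?thesis unfolding Fil_reduced_def using less.prems by (intro mp.span_base) blast
  next
    case 2
    then obtain l where l: "j = p + l" using le_Suc_ex by blast
    have "xyd_monom k s t i j = X ^ k * h1 p M ^ s * NY ^ t * Y ^ i * \<delta> ^ l * \<delta> ^ p"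
      unfolding xyd_monom_def l by (simp add: power_add mult_ac)
    also have "\<dots> = xyd_monom k (s + 1) t i l
      - Const (\<gamma> p M 1 2 4 5 / \<gamma> p M 1 2 3 5) * xyd_monom (k + p) s t (i + p) l
      - Const (\<gamma> p M 1 3 4 5 / \<gamma> p M 1 2 3 5) * xyd_monom (k + (2 * p - 2)) s t i (l + 1)
      - Const (\<gamma> p M 2 3 4 5 / \<gamma> p M 1 2 3 5) * xyd_monom (k + (2 * p - 1)) s t (i + 1) l"
      unfolding delta_power_eq xyd_monom_def power_add power_one_right
      by (simp only: right_diff_distrib mult_ac)
    also have "\<dots> \<in> Fil_reduced n"
      by (intro df sc IH) (use p_gt_2 in \<open>simp_all add: l weight_def algebra_simps\<close>)
    finally show ?thesis .
  next
    case 3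
    then obtain l where l: "i = p ^ 3 + l" using le_Suc_ex by blast
    have "xyd_monom k s t i j = X ^ k * h1 p M ^ s * NY ^ t * Y ^ l * \<delta> ^ j * Y ^ (p ^ 3)"
      unfolding xyd_monom_def l by (simp add: power_add mult_ac)
    also have "\<dots> = xyd_monom k s (t + 1) l j
      - Const (- (\<gamma> p M 1 2 3 7 / \<gamma> p M 1 2 3 5)) * xyd_monom (k + (p ^ 3 - p\<^sup>2)) s t (l + p\<^sup>2) j
      - Const (\<gamma> p M 1 2 5 7 / \<gamma> p M 1 2 3 5) * xyd_monom (k + (p ^ 3 - p)) s t (l + p) j
      - Const (\<gamma> p M 2 3 5 7 / \<gamma> p M 1 2 3 5) * xyd_monom (k + (p ^ 3 - 1)) s t (l + 1) j"
      unfolding Y_power_eq xyd_monom_def power_add power_one_right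
      by (simp only: right_diff_distrib mult_ac)
    also have "\<dots> \<in> Fil_reduced n"
      by (intro df sc IH) (use p_powers_less in \<open>simp_all add: l weight_def algebra_simps\<close>)
    finally show ?thesis .
  qed
qed

lemma Fil_subset_reduced: "Fil n \<subseteq> Fil_reduced n"
  unfolding Fil_def
proof (rule mp.span_minimal)
  show "{xyd_monom k s t i j |k s t i j. weight s t i j \<le> n} \<subseteq> Fil_reduced n"
    using xyd_monom_reduced by blast
  show "mp.subspace (Fil_reduced n)" unfolding Fil_reduced_def by (rule mp.subspace_span)
qed

lemma Fil_base_zero: "0 \<in> Fil_base n" unfolding Fil_base_def by (rule mp.span_zero)

lemma Fil_reduced_expansion:
  assumes "f \<in> Fil_reduced n"
  obtains r where "\<And>i j. r i j \<in> Fil_base n" "f = (\<Sum>j<p. (\<Sum>i<p ^ 3. r i j * Y ^ i) * \<delta> ^ j)"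
proof -
  have "\<exists>r. (\<forall>i j. r i j \<in> Fil_base n) \<and> f = (\<Sum>j<p. (\<Sum>i<p ^ 3. r i j * Y ^ i) * \<delta> ^ j)"
    using assms unfolding Fil_reduced_def
  proof (induction rule: mp.span_induct_alt)
    case base
    show ?case by (rule exI[of _ "\<lambda>_ _. 0"]) (simp add: Fil_base_zero)
  next
    case (step c x y)
    then obtain r where r: "\<And>i j. r i j \<in> Fil_base n" "y = (\<Sum>j<p. (\<Sum>i<p ^ 3. r i j * Y ^ i) * \<delta> ^ j)"
      by blast
    from step obtain k s t i0 j0 where x: "x = xyd_monom k s t i0 j0" "weight s t i0 j0 \<le> n" "i0 < p ^ 3" "j0 < p"
      by blast
    define b where "b = Const c * (X ^ k * h1 p M ^ s * NY ^ t)"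
    have "b \<in> Fil_base n"
      unfolding b_def Fil_base_def using x(2)
      by (intro mp.span_scale mp.span_base CollectI exI[of _ k] exI[of _ s] exI[of _ t])
        (simp add: weight_def algebra_simps)
    define r' where "r' = (\<lambda>i j. r i j + (if i = i0 \<and> j = j0 then b else 0))"
    have "r' i j \<in> Fil_base n" for i j
      using r(1)[of i j] \<open>b \<in> Fil_base n\<close> unfolding r'_def Fil_base_def by (auto intro: mp.span_add)
    moreover have "Const c * x + y = (\<Sum>j<p. (\<Sum>i<p ^ 3. r' i j * Y ^ i) * \<delta> ^ j)"
    proof -
      have "(\<Sum>i<p ^ 3. (if i = i0 \<and> j = j0 then b else 0) * Y ^ i) = (if j = j0 then b * Y ^ i0 else 0)" for j
        using x(3) by (cases "j = j0") (simp_all add: if_distrib[of "\<lambda>u. u * _"] sum.delta cong: if_cong)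
      then have "(\<Sum>j<p. (\<Sum>i<p ^ 3. r' i j * Y ^ i) * \<delta> ^ j)
        = y + (\<Sum>j<p. (if j = j0 then b * Y ^ i0 else 0) * \<delta> ^ j)"
        unfolding r'_def r(2) by (simp only: distrib_right sum.distrib)
      also have "(\<Sum>j<p. (if j = j0 then b * Y ^ i0 else 0) * \<delta> ^ j) = b * Y ^ i0 * \<delta> ^ j0"
        using x(4) by (simp add: if_distrib[of "\<lambda>u. u * _"] sum.delta cong: if_cong)
      also have "\<dots> = Const c * x" by (simp add: b_def x(1) xyd_monom_def mult_ac)
      finally show ?thesis by simp
    qed
    ultimately show ?case by blast
  qed
  then show ?thesis using that by blast
qed

definition invariant :: "(3, 'a) mpoly \<Rightarrow> bool" where
  "invariant f \<longleftrightarrow> (\<forall>a b. (a, b) \<in> W \<longrightarrow> translate a b f = f)"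

lemma invariant_iff: "f \<in> invariants p M \<longleftrightarrow> invariant f"
  by (auto simp: invariants_iff[OF p_pos] invariant_def)

lemma invariant_zero: "invariant 0" by (simp add: invariant_def)
lemma invariant_Const: "invariant (Const c)" by (simp add: invariant_def)
lemma invariant_X: "invariant X" by (simp add: invariant_def)
lemma invariant_h1: "invariant (h1 p M)" using h1_invariant by (auto simp: invariant_def)
lemma invariant_h2: "invariant (h2 p M)" using h2_invariant by (auto simp: invariant_def)
lemma invariant_NY: "invariant NY" using orbit_prod_invariant by (auto simp: invariant_def)
lemma invariant_NZ: "invariant NZ" using orbit_prod_invariant by (auto simp: invariant_def)
lemma invariant_add: "invariant f \<Longrightarrow> invariant g \<Longrightarrow> invariant (f + g)" by (auto simp: invariant_def translate_add)
lemma invariant_diff: "invariant f \<Longrightarrow> invariant g \<Longrightarrow> invariant (f - g)" by (auto simp: invariant_def translate_diff)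
lemma invariant_mult: "invariant f \<Longrightarrow> invariant g \<Longrightarrow> invariant (f * g)" by (auto simp: invariant_def translate_mult)
lemma invariant_power: "invariant f \<Longrightarrow> invariant (f ^ k)" by (auto simp: invariant_def translate_power)

lemma invariant_span:
  assumes "\<And>b. b \<in> S \<Longrightarrow> invariant b" "f \<in> mp.span S"
  shows "invariant f"
  using assms(2)
  by (induction rule: mp.span_induct_alt)
     (simp_all add: invariant_zero invariant_add invariant_mult invariant_Const assms(1))

lemma invariant_Fil_base: "f \<in> Fil_base n \<Longrightarrow> invariant f"
  unfolding Fil_base_def
  by (erule invariant_span[rotated])
     (auto intro!: invariant_mult invariant_power invariant_X invariant_h1 invariant_NY)

text \<open>The coefficients of the expansion by powers of \<open>y\<close> and \<open>\<delta>\<close> are invariant.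
  So, if \<open>f\<close> is invariant too, the expansion takes the value \<open>f\<close> at all translates of
  \<open>(y, \<delta>)\<close>, and \<open>f\<close> is the constant coefficient.\<close>

lemma invariant_Fil:
  assumes "invariant f" "f \<in> Fil n"
  shows "f \<in> Fil_base n"
proof -
  obtain r where r: "\<And>i j. r i j \<in> Fil_base n" "f = (\<Sum>j<p. (\<Sum>i<p ^ 3. r i j * Y ^ i) * \<delta> ^ j)"
    using Fil_reduced_expansion assms(2) Fil_subset_reduced by blast
  have "f = (\<Sum>j<p. (\<Sum>i<p ^ 3. r i j * (Y + Const a * X) ^ i) * (\<delta> - Const b * X\<^sup>2) ^ j)"
    if "(a, b) \<in> W" for a b
  proof -
    have "translate a b (r i j) = r i j" for i j
      using invariant_Fil_base[OF r(1)] that by (auto simp: invariant_def)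
    moreover have "f = translate a b f" using assms(1) that by (auto simp: invariant_def)
    ultimately show ?thesis
      unfolding r(2) by (simp only: translate_sum translate_mult translate_power translate_Var translate_delta)
  qed
  then have "r 0 0 = f" by (rule interpolation)
  then show ?thesis using r(1) by metis
qed

lemma Y_in_Fil: "Y \<in> Fil 2" using Fil_monom[of 0 0 1 0 2 0] by (simp add: xyd_monom_def weight_def)
lemma \<delta>_in_Fil: "\<delta> \<in> Fil 3" using Fil_monom[of 0 0 0 1 3 0] by (simp add: xyd_monom_def weight_def)
lemma X_power_in_Fil: "X ^ k \<in> Fil 0" using Fil_monom[of 0 0 0 0 0 k] by (simp add: xyd_monom_def weight_def)
lemma NY_in_Fil: "NY \<in> Fil (2 * p ^ 3)" using Fil_monom[of 0 1 0 0 "2 * p ^ 3" 0] by (simp add: xyd_monom_def weight_def)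

lemma Fil_power: "f \<in> Fil n \<Longrightarrow> f ^ k \<in> Fil (k * n)"
proof (induction k)
  case 0
  then show ?case using X_power_in_Fil[of 0] by simp
next
  case (Suc k)
  then show ?case using Fil_mult[of f n "f ^ k" "k * n"] by simp
qed

text \<open>The variable \<open>z\<close> is eliminated by \<open>x z = y\<^sup>2 - \<delta>\<close>.\<close>

lemma X_power_mult_in_Fil: "\<exists>k n. X ^ k * f \<in> Fil n"
proof (induction f rule: mpoly_induct)
  case zero
  then show ?case using Fil_zero by auto
next
  case (plus f g)
  then obtain k n k' n' where "X ^ k * f \<in> Fil n" "X ^ k' * g \<in> Fil n'" by blast
  then have "X ^ k' * (X ^ k * f) \<in> Fil (0 + n)" "X ^ k * (X ^ k' * g) \<in> Fil (0 + n')"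
    using Fil_mult X_power_in_Fil by blast+
  then have "X ^ k' * (X ^ k * f) \<in> Fil (n + n')" "X ^ k * (X ^ k' * g) \<in> Fil (n + n')"
    using Fil_mono[of n "n + n'"] Fil_mono[of n' "n + n'"] by auto
  then have "X ^ (k + k') * (f + g) \<in> Fil (n + n')"
    using Fil_add[of "X ^ k' * (X ^ k * f)" "n + n'" "X ^ k * (X ^ k' * g)"]
    by (simp add: power_add distrib_left mult.assoc mult.left_commute[of "X ^ k'"])
  then show ?case by blast
next
  case (single m c)
  let ?i = "lookup m 0" and ?j = "lookup m 1" and ?k = "lookup m 2"
  have m: "m = single 0 ?i + single 1 ?j + single 2 ?k"
    by (rule monom_three_eqI) (simp_all add: lookup_add lookup_single when_def)
  have "single m c = Const c * (X ^ ?i * Y ^ ?j * Z ^ ?k)"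
    unfolding X_power Y_power Z_power mult_single Const_mult_single m[symmetric] by simp
  moreover have "X * Z = Y\<^sup>2 - (\<delta> :: (3, 'a) mpoly)" by (simp add: \<delta>_def)
  then have "X ^ ?k * Z ^ ?k = (Y\<^sup>2 - (\<delta> :: (3, 'a) mpoly)) ^ ?k" by (simp flip: power_mult_distrib)
  ultimately have e: "X ^ ?k * single m c = Const c * (X ^ ?i * (Y ^ ?j * (Y\<^sup>2 - \<delta>) ^ ?k))"
    by (simp add: mult_ac)
  have "Y\<^sup>2 - \<delta> \<in> Fil 4"
    using Fil_power[OF Y_in_Fil, of 2] \<delta>_in_Fil Fil_mono[of 3 4] by (intro Fil_diff) auto
  then have "X ^ ?k * single m c \<in> Fil (0 + (?j * 2 + ?k * 4))"
    unfolding e by (intro Fil_Const_mult Fil_mult X_power_in_Fil Fil_power Y_in_Fil)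
  then show ?case by blast
qed

lemma X_power_mult_invariant:
  assumes "invariant f"
  obtains k n where "X ^ k * f \<in> Fil_base n"
  using X_power_mult_in_Fil[of f] invariant_Fil invariant_mult[OF invariant_power[OF invariant_X] assms] by blast

text \<open>Weights add up under multiplication, so all terms of the expanded product other than the power of
  \<open>Q\<close> have lower weight. The truncated subtraction is harmless: for empty \<open>I\<close> the difference
  is zero.\<close>

lemma Fil_prod_top:
  assumes "finite I" "d > 0" "Q \<in> Fil d" and q: "\<And>w. w \<in> I \<Longrightarrow> q w - Q \<in> Fil (d - 1)"
  shows "prod q I - Q ^ card I \<in> Fil (card I * d - 1)"
  using assms(1) q
proof (induction I rule: finite_induct)
  case empty
  then show ?case by (simp add: Fil_zero)
next
  case (insert w I)
  define e where "e = q w - Q"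
  define r where "r = prod q I - Q ^ card I"
  have e: "e \<in> Fil (d - 1)" using insert by (simp add: e_def)
  have r: "r \<in> Fil (card I * d - 1)" using insert by (simp add: r_def)
  have Qp: "Q ^ card I \<in> Fil (card I * d)" using assms(3) by (rule Fil_power)
  show ?case
  proof (cases "I = {}")
    case True
    then show ?thesis using e by (simp add: e_def)
  next
    case False
    then have c: "card I * d > 0" using insert assms(2) by (simp add: card_gt_0_iff)
    have "Q * r \<in> Fil (card (insert w I) * d - 1)"
      by (rule subsetD[OF Fil_mono Fil_mult[OF assms(3) r]]) (use c insert in simp)
    moreover have "e * Q ^ card I \<in> Fil (card (insert w I) * d - 1)"
      by (rule subsetD[OF Fil_mono Fil_mult[OF e Qp]]) (use c assms(2) insert in simp)
    moreover have "e * r \<in> Fil (card (insert w I) * d - 1)"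
      by (rule subsetD[OF Fil_mono Fil_mult[OF e r]]) (use c assms(2) insert in simp)
    moreover have "prod q (insert w I) - Q ^ card (insert w I) = Q * r + e * Q ^ card I + e * r"
    proof -
      have s: "(Q' + e') * (P + r') - Q' * P = Q' * r' + e' * P + e' * r'" for Q' e' P r' :: "(3, 'a) mpoly"
        by (simp add: algebra_simps)
      have "q w = Q + e" "prod q I = Q ^ card I + r" by (simp_all add: e_def r_def)
      then show ?thesis using insert s by simp
    qed
    ultimately show ?thesis by (simp only: Fil_add)
  qed
qed

text \<open>Up to a power of \<open>x\<close>, the norm of \<open>z\<close> is the product of the translates of
  \<open>y\<^sup>2 - \<delta>\<close>, in which \<open>y\<^sup>2\<close> has the largest weight; so it is a monic
  polynomial of degree \<open>2p\<close> in the norm of \<open>y\<close>.\<close>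

lemma NZ_monic_in_NY: "X ^ (p ^ 4) * NZ - NY ^ (2 * p) \<in> Fil_base (4 * p ^ 4 - 1)"
proof -
  \<comment> \<open>The factor is \<open>(y + a x)\<^sup>2 - (\<delta> - b x\<^sup>2)\<close>, the translate of \<open>y\<^sup>2 - \<delta>\<close>.\<close>
  have f: "X * translate a b Z - Y\<^sup>2 \<in> Fil (4 - 1)" for a b
  proof -
    have r: "x * (z + u * y + v * x) - y\<^sup>2 = u * (x * y) + v * x\<^sup>2 - (y\<^sup>2 - x * z)" for x y z u v :: "(3, 'a) mpoly"
      by (simp add: algebra_simps power2_eq_square)
    have "X * translate a b Z - Y\<^sup>2 = Const (2 * a) * (X ^ 1 * Y) + Const (a\<^sup>2 + b) * X ^ 2 - \<delta>"
      unfolding translate_Var \<delta>_def power_one_right by (rule r)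
    also have "\<dots> \<in> Fil 3"
    proof (intro Fil_diff Fil_add Fil_Const_mult \<delta>_in_Fil)
      show "X ^ 1 * Y \<in> Fil 3" by (rule subsetD[OF Fil_mono Fil_mult[OF X_power_in_Fil Y_in_Fil]]) simp
      show "X ^ 2 \<in> Fil 3" using X_power_in_Fil Fil_mono[of 0 3] by auto
    qed
    finally show ?thesis by simp
  qed
  have "(\<Prod>w\<in>W. X * translate (fst w) (snd w) Z) - (Y\<^sup>2) ^ card W \<in> Fil (card W * 4 - 1)"
    using Fil_power[OF Y_in_Fil, of 2] by (intro Fil_prod_top finite_W f) simp_all
  moreover have "(\<Prod>w\<in>W. X * translate (fst w) (snd w) Z) = X ^ (p ^ 4) * NZ"
    unfolding NZ_prod case_prod_beta' by (simp only: prod.distrib prod_constant card_W)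
  ultimately have 1: "X ^ (p ^ 4) * NZ - Y ^ (2 * p ^ 4) \<in> Fil (4 * p ^ 4 - 1)"
    by (simp only: card_W power_mult mult.commute[of _ 4])
  have "Y ^ (p ^ 3) - NY \<in> Fil (2 * p ^ 3 - 1)"
  proof -
    have "Y ^ (p ^ 3) - NY = Const (\<gamma> p M 1 2 3 7 / \<gamma> p M 1 2 3 5) * (X ^ (p ^ 3 - p\<^sup>2) * Y ^ (p\<^sup>2))
      - Const (\<gamma> p M 1 2 5 7 / \<gamma> p M 1 2 3 5) * (X ^ (p ^ 3 - p) * Y ^ p)
      - Const (\<gamma> p M 2 3 5 7 / \<gamma> p M 1 2 3 5) * (X ^ (p ^ 3 - 1) * Y ^ 1)"
      unfolding Y_power_eq by (simp add: Const_uminus mult.assoc)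
    moreover have "X ^ k * Y ^ i \<in> Fil (2 * p ^ 3 - 1)" if "i < p ^ 3" for i k
      by (rule subsetD[OF Fil_mono Fil_mult[OF X_power_in_Fil Fil_power[OF Y_in_Fil]]]) (use that in simp)
    ultimately show ?thesis using p_powers_less by (simp only: Fil_diff Fil_Const_mult)
  qed
  then have "(\<Prod>i<2 * p. Y ^ (p ^ 3)) - NY ^ card {..<2 * p} \<in> Fil (card {..<2 * p} * (2 * p ^ 3) - 1)"
    using p_pos by (intro Fil_prod_top NY_in_Fil) simp_all
  moreover have "p ^ 3 * (2 * p) = 2 * p ^ 4" "2 * p * (2 * p ^ 3) = 4 * p ^ 4"
    by (simp_all add: power3_eq_cube power4_eq_xxxx)
  ultimately have 2: "Y ^ (2 * p ^ 4) - NY ^ (2 * p) \<in> Fil (4 * p ^ 4 - 1)"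
    by (simp only: prod_constant card_lessThan power_mult[symmetric])
  have "X ^ (p ^ 4) * NZ - NY ^ (2 * p) \<in> Fil (4 * p ^ 4 - 1)"
    using Fil_add[OF 1 2] by simp
  then show ?thesis
    by (intro invariant_Fil invariant_diff invariant_mult invariant_power invariant_X invariant_NY invariant_NZ)
qed

end


section \<open>Normal monomials in the generators\<close>

lemma leads_Const_mult:
  fixes f :: "(3, 'a::idom) mpoly"
  assumes "G.leads f m" "c \<noteq> 0"
  shows "G.leads (Const c * f) m" "lookup (Const c * f) m = c * lookup f m"
proof -
  have "keys (Const c * f) = keys f" using assms(2) by (auto simp: in_keys_iff lookup_Const_mult)
  then show "G.leads (Const c * f) m" using assms(1) by (simp add: G.leads_def)
  show "lookup (Const c * f) m = c * lookup f m" by (rule lookup_Const_mult)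
qed

lemma lookup_sum_const: "lookup (\<Sum>i<k. m) v = k * lookup m v" for k :: nat and m :: "'v monom"
  by (simp add: lookup_sum)

lemma sum_lessThan_five: "(\<Sum>i<5. f i) = f 0 + f 1 + f 2 + f 3 + f (4::nat)"
  for f :: "nat \<Rightarrow> 'b::comm_monoid_add"
  by (simp add: eval_nat_numeral add.assoc)

lemma less_five_cases: "i < 5 \<Longrightarrow> i = 0 \<or> i = 1 \<or> i = 2 \<or> i = 3 \<or> i = (4::nat)"
  by linarith

context rank_four_action
begin

definition bs :: "(3, 'a) mpoly list" where
  "bs = [X, h1 p M, h2 p M, NY, NZ]"

definition gen_exponents :: "nat monom set" where
  "gen_exponents = {K. keys K \<subseteq> {..<5}}"

abbreviation gen_monom :: "nat monom \<Rightarrow> (3, 'a) mpoly" where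
  "gen_monom \<equiv> monom_eval ((!) bs)"

definition lead_of_gen :: "nat \<Rightarrow> 3 monom" where
  "lead_of_gen i = [single 0 1, single 1 (2 * p), single 1 (p ^ 3 + 1), single 1 (p ^ 3), single 2 (p ^ 4)] ! i"

definition lead_of :: "nat monom \<Rightarrow> 3 monom" where
  "lead_of K = (\<Sum>i<5. \<Sum>j<lookup K i. lead_of_gen i)"

lemma length_bs [simp]: "length bs = 5" by (simp add: bs_def)

lemma bs_nth [simp]: "bs ! 0 = X" "bs ! 1 = h1 p M" "bs ! Suc 0 = h1 p M" "bs ! 2 = h2 p M" "bs ! 3 = NY" "bs ! 4 = NZ"
  by (simp_all add: bs_def eval_nat_numeral)

lemma gen_exponents_add: "K \<in> gen_exponents \<Longrightarrow> L \<in> gen_exponents \<Longrightarrow> K + L \<in> gen_exponents"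
  unfolding gen_exponents_def by (auto dest!: in_keys_addD)

lemma gen_exponents_single: "i < 5 \<Longrightarrow> single i k \<in> gen_exponents" by (simp add: gen_exponents_def)

lemma gen_exponents_lookup: "K \<in> gen_exponents \<Longrightarrow> i \<ge> 5 \<Longrightarrow> lookup K i = 0"
  unfolding gen_exponents_def by (auto simp: in_keys_iff subset_iff)

lemma leads_gen:
  assumes "i < 5"
  shows "G.leads (bs ! i) (lead_of_gen i)" "lookup (bs ! i) (lead_of_gen i) = 1"
  using less_five_cases[OF assms] leads_X leads_h1 leads_h2 leads_NY leads_NZ
  by (auto simp: lead_of_gen_def)

lemma leads_gen_monom:
  assumes "K \<in> gen_exponents"
  shows "G.leads (gen_monom K) (lead_of K)" "lookup (gen_monom K) (lead_of K) = 1"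
proof -
  have p: "G.leads (bs ! i ^ k) (\<Sum>j<k. lead_of_gen i) \<and> lookup (bs ! i ^ k) (\<Sum>j<k. lead_of_gen i) = 1" if "i < 5" for i k
    using G.lead_power[OF leads_gen(1)[OF that] UNIV_I, of k] leads_gen(2)[OF that] by (simp only: power_one)
  have e: "gen_monom K = (\<Prod>i<5. bs ! i ^ lookup K i)"
    using assms by (intro monom_eval_lessThan) (simp add: gen_exponents_def)
  show "G.leads (gen_monom K) (lead_of K)" "lookup (gen_monom K) (lead_of K) = 1"
    unfolding e lead_of_def
    using G.lead_prod[of "{..<5}" "\<lambda>i. bs ! i ^ lookup K i" "\<lambda>i. \<Sum>j<lookup K i. lead_of_gen i"] p by auto
qed

lemma lead_of_lookup:
  "lookup (lead_of K) 0 = lookup K 0"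
  "lookup (lead_of K) 1 = 2 * p * lookup K 1 + (p ^ 3 + 1) * lookup K 2 + p ^ 3 * lookup K 3"
  "lookup (lead_of K) 2 = p ^ 4 * lookup K 4"
  by (simp_all add: lead_of_def sum_lessThan_five lookup_add lookup_sum_const lead_of_gen_def lookup_single
      mult.commute del: sum_constant)

lemma lead_of_add: "lead_of (K + L) = lead_of K + lead_of L"
  by (rule monom_three_eqI) (simp_all add: lead_of_lookup lookup_add algebra_simps)

definition normal :: "nat monom \<Rightarrow> bool" where
  "normal K \<longleftrightarrow> K \<in> gen_exponents \<and> lookup K 2 < p \<and> lookup K 3 < 2"

lemma gen_exponents_eqI:
  assumes "K \<in> gen_exponents" "L \<in> gen_exponents" "lead_of K = lead_of L" "lookup K 2 = lookup L 2" "lookup K 3 = lookup L 3"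
  shows "K = L"
proof (rule poly_mapping_eqI)
  fix i
  have "lookup K 0 = lookup L 0" "lookup K 1 = lookup L 1" "lookup K 4 = lookup L 4"
    using lead_of_lookup[of K] lead_of_lookup[of L] assms(3-5) p_pos by auto
  then show "lookup K i = lookup L i"
    using assms less_five_cases[of i] gen_exponents_lookup[of K i] gen_exponents_lookup[of L i] by (cases "i < 5") auto
qed

text \<open>The exponent of \<open>y\<close> in the lead monomial determines the exponent of \<open>h\<^sub>2\<close>
  modulo \<open>p\<close> and then that of the norm of \<open>y\<close> modulo 2.\<close>

lemma lead_of_inj_normal: "inj_on lead_of {K. normal K}"
proof (rule inj_onI)
  fix K L assume "K \<in> {K. normal K}" "L \<in> {K. normal K}" and e: "lead_of K = lead_of L"
  then have K: "K \<in> gen_exponents" "lookup K 2 < p" "lookup K 3 < 2" and L: "L \<in> gen_exponents" "lookup L 2 < p" "lookup L 3 < 2"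
    by (auto simp: normal_def)
  have y: "2 * p * lookup K 1 + (p ^ 3 + 1) * lookup K 2 + p ^ 3 * lookup K 3
    = 2 * p * lookup L 1 + (p ^ 3 + 1) * lookup L 2 + p ^ 3 * lookup L 3"
    using lead_of_lookup(2)[of K] lead_of_lookup(2)[of L] e by simp
  have f: "2 * p * b + (p ^ 3 + 1) * c + p ^ 3 * d = c + p * (2 * b + p\<^sup>2 * c + p\<^sup>2 * d)" for b c d
    by (simp add: power3_eq_cube power2_eq_square algebra_simps)
  have "(2 * p * b + (p ^ 3 + 1) * c + p ^ 3 * d) mod p = c" if "c < p" for b c d
    unfolding f using that by simp
  then have c: "lookup K 2 = lookup L 2" using K L y by metis
  have "p * (2 * lookup K 1 + p\<^sup>2 * lookup K 3) = p * (2 * lookup L 1 + p\<^sup>2 * lookup L 3)"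
    using y c by (simp add: power3_eq_cube power2_eq_square algebra_simps)
  then have "2 * lookup K 1 + p\<^sup>2 * lookup K 3 = 2 * lookup L 1 + p\<^sup>2 * lookup L 3" using p_pos by simp
  then have "even (2 * lookup K 1 + p\<^sup>2 * lookup K 3) = even (2 * lookup L 1 + p\<^sup>2 * lookup L 3)" by (rule arg_cong)
  then have "even (lookup K 3) = even (lookup L 3)" using odd_p by simp
  then have "lookup K 3 = lookup L 3" using K(3) L(3) by (auto simp: less_2_cases_iff)
  then show "K = L" using gen_exponents_eqI K L e c by blast
qed

definition N :: "(3, 'a) mpoly set" where
  "N = mp.span {gen_monom K |K. normal K}"

lemma N_expansion:
  assumes "f \<in> N"
  obtains q where "\<And>K. K \<in> keys q \<Longrightarrow> normal K" "f = subst ((!) bs) q"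
proof -
  have "\<exists>q. (\<forall>K\<in>keys q. normal K) \<and> f = subst ((!) bs) q"
    using assms unfolding N_def
  proof (induction rule: mp.span_induct_alt)
    case base
    show ?case by (rule exI[of _ 0]) simp
  next
    case (step c x y)
    then obtain K q where K: "normal K" "x = gen_monom K" and q: "\<forall>K\<in>keys q. normal K" "y = subst ((!) bs) q"
      by blast
    have "\<forall>L\<in>keys (single K c + q). normal L" using K q by (auto dest!: in_keys_addD split: if_splits)
    moreover have "Const c * x + y = subst ((!) bs) (single K c + q)"
      by (simp add: K q subst_add subst_single)
    ultimately show ?case by blast
  qed
  then show ?thesis using that by blast
qed

lemma normal_lead:
  assumes "finite S" "S \<noteq> {}" "\<And>K. K \<in> S \<Longrightarrow> normal K \<and> c K \<noteq> 0"
  obtains K where "K \<in> S" "G.leads (\<Sum>K\<in>S. Const (c K) * gen_monom K) (lead_of K)"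
proof (rule G.leads_sum_distinct[OF assms(1,2), of "\<lambda>K. Const (c K) * gen_monom K" lead_of])
  show "G.leads (Const (c K) * gen_monom K) (lead_of K)" if "K \<in> S" for K
    using assms(3)[OF that] by (intro leads_Const_mult leads_gen_monom) (auto simp: normal_def)
  show "inj_on lead_of S" using lead_of_inj_normal assms(3) by (auto intro: inj_on_subset)
qed (use that in blast)

lemma subst_normal_lead:
  assumes "q \<noteq> 0" "\<And>K. K \<in> keys q \<Longrightarrow> normal K"
  obtains K where "K \<in> keys q" "G.leads (subst ((!) bs) q) (lead_of K)"
  unfolding subst_def
  by (rule normal_lead[of "keys q" "lookup q"]) (use assms that in \<open>auto simp: in_keys_iff subst_def\<close>)

lemma gen_monom_single: "i < 5 \<Longrightarrow> gen_monom (single i 1 + K) = bs ! i * gen_monom K"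
  by (simp add: monom_eval_add)

lemma N_gen_monom: "normal K \<Longrightarrow> gen_monom K \<in> N"
  unfolding N_def by (rule mp.span_base) blast

lemma N_add: "f \<in> N \<Longrightarrow> g \<in> N \<Longrightarrow> f + g \<in> N" unfolding N_def by (rule mp.span_add)
lemma N_diff: "f \<in> N \<Longrightarrow> g \<in> N \<Longrightarrow> f - g \<in> N" unfolding N_def by (rule mp.span_diff)
lemma N_Const_mult: "f \<in> N \<Longrightarrow> Const c * f \<in> N" unfolding N_def by (rule mp.span_scale)

lemma N_gen_mult:
  assumes "i \<in> {0, 1, 4}" "f \<in> N"
  shows "bs ! i * f \<in> N"
  using assms(2) unfolding N_def
proof (rule span_mult_closed[rotated])
  fix b assume "b \<in> {gen_monom K |K. normal K}"
  then obtain K where K: "b = gen_monom K" "normal K" by blast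
  have "normal (single i 1 + K)"
    using K assms(1) by (auto simp: normal_def gen_exponents_add gen_exponents_single lookup_add lookup_single)
  moreover have "bs ! i * b = gen_monom (single i 1 + K)"
    using assms(1) K(1) gen_monom_single[of i K] by auto
  ultimately show "bs ! i * b \<in> mp.span {gen_monom K |K. normal K}"
    using N_gen_monom unfolding N_def by simp
qed

lemma N_power_mult: "i \<in> {0, 1, 4} \<Longrightarrow> f \<in> N \<Longrightarrow> bs ! i ^ k * f \<in> N"
  by (induction k) (simp_all only: power_0 mult_1 power_Suc mult.assoc N_gen_mult)

lemma N_X_power_mult: "f \<in> N \<Longrightarrow> X ^ k * f \<in> N"
  and N_h1_power_mult: "f \<in> N \<Longrightarrow> h1 p M ^ k * f \<in> N"
  and N_NZ_mult: "f \<in> N \<Longrightarrow> NZ * f \<in> N"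
  using N_power_mult[of 0 f k] N_power_mult[of 1 f k] N_power_mult[of 4 f 1] by simp_all

text \<open>Divisibility by \<open>x\<close> is visible on the normal monomials: the part of an expansion that does
  not involve \<open>x\<close> is divisible by \<open>x\<close>, but its lead monomial is not.\<close>

lemma N_div_X:
  assumes "X * f \<in> N"
  shows "f \<in> N"
proof -
  obtain q where q: "\<And>K. K \<in> keys q \<Longrightarrow> normal K" "X * f = subst ((!) bs) q"
    using N_expansion[OF assms] by metis
  let ?term = "\<lambda>K. Const (lookup q K) * gen_monom K"
  define S where "S = {K \<in> keys q. lookup K 0 = 0}"
  have dec: "gen_monom K = X * gen_monom (K - single 0 1)" "normal (K - single 0 1)"
    if "K \<in> keys q" "lookup K 0 > 0" for K
  proof -
    have K: "single 0 1 + (K - single 0 1) = K"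
      using that(2) by (intro poly_mapping_eqI) (simp add: lookup_add lookup_minus lookup_single when_def)
    show "gen_monom K = X * gen_monom (K - single 0 1)"
      using gen_monom_single[of 0 "K - single 0 1"] unfolding K by simp
    show "normal (K - single 0 1)"
      using q(1)[OF that(1)] unfolding normal_def gen_exponents_def
      by (auto simp: lookup_minus lookup_single in_keys_iff subset_iff when_def)
  qed
  have split: "X * f = sum ?term S + sum ?term (keys q - S)"
    unfolding q(2) subst_def by (rule sum.subset_diff[THEN trans, OF _ _ add.commute]) (auto simp: S_def)
  have "S = {}"
  proof (rule ccontr)
    assume "S \<noteq> {}"
    obtain K where K: "K \<in> S" "G.leads (sum ?term S) (lead_of K)"
    proof (rule normal_lead[of S "lookup q"])
      show "finite S" by (simp add: S_def)
      show "normal K \<and> lookup q K \<noteq> 0" if "K \<in> S" for K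
        using that q(1) by (simp add: S_def in_keys_iff)
    qed (rule \<open>S \<noteq> {}\<close>)
    have "X dvd ?term K" if "K \<in> keys q - S" for K
      using dec(1)[of K] that by (simp add: S_def dvd_mult)
    then have "X dvd sum ?term (keys q - S)" by (rule dvd_sum)
    then have "X dvd sum ?term S" using split dvd_add_left_iff[of X "sum ?term (keys q - S)" "sum ?term S"] by (metis dvd_triv_left)
    moreover have "lead_of K \<in> keys (sum ?term S)" using K(2) by (simp add: G.leads_def)
    ultimately have "lookup (lead_of K) 0 > 0" by (rule X_dvd_keys)
    then show False using K(1) by (simp add: lead_of_lookup S_def)
  qed
  then have pos: "lookup K 0 > 0" if "K \<in> keys q" for K
    using that unfolding S_def by (metis (mono_tags, lifting) empty_iff gr0I mem_Collect_eq)
  have "X * f = X * (\<Sum>K\<in>keys q. Const (lookup q K) * gen_monom (K - single 0 1))"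
    unfolding q(2) subst_def sum_distrib_left
    by (rule sum.cong[OF refl]) (use dec(1) pos in \<open>simp add: mult_ac\<close>)
  then have "f = (\<Sum>K\<in>keys q. Const (lookup q K) * gen_monom (K - single 0 1))" by simp
  also have "\<dots> \<in> N"
    unfolding N_def by (intro mp.span_sum mp.span_scale mp.span_base) (use dec(2) pos in blast)
  finally show ?thesis .
qed


section \<open>The normal monomials span the invariants\<close>

text \<open>Solving the definition of \<open>h\<^sub>2\<close> for the square of the norm of \<open>y\<close>. Only
  multiplications by \<open>x\<close> and \<open>h\<^sub>1\<close> occur in \<open>u\<close>, and they preserve normal
  monomials.\<close>

lemma NY_square: obtains u where "\<And>f. f \<in> N \<Longrightarrow> u * f \<in> N"
  and "NY\<^sup>2 = u + Const (2 * \<gamma> p M 2 3 5 7 / \<gamma> p M 1 2 3 5) * X ^ (p ^ 3 - 1) * h2 p M"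
proof -
  define u where "u = h1 p M ^ (p\<^sup>2) - Const (2 / \<gamma> p M 1 2 3 5) *
       (Const (\<gamma> p M 1 2 3 7) * X ^ (p ^ 3 - p\<^sup>2) * h1 p M ^ ((p\<^sup>2 + p) div 2)
        - Const (\<gamma> p M 1 2 5 7) * X ^ (p ^ 3 - p) * h1 p M ^ ((p\<^sup>2 + 1) div 2))"
  obtain s where s: "Const (\<gamma> p M 1 2 3 5) * h2_tilde p M = h2 p M * (Const (2 * \<gamma> p M 2 3 5 7) * X ^ (p ^ 3 - 1))"
    using h2_exists by metis
  have c: "Const (1 / \<gamma> p M 1 2 3 5) * Const (\<gamma> p M 1 2 3 5) = (1 :: (3, 'a) mpoly)"
    "Const (1 / \<gamma> p M 1 2 3 5) * Const (2 * \<gamma> p M 2 3 5 7) = (Const (2 * \<gamma> p M 2 3 5 7 / \<gamma> p M 1 2 3 5) :: (3, 'a) mpoly)"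
    using \<gamma>1235 unfolding Const_mult[symmetric] by simp_all
  have "h2_tilde p M = (Const (1 / \<gamma> p M 1 2 3 5) * Const (\<gamma> p M 1 2 3 5)) * h2_tilde p M" by (simp only: c mult_1)
  also have "\<dots> = (Const (1 / \<gamma> p M 1 2 3 5) * Const (2 * \<gamma> p M 2 3 5 7)) * X ^ (p ^ 3 - 1) * h2 p M"
    unfolding mult.assoc s by (simp only: mult_ac)
  finally have "h2_tilde p M = Const (2 * \<gamma> p M 2 3 5 7 / \<gamma> p M 1 2 3 5) * X ^ (p ^ 3 - 1) * h2 p M" by (simp only: c)
  moreover have "NY\<^sup>2 = u + h2_tilde p M" by (simp add: u_def h2_tilde_def)
  moreover have "u * f \<in> N" if f: "f \<in> N" for f
  proof -
    have "u * f = h1 p M ^ (p\<^sup>2) * f - Const (2 / \<gamma> p M 1 2 3 5) *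
       (Const (\<gamma> p M 1 2 3 7) * (X ^ (p ^ 3 - p\<^sup>2) * (h1 p M ^ ((p\<^sup>2 + p) div 2) * f))
        - Const (\<gamma> p M 1 2 5 7) * (X ^ (p ^ 3 - p) * (h1 p M ^ ((p\<^sup>2 + 1) div 2) * f)))"
      unfolding u_def by (simp only: left_diff_distrib mult.assoc)
    then show ?thesis using f by (simp only: N_diff N_Const_mult N_X_power_mult N_h1_power_mult)
  qed
  ultimately show ?thesis using that by metis
qed

lemma gen_monom_h2_NY: "c < p \<Longrightarrow> d < 2 \<Longrightarrow> h2 p M ^ c * NY ^ d \<in> N"
  using N_gen_monom[of "single 2 c + single 3 d"]
  by (simp add: normal_def gen_exponents_add gen_exponents_single lookup_add lookup_single monom_eval_add)

text \<open>Each step trades a square of the norm of \<open>y\<close> for at most one factor \<open>h\<^sub>2\<close>,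
  so the exponent of \<open>h\<^sub>2\<close> stays below \<open>p\<close>.\<close>

lemma NY_power_h2_in_N: "c + e < p \<Longrightarrow> d < 2 \<Longrightarrow> NY ^ (2 * c) * (h2 p M ^ e * NY ^ d) \<in> N"
proof (induction c arbitrary: e)
  case 0
  then show ?case using gen_monom_h2_NY by simp
next
  case (Suc c)
  obtain u where u: "\<And>f. f \<in> N \<Longrightarrow> u * f \<in> N"
    "NY\<^sup>2 = u + Const (2 * \<gamma> p M 2 3 5 7 / \<gamma> p M 1 2 3 5) * X ^ (p ^ 3 - 1) * h2 p M"
    using NY_square by metis
  have "NY ^ (2 * Suc c) * (h2 p M ^ e * NY ^ d) = NY\<^sup>2 * (NY ^ (2 * c) * (h2 p M ^ e * NY ^ d))"
    by (simp add: power2_eq_square mult_ac)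
  also have "\<dots> = u * (NY ^ (2 * c) * (h2 p M ^ e * NY ^ d)) + Const (2 * \<gamma> p M 2 3 5 7 / \<gamma> p M 1 2 3 5) *
      (X ^ (p ^ 3 - 1) * (NY ^ (2 * c) * (h2 p M ^ Suc e * NY ^ d)))"
    unfolding u(2) power_Suc distrib_right by (simp only: mult_ac)
  also have "\<dots> \<in> N"
    using Suc by (intro N_add N_Const_mult N_X_power_mult u(1) Suc.IH) simp_all
  finally show ?case .
qed

text \<open>The exponents below \<open>2p\<close> are covered by \<open>NY_power_h2_in_N\<close>; for the others the
  power of exponent \<open>2p\<close> is expressed through the norm of \<open>z\<close> and smaller powers.\<close>

lemma NY_power_in_N: "NY ^ t \<in> N"
proof (induction t rule: less_induct)
  case (less t)
  show ?case
  proof (cases "t < 2 * p")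
    case True
    have "NY ^ t = NY ^ (2 * (t div 2)) * (h2 p M ^ 0 * NY ^ (t mod 2))"
      by (simp flip: power_add)
    also have "\<dots> \<in> N" by (rule NY_power_h2_in_N) (use True in simp_all)
    finally show ?thesis .
  next
    case False
    define l where "l = t - 2 * p"
    have l: "t = l + 2 * p" "l < t" using False p_pos by (simp_all add: l_def)
    define r where "r = X ^ (p ^ 4) * NZ - NY ^ (2 * p)"
    have "NY ^ l * r \<in> N"
      unfolding N_def
    proof (rule span_mult_closed)
      show "r \<in> mp.span {X ^ k * h1 p M ^ s * NY ^ t' |k s t'. 3 * p * s + 2 * p ^ 3 * t' \<le> 4 * p ^ 4 - 1}"
        using NZ_monic_in_NY unfolding r_def Fil_base_def .
      fix b assume "b \<in> {X ^ k * h1 p M ^ s * NY ^ t' |k s t'. 3 * p * s + 2 * p ^ 3 * t' \<le> 4 * p ^ 4 - 1}"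
      then obtain k s t' where b: "b = X ^ k * h1 p M ^ s * NY ^ t'" "3 * p * s + 2 * p ^ 3 * t' \<le> 4 * p ^ 4 - 1"
        by blast
      have "t' < 2 * p"
      proof (rule ccontr)
        assume "\<not> t' < 2 * p"
        then have "2 * p ^ 3 * (2 * p) \<le> 2 * p ^ 3 * t'" by (intro mult_le_mono2) simp
        moreover have "2 * p ^ 3 * (2 * p) = 4 * p ^ 4" "p ^ 4 > 0"
          using p_pos by (simp_all add: power3_eq_cube power4_eq_xxxx)
        ultimately show False using b(2) by linarith
      qed
      then have "NY ^ (l + t') \<in> N" using l less by simp
      then have "X ^ k * (h1 p M ^ s * NY ^ (l + t')) \<in> N" by (intro N_X_power_mult N_h1_power_mult)
      moreover have "NY ^ l * b = X ^ k * (h1 p M ^ s * NY ^ (l + t'))"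
        unfolding b(1) by (simp add: power_add mult_ac)
      ultimately show "NY ^ l * b \<in> mp.span {gen_monom K |K. normal K}" unfolding N_def by simp
    qed
    moreover have "NY ^ t = X ^ (p ^ 4) * (NZ * NY ^ l) - NY ^ l * r"
      unfolding l(1) r_def by (simp add: power_add algebra_simps)
    moreover have "NY ^ l \<in> N" using l less by simp
    ultimately show ?thesis by (simp only: N_diff N_X_power_mult N_NZ_mult)
  qed
qed

lemma invariant_gen_monom: "K \<in> gen_exponents \<Longrightarrow> invariant (gen_monom K)"
proof -
  assume "K \<in> gen_exponents"
  then have e: "gen_monom K = (\<Prod>i<5. bs ! i ^ lookup K i)"
    by (intro monom_eval_lessThan) (simp add: gen_exponents_def)
  have gen: "invariant (bs ! i)" if "i < 5" for i
    using less_five_cases[OF that] invariant_X invariant_h1 invariant_h2 invariant_NY invariant_NZ by auto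
  have prod: "invariant (prod f I)" if "\<And>i. i \<in> I \<Longrightarrow> invariant (f i)" for f :: "nat \<Rightarrow> (3, 'a) mpoly" and I
    using that by (induction I rule: infinite_finite_induct)
      (simp_all add: invariant_mult invariant_Const[of 1, simplified])
  show ?thesis unfolding e
    by (rule prod, rule invariant_power, rule gen) simp
qed

text \<open>A power of \<open>x\<close> carries an invariant into \<open>F[x, h\<^sub>1, N(y)]\<close>, which lies in
  \<open>N\<close>; the factors \<open>x\<close> can then be removed one at a time.\<close>

theorem invariants_eq_N: "invariants p M = N"
proof
  show "N \<subseteq> invariants p M"
  proof
    fix f assume "f \<in> N"
    then have "invariant f"
      unfolding N_def by (rule invariant_span[rotated]) (auto simp: normal_def intro: invariant_gen_monom)
    then show "f \<in> invariants p M" by (simp add: invariant_iff)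
  qed
  show "invariants p M \<subseteq> N"
  proof
    fix f assume "f \<in> invariants p M"
    then have "invariant f" by (simp add: invariant_iff)
    then obtain k n where k: "X ^ k * f \<in> Fil_base n" by (rule X_power_mult_invariant)
    have "Fil_base n \<subseteq> N"
      unfolding Fil_base_def
    proof (rule mp.span_minimal)
      show "mp.subspace N" unfolding N_def by (rule mp.subspace_span)
      show "{X ^ k * h1 p M ^ s * NY ^ t |k s t. 3 * p * s + 2 * p ^ 3 * t \<le> n} \<subseteq> N"
      proof clarify
        fix k s t
        show "X ^ k * h1 p M ^ s * NY ^ t \<in> N"
          unfolding mult.assoc by (intro N_X_power_mult N_h1_power_mult NY_power_in_N)
      qed
    qed
    with k have "X ^ k * f \<in> N" by blast
    then show "f \<in> N"
    proof (induction k)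
      case (Suc k)
      then have "X * (X ^ k * f) \<in> N" by (simp only: power_Suc mult.assoc)
      then show ?case using Suc.IH N_div_X by blast
    qed simp
  qed
qed

end


section \<open>Polynomial rings as carriers\<close>

lemma mpoly_ring_simps [simp]:
  "x \<otimes>\<^bsub>mpoly_ring n\<^esub> y = x * y" "\<one>\<^bsub>mpoly_ring n\<^esub> = 1" "\<zero>\<^bsub>mpoly_ring n\<^esub> = 0" "x \<oplus>\<^bsub>mpoly_ring n\<^esub> y = x + y"
  by (simp_all add: mpoly_ring_def)

lemma carrier_mpoly_ring: "f \<in> carrier (mpoly_ring n) \<longleftrightarrow> (\<forall>K\<in>keys f. keys K \<subseteq> {..<n})"
  by (simp add: mpoly_ring_def)

lemma carrier_add: "f \<in> carrier (mpoly_ring n) \<Longrightarrow> g \<in> carrier (mpoly_ring n) \<Longrightarrow> f + g \<in> carrier (mpoly_ring n)"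
  unfolding carrier_mpoly_ring by (auto dest!: in_keys_addD)

lemma carrier_mult: "f \<in> carrier (mpoly_ring n) \<Longrightarrow> g \<in> carrier (mpoly_ring n) \<Longrightarrow> f * g \<in> carrier (mpoly_ring n)"
  unfolding carrier_mpoly_ring by (fastforce elim!: in_keys_multE dest!: in_keys_addD)

lemma carrier_uminus: "f \<in> carrier (mpoly_ring n) \<Longrightarrow> - f \<in> carrier (mpoly_ring n)"
  unfolding carrier_mpoly_ring by (simp add: in_keys_iff)

lemma carrier_Const: "Const c \<in> carrier (mpoly_ring n)"
  by (simp add: carrier_mpoly_ring Const_def)

lemma carrier_zero: "0 \<in> carrier (mpoly_ring n)"
  by (simp add: carrier_mpoly_ring)

lemma cring_mpoly_ring: "cring (mpoly_ring n :: (nat, 'a::comm_ring_1) mpoly ring)"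
proof (rule cringI)
  show "abelian_group (mpoly_ring n :: (nat, 'a) mpoly ring)"
  proof (rule abelian_groupI)
    fix x :: "(nat, 'a) mpoly" assume "x \<in> carrier (mpoly_ring n)"
    then show "\<exists>y\<in>carrier (mpoly_ring n). y \<oplus>\<^bsub>mpoly_ring n\<^esub> x = \<zero>\<^bsub>mpoly_ring n\<^esub>"
      by (intro bexI[of _ "- x"]) (simp_all add: carrier_uminus)
  qed (simp_all add: carrier_add carrier_zero add_ac)
  show "comm_monoid (mpoly_ring n :: (nat, 'a) mpoly ring)"
    by (rule comm_monoidI) (simp_all add: carrier_mult carrier_Const[of 1, simplified] mult_ac)
qed (simp_all add: distrib_right)

lemma ideal_add: "ideal I (mpoly_ring n) \<Longrightarrow> f \<in> I \<Longrightarrow> g \<in> I \<Longrightarrow> f + g \<in> I"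
  using additive_subgroup.a_closed[OF ideal.axioms(1), of I "mpoly_ring n" f g] by simp

lemma ideal_mult: "ideal I (mpoly_ring n) \<Longrightarrow> f \<in> I \<Longrightarrow> g \<in> carrier (mpoly_ring n) \<Longrightarrow> g * f \<in> I"
  using ideal.I_l_closed[of I "mpoly_ring n" f g] by simp

lemma ideal_zero: "ideal I (mpoly_ring n) \<Longrightarrow> 0 \<in> I"
  using additive_subgroup.zero_closed[OF ideal.axioms(1), of I "mpoly_ring n"] by simp

lemma ideal_diff:
  assumes "ideal I (mpoly_ring n)" "f \<in> I" "g \<in> I"
  shows "f - g \<in> I"
proof -
  have "Const (- 1) * g \<in> I" by (rule ideal_mult[OF assms(1,3) carrier_Const])
  then show ?thesis using ideal_add[OF assms(1,2)] by (fastforce simp: Const_uminus)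
qed

lemma ideal_genideal: "S \<subseteq> carrier (mpoly_ring n) \<Longrightarrow> ideal (Idl\<^bsub>mpoly_ring n\<^esub> S) (mpoly_ring n)"
  by (rule ring.genideal_ideal[OF cring.axioms(1)[OF cring_mpoly_ring]])

lemma subset_genideal: "S \<subseteq> carrier (mpoly_ring n) \<Longrightarrow> S \<subseteq> Idl\<^bsub>mpoly_ring n\<^esub> S"
  by (rule ring.genideal_self[OF cring.axioms(1)[OF cring_mpoly_ring]])

lemma genideal_subset: "ideal I (mpoly_ring n) \<Longrightarrow> S \<subseteq> I \<Longrightarrow> Idl\<^bsub>mpoly_ring n\<^esub> S \<subseteq> I"
  by (rule ring.genideal_minimal[OF cring.axioms(1)[OF cring_mpoly_ring]])

lemma genideal_empty: "Idl\<^bsub>mpoly_ring n\<^esub> {} = {0}"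
proof
  show "Idl\<^bsub>mpoly_ring n\<^esub> {} \<subseteq> {0}"
    using genideal_subset[OF ring.zeroideal[OF cring.axioms(1)[OF cring_mpoly_ring]], of "{}" n] by simp
  show "{0} \<subseteq> Idl\<^bsub>mpoly_ring n\<^esub> {}"
    using ideal_zero[OF ideal_genideal, of "{}" n] by simp
qed

lemma genideal_singletonE:
  assumes "f \<in> Idl\<^bsub>mpoly_ring n\<^esub> {g}" "g \<in> carrier (mpoly_ring n)"
  obtains q where "q \<in> carrier (mpoly_ring n)" "f = q * g"
  using assms cring.cgenideal_eq_genideal[OF cring_mpoly_ring assms(2)] by (auto simp: cgenideal_def)

lemma ideal_relation_ideal:
  fixes bs :: "('v, 'b::comm_ring_1) mpoly list"
  shows "ideal (relation_ideal bs) (mpoly_ring (length bs))"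
proof (rule idealI)
  show "ring (mpoly_ring (length bs) :: (nat, 'b) mpoly ring)" by (rule cring.axioms(1)[OF cring_mpoly_ring])
  interpret R: cring "mpoly_ring (length bs) :: (nat, 'b) mpoly ring" by (rule cring_mpoly_ring)
  show "subgroup (relation_ideal bs) (add_monoid (mpoly_ring (length bs)))"
  proof (rule R.add.subgroupI)
    show "relation_ideal bs \<noteq> {}" unfolding relation_ideal_def using carrier_zero subst_0 by blast
    fix a b assume a: "a \<in> relation_ideal bs"
    have "\<ominus>\<^bsub>mpoly_ring (length bs)\<^esub> a = - a"
      using a by (intro R.minus_equality) (auto simp: relation_ideal_def carrier_uminus)
    then show "\<ominus>\<^bsub>mpoly_ring (length bs)\<^esub> a \<in> relation_ideal bs"
      using a by (simp add: relation_ideal_def carrier_uminus subst_uminus)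
    assume "b \<in> relation_ideal bs"
    then show "a \<oplus>\<^bsub>mpoly_ring (length bs)\<^esub> b \<in> relation_ideal bs"
      using a by (simp add: relation_ideal_def carrier_add subst_add)
  qed (auto simp: relation_ideal_def)
qed (simp_all add: relation_ideal_def carrier_mult subst_mult)

lemma leads_diff_less:
  assumes "G.leads f m" "G.leads g m" "lookup f m = lookup g m" "n \<in> keys (f - g)"
  shows "gkey n < gkey m"
proof -
  have "n \<noteq> m" using assms(3,4) by (auto simp: in_keys_iff lookup_minus)
  moreover have "n \<in> keys f \<or> n \<in> keys g" using assms(4) by (auto simp: in_keys_iff lookup_minus)
  ultimately show ?thesis using assms(1,2) unfolding G.leads_def by blast
qed


section \<open>Subduction\<close>

context rank_four_action
begin

lemma LT_Const_gen_monom: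
  assumes "f \<noteq> 0" "K \<in> gen_exponents" "LT f = LT (Const c * gen_monom K)"
  shows "G.leads f (lead_of K)" "lookup f (lead_of K) = c" "c \<noteq> 0"
proof -
  have l: "G.leads f (lead_exp f)" by (rule leads_lead_exp[OF assms(1)])
  then have nz: "lookup f (lead_exp f) \<noteq> 0" by (rule G.leads_lookup)
  show c: "c \<noteq> 0"
  proof
    assume "c = 0"
    then have "LT f = 0" using assms(3) by (simp add: LT_def)
    then have "lookup (LT f) (lead_exp f) = 0" by simp
    then show False using nz by (simp add: LT_def)
  qed
  have g: "G.leads (Const c * gen_monom K) (lead_of K)" "lookup (Const c * gen_monom K) (lead_of K) = c"
    using leads_Const_mult[OF leads_gen_monom(1)[OF assms(2)] c] leads_gen_monom(2)[OF assms(2)] by simp_all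
  have e: "single (lead_exp f) (lookup f (lead_exp f)) = single (lead_of K) c"
    using assms(3) LT_eq[OF l] LT_eq[OF g(1)] g(2) by simp
  then have "lead_exp f = lead_of K"
    using nz c by (metis lookup_single_eq lookup_single_not_eq)
  then show "G.leads f (lead_of K)" "lookup f (lead_of K) = c"
    using l e by (auto dest: arg_cong[where f = "\<lambda>g. lookup g (lead_of K)"])
qed

text \<open>Besides expressing \<open>f\<close>, a subduction only uses products whose lead monomials do not exceed
  that of \<open>f\<close>, because the lead monomials decrease from step to step.\<close>

lemma subducts_sound:
  assumes "subducts bs f P"
  shows "subst ((!) bs) P = f"
    and "K \<in> keys P \<Longrightarrow> K \<in> gen_exponents \<and> (\<exists>n\<in>keys f. gkey (lead_of K) \<le> gkey n)"
proof -
  have "subst ((!) bs) P = f \<and> (\<forall>K\<in>keys P. K \<in> gen_exponents \<and> (\<exists>n\<in>keys f. gkey (lead_of K) \<le> gkey n))"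
    using assms
  proof induction
    case (step f K c P)
    then have K: "K \<in> gen_exponents" by (simp add: gen_exponents_def)
    note l = LT_Const_gen_monom[OF step.hyps(1) K step.hyps(3)]
    have g: "G.leads (Const c * gen_monom K) (lead_of K)" "lookup (Const c * gen_monom K) (lead_of K) = c"
      using leads_Const_mult[OF leads_gen_monom(1)[OF K] l(3)] leads_gen_monom(2)[OF K] by simp_all
    have K': "lead_of K \<in> keys f" using l(1) by (simp add: G.leads_def)
    have lt: "gkey n < gkey (lead_of K)" if "n \<in> keys (f - Const c * gen_monom K)" for n
      using leads_diff_less[OF l(1) g(1) _ that] l(2) g(2) by simp
    have "L \<in> gen_exponents \<and> (\<exists>n\<in>keys f. gkey (lead_of L) \<le> gkey n)" if "L \<in> keys (single K c + P)" for L
    proof -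
      from that consider "L = K" | "L \<in> keys P" by (auto dest!: in_keys_addD split: if_splits)
      then show ?thesis
      proof cases
        case 1
        then show ?thesis using K K' by blast
      next
        case 2
        then obtain n where "L \<in> gen_exponents" "n \<in> keys (f - Const c * gen_monom K)" "gkey (lead_of L) \<le> gkey n"
          using step.IH by blast
        then show ?thesis using lt[of n] K' by (metis order.strict_implies_order order.trans)
      qed
    qed
    moreover have "subst ((!) bs) (single K c + P) = f"
      using step.IH by (simp add: subst_add subst_single)
    ultimately show ?case by blast
  qed simp
  then show "subst ((!) bs) P = f" "K \<in> keys P \<Longrightarrow> K \<in> gen_exponents \<and> (\<exists>n\<in>keys f. gkey (lead_of K) \<le> gkey n)"
    by blast+
qed

lemma invariant_lead:
  assumes "f \<in> invariants p M" "f \<noteq> 0"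
  obtains K where "normal K" "G.leads f (lead_of K)"
proof -
  have "f \<in> N" using assms(1) by (simp add: invariants_eq_N)
  then obtain q where q: "\<And>K. K \<in> keys q \<Longrightarrow> normal K" "f = subst ((!) bs) q" using N_expansion by metis
  have "q \<noteq> 0" using assms(2) q(2) by auto
  then obtain K where "K \<in> keys q" "G.leads f (lead_of K)"
    unfolding q(2) using subst_normal_lead q(1) by metis
  then show ?thesis using q(1) that by blast
qed

lemma invariants_diff: "f \<in> invariants p M \<Longrightarrow> g \<in> invariants p M \<Longrightarrow> f - g \<in> invariants p M"
  by (simp add: invariant_iff invariant_diff)

lemma invariants_Const_mult: "f \<in> invariants p M \<Longrightarrow> Const c * f \<in> invariants p M"
  by (simp add: invariant_iff invariant_mult invariant_Const)

lemma invariants_gen_monom: "K \<in> gen_exponents \<Longrightarrow> gen_monom K \<in> invariants p M"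
  by (simp add: invariant_iff invariant_gen_monom)

text \<open>The lead monomial of an invariant is that of a normal monomial, so a subduction never gets stuck; it ends
  because the order is a well-order.\<close>

lemma subducts_exists:
  assumes "f \<in> invariants p M"
  shows "\<exists>P. subducts bs f P"
proof (cases "f = 0")
  case False
  then show ?thesis
    using assms
  proof (induction "gkey (lead_exp f)" arbitrary: f rule: less_induct)
    case less
    obtain K where K: "normal K" "G.leads f (lead_of K)" using invariant_lead less.prems by metis
    have K5: "K \<in> gen_exponents" using K(1) by (simp add: normal_def)
    define c where "c = lookup f (lead_of K)"
    have c: "c \<noteq> 0" using G.leads_lookup[OF K(2)] by (simp add: c_def)
    have g: "G.leads (Const c * gen_monom K) (lead_of K)" "lookup (Const c * gen_monom K) (lead_of K) = c"
      using leads_Const_mult[OF leads_gen_monom(1)[OF K5] c] leads_gen_monom(2)[OF K5] by simp_all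
    define f' where "f' = f - Const c * gen_monom K"
    have f': "f' \<in> invariants p M"
      unfolding f'_def using less.prems K5 by (intro invariants_diff invariants_Const_mult invariants_gen_monom)
    have "\<exists>P. subducts bs f' P"
    proof (cases "f' = 0")
      case False
      have "lead_exp f' \<in> keys f'" using leads_lead_exp[OF False] by (simp add: G.leads_def)
      then have "gkey (lead_exp f') < gkey (lead_of K)"
        unfolding f'_def using leads_diff_less[OF K(2) g(1)] g(2) by (simp add: c_def)
      then show ?thesis using less.hyps[of f'] False f' lead_exp_eqI[OF K(2)] by simp
    qed (auto intro: subducts.zero)
    then obtain P where P: "subducts bs f' P" by blast
    have "LT f = LT (Const c * gen_monom K)"
      using LT_eq[OF K(2)] LT_eq[OF g(1)] g(2) by (simp add: c_def)
    then have "subducts bs f (single K c + P)"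
      using less.prems K5 P unfolding f'_def by (intro subducts.step) (simp_all add: gen_exponents_def)
    then show ?case by blast
  qed
qed (auto intro: subducts.zero)

lemma subduction_relation_exists:
  assumes "I \<in> gen_exponents" "J \<in> gen_exponents" "lead_of I = lead_of J"
  shows "\<exists>R. subduction_relation bs I J R"
proof -
  have l: "G.leads (gen_monom I) (lead_of I)" "G.leads (gen_monom J) (lead_of I)"
    "lookup (gen_monom I) (lead_of I) = 1" "lookup (gen_monom J) (lead_of I) = 1"
    using leads_gen_monom assms by metis+
  have "tete_a_tete bs I J"
    using assms l by (simp add: tete_a_tete_def gen_exponents_def LM_eq)
  moreover have "LT (gen_monom I) = LT (Const 1 * gen_monom J)"
    using LT_eq[OF l(1)] LT_eq[OF l(2)] l(3,4) by simp
  moreover obtain P where "subducts bs (gen_monom I - Const 1 * gen_monom J) P"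
    using subducts_exists invariants_diff invariants_Const_mult invariants_gen_monom assms by metis
  ultimately show ?thesis unfolding subduction_relation_def by blast
qed


section \<open>Division with respect to the two relations\<close>

text \<open>Monomials in the generators are compared by the lead monomials of their values. Breaking ties by the
  exponents of \<open>h\<^sub>2\<close> and of the norm of \<open>y\<close> makes the lead monomials of the two
  relations coprime powers of single variables.\<close>

definition tkey :: "nat monom \<Rightarrow> (nat \<times> nat \<times> nat) \<times> nat \<times> nat" where
  "tkey K = (gkey (lead_of K), lookup K 2, lookup K 3)"

lemma tkey_less_iff: "tkey K < tkey L \<longleftrightarrow> gkey (lead_of K) < gkey (lead_of L)
  \<or> lead_of K = lead_of L \<and> (lookup K 2, lookup K 3) < (lookup L 2, lookup L 3)"
proof -
  have "gkey (lead_of K) = gkey (lead_of L) \<longleftrightarrow> lead_of K = lead_of L"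
    using G.key_inj by (simp add: inj_eq)
  then show ?thesis
    unfolding tkey_def less_prod_simp[of "gkey (lead_of K)"] by (auto simp: order_le_less)
qed

lemma monomial_key_tkey: "monomial_key tkey gen_exponents"
proof
  show "inj_on tkey gen_exponents"
  proof (rule inj_onI)
    fix K L assume KL: "K \<in> gen_exponents" "L \<in> gen_exponents" "tkey K = tkey L"
    then have "lead_of K = lead_of L" using G.key_inj by (simp add: tkey_def inj_eq)
    with KL show "K = L" by (intro gen_exponents_eqI) (simp_all add: tkey_def)
  qed
  show "tkey (K + D) < tkey (L + D)" if "tkey K < tkey L" for K L D
    using that unfolding tkey_less_iff lead_of_add lookup_add
    by (auto intro: G.key_mono)
qed (rule gen_exponents_add)

sublocale T: monomial_key tkey gen_exponents by (rule monomial_key_tkey)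

lemma carrier_gen_exponents: "f \<in> carrier (mpoly_ring 5) \<longleftrightarrow> keys f \<subseteq> gen_exponents"
  by (auto simp: carrier_mpoly_ring gen_exponents_def)

text \<open>In a relation from a tete-a-tete the monomials \<open>I\<close> and \<open>J\<close> have values with the
  same lead monomial, while the lead monomials of all others are smaller. So the tie-break decides that
  \<open>I\<close> leads, independently of the choices made in the subduction.\<close>

lemma subduction_relation_leads:
  assumes R: "subduction_relation bs I J R" and IJ: "(lookup J 2, lookup J 3) < (lookup I 2, lookup I 3)"
  shows "T.leads R I" "lookup R I = 1" "R \<in> relation_ideal bs"
proof -
  from R obtain c P where t: "tete_a_tete bs I J" and c: "LT (gen_monom I) = LT (Const c * gen_monom J)"
    and P: "subducts bs (gen_monom I - Const c * gen_monom J) P"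
    and R_eq: "R = single I 1 - single J c - P"
    unfolding subduction_relation_def by blast
  have I: "I \<in> gen_exponents" and J: "J \<in> gen_exponents" using t by (simp_all add: tete_a_tete_def gen_exponents_def)
  have lI: "G.leads (gen_monom I) (lead_of I)" by (rule leads_gen_monom[OF I])
  note l = LT_Const_gen_monom[OF G.leads_nonzero[OF lI] J c]
  have e: "lead_of I = lead_of J" by (rule G.leads_unique[OF lI l(1)])
  have g: "G.leads (Const c * gen_monom J) (lead_of I)" "lookup (Const c * gen_monom J) (lead_of I) = c"
    unfolding e using leads_Const_mult[OF leads_gen_monom(1)[OF J] l(3)] leads_gen_monom(2)[OF J] by simp_all
  have P5: "K \<in> gen_exponents \<and> tkey K < tkey I" if K: "K \<in> keys P" for K
  proof -
    obtain n where n: "K \<in> gen_exponents" "n \<in> keys (gen_monom I - Const c * gen_monom J)" "gkey (lead_of K) \<le> gkey n"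
      using subducts_sound(2)[OF P K] by blast
    have "gkey n < gkey (lead_of I)"
      using leads_diff_less[OF lI g(1) _ n(2)] l(2) g(2) e by simp
    with n(3) have "gkey (lead_of K) < gkey (lead_of I)" by (rule order.strict_trans1)
    then show ?thesis using n(1) unfolding tkey_less_iff by blast
  qed
  have J_less: "tkey J < tkey I" unfolding tkey_less_iff using IJ e[symmetric] by blast
  have keys_R: "K \<in> gen_exponents \<and> tkey K < tkey I" if "K \<in> keys R" "K \<noteq> I" for K
  proof -
    have "K = J \<or> K \<in> keys P"
      using that unfolding R_eq by (auto simp: in_keys_iff lookup_minus lookup_single when_def split: if_splits)
    then show ?thesis using J J_less P5 by blast
  qed
  have "I \<noteq> J" using J_less by auto
  moreover have "I \<notin> keys P" using P5 by blast
  ultimately show R1: "lookup R I = 1"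
    unfolding R_eq by (simp add: lookup_minus lookup_single when_def in_keys_iff)
  then show lead: "T.leads R I"
    unfolding T.leads_def using keys_R I by (auto simp: in_keys_iff)
  have "subst ((!) bs) R = 0"
    unfolding R_eq subst_diff subst_single subducts_sound(1)[OF P] by simp
  then show "R \<in> relation_ideal bs"
    using lead by (simp add: relation_ideal_def carrier_gen_exponents T.leads_def)
qed

definition reducible :: "nat monom set \<Rightarrow> nat monom \<Rightarrow> bool" where
  "reducible B K \<longleftrightarrow> (\<exists>I\<in>B. \<exists>D. K = I + D)"

lemma gen_exponents_addD: "I + D \<in> gen_exponents \<Longrightarrow> D \<in> gen_exponents"
  unfolding gen_exponents_def by (auto simp: in_keys_iff lookup_add subset_iff)

text \<open>Division by polynomials with lead monomials in \<open>B\<close>: subtracting a multiple of one of them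
  replaces a reducible monomial by monomials with smaller keys, and the keys are well-ordered.\<close>

lemma normal_form:
  fixes L :: "(nat, 'a) mpoly set"
  assumes L: "ideal L (mpoly_ring 5)"
    and B: "\<And>I. I \<in> B \<Longrightarrow> \<exists>R\<in>L. T.leads R I \<and> lookup R I = 1"
    and f: "keys f \<subseteq> gen_exponents"
  obtains r where "keys r \<subseteq> gen_exponents" "\<And>K. K \<in> keys r \<Longrightarrow> \<not> reducible B K" "f - r \<in> L"
proof -
  define good where "good f \<longleftrightarrow> (\<exists>r. keys r \<subseteq> gen_exponents \<and> (\<forall>K\<in>keys r. \<not> reducible B K) \<and> f - r \<in> L)" for f
  have good_0: "good 0"
    unfolding good_def by (rule exI[of _ 0]) (simp add: ideal_zero[OF L])
  have good_add: "good (f + g)" if fg: "good f" "good g" for f g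
  proof -
    from fg obtain r s where r: "keys r \<subseteq> gen_exponents" "\<forall>K\<in>keys r. \<not> reducible B K" "f - r \<in> L"
      and s: "keys s \<subseteq> gen_exponents" "\<forall>K\<in>keys s. \<not> reducible B K" "g - s \<in> L"
      unfolding good_def by blast
    have "(f + g) - (r + s) = (f - r) + (g - s)" by simp
    then have "(f + g) - (r + s) \<in> L" using ideal_add[OF L r(3) s(3)] by (simp only:)
    moreover have "K \<in> gen_exponents \<and> \<not> reducible B K" if K: "K \<in> keys (r + s)" for K
      using in_keys_addD[OF K] r(1,2) s(1,2) by blast
    ultimately show ?thesis unfolding good_def by blast
  qed
  have good_scale: "good (Const c * f)" if "good f" for c f
  proof -
    from that obtain r where r: "keys r \<subseteq> gen_exponents" "\<forall>K\<in>keys r. \<not> reducible B K" "f - r \<in> L"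
      unfolding good_def by blast
    have "Const c * f - Const c * r \<in> L"
      using ideal_mult[OF L r(3) carrier_Const, of c] by (simp add: right_diff_distrib)
    moreover have "keys (Const c * r) \<subseteq> keys r" by (auto simp: in_keys_iff lookup_Const_mult)
    ultimately show ?thesis unfolding good_def using r by blast
  qed
  have good_sum: "good h" if "\<And>K. K \<in> keys h \<Longrightarrow> good (single K 1)" for h
  proof -
    have "good (\<Sum>K\<in>S. Const (lookup h K) * single K 1)" if "finite S" "S \<subseteq> keys h" for S
      using that
    proof (induction S rule: finite_induct)
      case (insert K S)
      then show ?case using good_add good_scale \<open>\<And>K. K \<in> keys h \<Longrightarrow> good (single K 1)\<close> by simp
    qed (simp add: good_0)
    from this[of "keys h"] show ?thesis
      using poly_mapping_sum_singles[of h] by (simp add: Const_mult_single)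
  qed
  have "good (single K 1)" if "K \<in> gen_exponents" for K
    using that
  proof (induction "tkey K" arbitrary: K rule: less_induct)
    case less
    show ?case
    proof (cases "reducible B K")
      case False
      then show ?thesis
        unfolding good_def using less.prems by (intro exI[of _ "single K 1"]) (simp add: ideal_zero[OF L])
    next
      case True
      then obtain I D where ID: "I \<in> B" "K = I + D" unfolding reducible_def by blast
      obtain R where R: "R \<in> L" "T.leads R I" "lookup R I = 1" using B[OF ID(1)] by blast
      have D: "D \<in> gen_exponents" using less.prems gen_exponents_addD unfolding ID(2) by blast
      have lD: "T.leads (single D (1::'a)) D" using D by (intro T.leads_single) simp_all
      define h where "h = single K 1 - single D 1 * R"
      have lR: "T.leads (single D 1 * R) K" "lookup (single D 1 * R) K = 1"
        using T.lead_product[OF lD R(2)] R(3) unfolding ID(2) by (simp_all add: add.commute)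
      have "good (single K' 1)" if "K' \<in> keys h" for K'
      proof (rule less.hyps)
        have "K' \<noteq> K" using that lR(2) by (auto simp: h_def in_keys_iff lookup_minus)
        then have "K' \<in> keys (single D 1 * R)"
          using that by (auto simp: h_def in_keys_iff lookup_minus lookup_single)
        then show "tkey K' < tkey K" "K' \<in> gen_exponents" using lR(1) \<open>K' \<noteq> K\<close> unfolding T.leads_def by auto
      qed
      then have "good h" by (rule good_sum)
      moreover have "good (single D 1 * R)"
        unfolding good_def using ideal_mult[OF L R(1), of "single D 1"] D
        by (intro exI[of _ 0]) (simp add: carrier_gen_exponents)
      ultimately have "good (h + single D 1 * R)" by (rule good_add)
      then show ?thesis by (simp add: h_def)
    qed
  qed
  then have "good f" using f good_sum[of f] by (meson subsetD)
  then obtain r where "keys r \<subseteq> gen_exponents" "\<forall>K\<in>keys r. \<not> reducible B K" "f - r \<in> L"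
    unfolding good_def by blast
  then show ?thesis by (intro that) simp_all
qed

text \<open>The irreducible monomials are the normal ones. The remainder of a relation is again a relation; if it were
  nonzero, its value would have a lead monomial.\<close>

lemma relation_ideal_eq:
  assumes "R1 \<in> relation_ideal bs" "T.leads R1 (single 3 2)" "lookup R1 (single 3 2) = 1"
    and "R2 \<in> relation_ideal bs" "T.leads R2 (single 2 p)" "lookup R2 (single 2 p) = 1"
  shows "relation_ideal bs = Idl\<^bsub>mpoly_ring 5\<^esub> {R1, R2}"
proof
  have id: "ideal (relation_ideal bs) (mpoly_ring 5)" using ideal_relation_ideal[of bs] by simp
  have c: "{R1, R2} \<subseteq> carrier (mpoly_ring 5)" using assms by (simp add: carrier_gen_exponents T.leads_def)
  have idl: "ideal (Idl\<^bsub>mpoly_ring 5\<^esub> {R1, R2}) (mpoly_ring 5)" by (rule ideal_genideal[OF c])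
  show sub: "Idl\<^bsub>mpoly_ring 5\<^esub> {R1, R2} \<subseteq> relation_ideal bs"
    using genideal_subset[OF id, of "{R1, R2}"] assms by simp
  show "relation_ideal bs \<subseteq> Idl\<^bsub>mpoly_ring 5\<^esub> {R1, R2}"
  proof
    fix f assume f: "f \<in> relation_ideal bs"
    obtain r where r: "keys r \<subseteq> gen_exponents" "\<And>K. K \<in> keys r \<Longrightarrow> \<not> reducible {single 3 2, single 2 p} K"
      "f - r \<in> Idl\<^bsub>mpoly_ring 5\<^esub> {R1, R2}"
    proof (rule normal_form[OF idl])
      show "\<exists>R\<in>Idl\<^bsub>mpoly_ring 5\<^esub> {R1, R2}. T.leads R I \<and> lookup R I = 1" if "I \<in> {single 3 2, single 2 p}" for I
        using that assms subset_genideal[OF c] by blast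
      show "keys f \<subseteq> gen_exponents" using f by (simp add: relation_ideal_def carrier_gen_exponents)
    qed blast
    have "normal K" if K: "K \<in> keys r" for K
    proof -
      have d: "\<exists>D. K = single i k + D" if "k \<le> lookup K i" for i k
        using that by (intro exI[of _ "K - single i k"] poly_mapping_eqI)
          (auto simp: lookup_add lookup_minus lookup_single when_def)
      have "\<not> p \<le> lookup K 2" "\<not> 2 \<le> lookup K 3"
        using d[of p 2] d[of 2 3] r(2)[OF K] unfolding reducible_def by blast+
      then show ?thesis using K r(1) by (auto simp: normal_def)
    qed
    moreover have "subst ((!) bs) r = 0"
    proof -
      have "subst ((!) bs) (f - r) = 0" using r(3) sub by (auto simp: relation_ideal_def)
      then show ?thesis using f by (simp add: relation_ideal_def subst_diff)
    qed
    ultimately have "r = 0" using subst_normal_lead[of r] G.leads_nonzero by metis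
    then show "f \<in> Idl\<^bsub>mpoly_ring 5\<^esub> {R1, R2}" using r(3) by simp
  qed
qed

text \<open>Let \<open>R2 * f\<close> be a multiple of \<open>R1\<close>, with \<open>f\<close> reduced modulo
  \<open>R1\<close>. If \<open>f\<close> were nonzero, then, as \<open>t\<^sub>2\<^sup>p\<close> and
  \<open>t\<^sub>3\<^sup>2\<close> are coprime, the lead monomial of \<open>f\<close> would be divisible by
  \<open>t\<^sub>3\<^sup>2\<close>.\<close>

lemma regular_relations:
  assumes "R1 \<in> relation_ideal bs" "T.leads R1 (single 3 2)" "lookup R1 (single 3 2) = 1"
    and "R2 \<in> relation_ideal bs" "T.leads R2 (single 2 p)"
  shows "regular_sequence (mpoly_ring 5) [R1, R2]"
proof -
  have c: "R1 \<in> carrier (mpoly_ring 5)" "R2 \<in> carrier (mpoly_ring 5)"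
    using assms by (simp_all add: carrier_gen_exponents T.leads_def)
  let ?L = "Idl\<^bsub>mpoly_ring 5\<^esub> {R1}"
  have L: "ideal ?L (mpoly_ring 5)" and R1L: "R1 \<in> ?L"
    using ideal_genideal[of "{R1}" 5] subset_genideal[of "{R1}" 5] c by auto
  have zero_case: "f = 0" if "R1 * f = 0" for f using that T.leads_nonzero[OF assms(2)] by simp
  have one_case: "f \<in> ?L" if f: "f \<in> carrier (mpoly_ring 5)" and R2f: "R2 * f \<in> ?L" for f
  proof -
    obtain r where r: "keys r \<subseteq> gen_exponents" "\<And>K. K \<in> keys r \<Longrightarrow> \<not> reducible {single 3 2} K" "f - r \<in> ?L"
    proof (rule normal_form[OF L])
      show "\<exists>R\<in>?L. T.leads R I \<and> lookup R I = 1" if "I \<in> {single 3 2}" for I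
        using that assms R1L by blast
      show "keys f \<subseteq> gen_exponents" using f by (simp add: carrier_gen_exponents)
    qed blast
    have "R2 * f - R2 * (f - r) \<in> ?L" by (rule ideal_diff[OF L R2f ideal_mult[OF L r(3) c(2)]])
    then have "R2 * r \<in> ?L" by (simp add: right_diff_distrib)
    then obtain q where q: "q \<in> carrier (mpoly_ring 5)" "R2 * r = q * R1" using genideal_singletonE c(1) by metis
    have "r = 0"
    proof (rule ccontr)
      assume "r \<noteq> 0"
      then have "q \<noteq> 0" using q(2) T.leads_nonzero[OF assms(5)] by auto
      obtain K where K: "T.leads r K" using T.leads_exists[OF \<open>r \<noteq> 0\<close> r(1)] by blast
      obtain D where D: "T.leads q D" using T.leads_exists[OF \<open>q \<noteq> 0\<close>] q(1) carrier_gen_exponents by blast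
      have "single 2 p + K = D + single 3 2"
        using T.lead_product(1)[OF assms(5) K] T.lead_product(1)[OF D assms(2)] q(2) T.leads_unique by metis
      then have "lookup (single 2 p + K) 3 = lookup (D + single 3 2) 3" by simp
      then have "2 \<le> lookup K 3" by (simp add: lookup_add lookup_single)
      then have "K = single 3 2 + (K - single 3 2)"
        by (intro poly_mapping_eqI) (auto simp: lookup_add lookup_minus lookup_single when_def)
      then have "reducible {single 3 2} K" unfolding reducible_def by blast
      then show False using r(2) K by (auto simp: T.leads_def)
    qed
    then show ?thesis using r(3) by simp
  qed
  have one_notin: "1 \<notin> Idl\<^bsub>mpoly_ring 5\<^esub> {R1, R2}"
  proof
    assume "1 \<in> Idl\<^bsub>mpoly_ring 5\<^esub> {R1, R2}"
    moreover have "Idl\<^bsub>mpoly_ring 5\<^esub> {R1, R2} \<subseteq> relation_ideal bs"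
      using genideal_subset[of "relation_ideal bs" 5 "{R1, R2}"] ideal_relation_ideal[of bs] assms(1,4) by simp
    ultimately have "(1 :: (nat, 'a) mpoly) \<in> relation_ideal bs" by blast
    then show False by (simp add: relation_ideal_def)
  qed
  have one_in: "1 \<in> carrier (mpoly_ring 5 :: (nat, 'a) mpoly ring)" using carrier_Const[of 1 5] by simp
  have step: "f \<in> Idl\<^bsub>mpoly_ring 5\<^esub> (set (take i [R1, R2]))"
    if "i < length [R1, R2]" "f \<in> carrier (mpoly_ring 5)"
      "[R1, R2] ! i * f \<in> Idl\<^bsub>mpoly_ring 5\<^esub> (set (take i [R1, R2]))" for i f
  proof -
    have "i < 2" using that(1) by simp
    then have "i = 0 \<or> i = 1" by linarith
    then show ?thesis
    proof
      assume i: "i = 0"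
      then have "R1 * f = 0" using that(3) by (simp add: genideal_empty)
      then have "f = 0" by (rule zero_case)
      then show ?thesis using i by (simp add: genideal_empty)
    next
      assume i: "i = 1"
      have "R2 * f \<in> ?L" using that(3) unfolding i by simp
      then have "f \<in> ?L" by (rule one_case[OF that(2)])
      then show ?thesis unfolding i by simp
    qed
  qed
  show ?thesis
    unfolding regular_sequence_def mpoly_ring_simps
  proof (intro conjI allI impI ballI)
    show "set [R1, R2] \<subseteq> carrier (mpoly_ring 5)" using c by simp
    show "Idl\<^bsub>mpoly_ring 5\<^esub> (set [R1, R2]) \<noteq> carrier (mpoly_ring 5)"
      using one_notin one_in by (metis list.set(1,2))
  qed (rule step)
qed

lemma subst_image_carrier: "subst ((!) bs) ` carrier (mpoly_ring 5) = invariants p M"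
proof
  show "subst ((!) bs) ` carrier (mpoly_ring 5) \<subseteq> invariants p M"
  proof
    fix g assume "g \<in> subst ((!) bs) ` carrier (mpoly_ring 5)"
    then obtain f where f: "keys f \<subseteq> gen_exponents" "g = subst ((!) bs) f" by (auto simp: carrier_gen_exponents)
    have "invariant (\<Sum>K\<in>S. Const (lookup f K) * gen_monom K)" if "finite S" "S \<subseteq> gen_exponents" for S
      using that by (induction S rule: finite_induct)
        (simp_all add: invariant_zero invariant_add invariant_mult invariant_Const invariant_gen_monom)
    then have "invariant g" unfolding f(2) subst_def using f(1) by simp
    then show "g \<in> invariants p M" by (simp add: invariant_iff)
  qed
  show "invariants p M \<subseteq> subst ((!) bs) ` carrier (mpoly_ring 5)"
  proof
    fix g assume "g \<in> invariants p M"
    then have "g \<in> N" by (simp add: invariants_eq_N)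
    then obtain q where q: "\<And>K. K \<in> keys q \<Longrightarrow> normal K" "g = subst ((!) bs) q" using N_expansion by metis
    have "keys q \<subseteq> gen_exponents" using q(1) by (auto simp: normal_def)
    then show "g \<in> subst ((!) bs) ` carrier (mpoly_ring 5)" using q(2) by (auto simp: carrier_gen_exponents)
  qed
qed

text \<open>Both sides of the first equation are \<open>y\<close> to the power \<open>2p\<^sup>3\<close>, and those of
  the second are \<open>y\<close> to the power \<open>p\<^sup>4 + p\<close>.\<close>

lemma lead_of_tete_a_tetes:
  "lead_of (single 3 2) = lead_of (single 1 (p\<^sup>2))"
  "lead_of (single 2 p) = lead_of (single 1 ((p ^ 3 + 1) div 2))"
proof -
  have "even (p ^ 3 + 1)" using odd_p by simp
  then have "2 * ((p ^ 3 + 1) div 2) = p ^ 3 + 1" by simp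
  then have "2 * p * ((p ^ 3 + 1) div 2) = (p ^ 3 + 1) * p" by (metis mult.assoc mult.commute)
  then show "lead_of (single 2 p) = lead_of (single 1 ((p ^ 3 + 1) div 2))"
    by (intro monom_three_eqI) (simp_all only: lead_of_lookup, simp_all add: lookup_single)
  show "lead_of (single 3 2) = lead_of (single 1 (p\<^sup>2))"
    by (intro monom_three_eqI) (simp_all only: lead_of_lookup, simp_all add: lookup_single power2_eq_square power3_eq_cube)
qed

lemma relations_exist:
  "\<exists>R. subduction_relation bs (single 3 2) (single 1 (p\<^sup>2)) R"
  "\<exists>R. subduction_relation bs (single 2 p) (single 1 ((p ^ 3 + 1) div 2)) R"
  by (intro subduction_relation_exists gen_exponents_single lead_of_tete_a_tetes; simp)+

lemma relations_present:
  assumes "subduction_relation bs (single 3 2) (single 1 (p\<^sup>2)) R1"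
    and "subduction_relation bs (single 2 p) (single 1 ((p ^ 3 + 1) div 2)) R2"
  shows "presents bs [R1, R2] (invariants p M)" "regular_sequence (mpoly_ring (length bs)) [R1, R2]"
proof -
  note r1 = subduction_relation_leads[OF assms(1)]
  note r2 = subduction_relation_leads[OF assms(2)]
  have l: "(lookup (single (1::nat) (p\<^sup>2)) 2, lookup (single (1::nat) (p\<^sup>2)) 3) < (lookup (single (3::nat) (2::nat)) 2, lookup (single (3::nat) (2::nat)) 3)"
    "(lookup (single (1::nat) ((p ^ 3 + 1) div 2)) 2, lookup (single (1::nat) ((p ^ 3 + 1) div 2)) 3) < (lookup (single (2::nat) p) 2, lookup (single (2::nat) p) 3)"
    using p_pos by (simp_all add: lookup_single)
  show "presents bs [R1, R2] (invariants p M)"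
    unfolding presents_def using subst_image_carrier relation_ideal_eq r1[OF l(1)] r2[OF l(2)] by simp
  show "regular_sequence (mpoly_ring (length bs)) [R1, R2]"
    using regular_relations r1[OF l(1)] r2[OF l(2)] by simp
qed

text \<open>The lead monomial of an invariant is that of a normal monomial, hence a product of lead monomials of
  generators.\<close>

lemma sagbi: "sagbi_basis (set bs) (invariants p M)"
  unfolding sagbi_basis_def
proof (intro conjI)
  have nth: "b \<in> set bs \<Longrightarrow> \<exists>i<5. b = bs ! i" for b by (metis in_set_conv_nth length_bs)
  show "finite (set bs)" by simp
  show "set bs \<subseteq> invariants p M - {0}"
  proof
    fix b assume "b \<in> set bs"
    then obtain i where i: "i < 5" "b = bs ! i" using nth by blast
    then have "b = gen_monom (single i 1)" by simp
    then show "b \<in> invariants p M - {0}"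
      using invariants_gen_monom[of "single i 1"] gen_exponents_single[of i 1] leads_gen(1)[OF i(1)] i G.leads_nonzero by auto
  qed
  show "alg_gen (LM ` set bs) = lin_span (LM ` (invariants p M - {0}))"
  proof
    show "alg_gen (LM ` set bs) \<subseteq> lin_span (LM ` (invariants p M - {0}))"
    proof
      fix f assume "f \<in> alg_gen (LM ` set bs)"
      then show "f \<in> lin_span (LM ` (invariants p M - {0}))"
        unfolding lin_span_eq
      proof induction
        case (gen f)
        then show ?case using \<open>set bs \<subseteq> invariants p M - {0}\<close> by (intro mp.span_base) blast
      next
        case (const c)
        have "G.leads (1 :: (3, 'a) mpoly) 0" using G.leads_single[of 0 "1 :: 'a"] by simp
        then have "LM 1 = (1 :: (3, 'a) mpoly)" using LM_eq by fastforce
        moreover have "(1 :: (3, 'a) mpoly) \<in> invariants p M - {0}"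
          using invariant_Const[of 1] by (simp add: invariant_iff)
        ultimately have "1 \<in> LM ` (invariants p M - {0})" by (metis image_eqI)
        then show ?case using mp.span_scale[OF mp.span_base, of 1 _ c] by simp
      next
        case (add f g)
        then show ?case by (intro mp.span_add)
      next
        case (mult f g)
        show ?case
        proof (rule span_mult[OF _ mult.IH])
          fix a b assume "a \<in> LM ` (invariants p M - {0})" "b \<in> LM ` (invariants p M - {0})"
          then obtain f g where fg: "a = LM f" "b = LM g" "f \<in> invariants p M" "f \<noteq> 0" "g \<in> invariants p M" "g \<noteq> 0"
            by blast
          have "LM (f * g) = single (lead_exp f + lead_exp g) 1"
            by (intro LM_eq G.lead_product leads_lead_exp fg)
          also have "\<dots> = a * b" unfolding fg LM_def by (simp add: mult_single)
          finally have "a * b = LM (f * g)" ..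
          moreover have "f * g \<in> invariants p M - {0}" using fg by (simp add: invariant_iff invariant_mult)
          ultimately show "a * b \<in> mp.span (LM ` (invariants p M - {0}))" by (intro mp.span_base) blast
        qed
      qed
    qed
    show "lin_span (LM ` (invariants p M - {0})) \<subseteq> alg_gen (LM ` set bs)"
      unfolding lin_span_eq
    proof (rule mp.span_minimal)
      show "mp.subspace (alg_gen (LM ` set bs))"
        by (rule mp.subspaceI) (use alg_gen.const[of 0 "LM ` set bs"] in \<open>auto intro: alg_gen.intros\<close>)
      show "LM ` (invariants p M - {0}) \<subseteq> alg_gen (LM ` set bs)"
      proof
        fix m assume "m \<in> LM ` (invariants p M - {0})"
        then obtain f where f: "m = LM f" "f \<in> invariants p M" "f \<noteq> 0" by blast
        then obtain K where K: "normal K" "G.leads f (lead_of K)" using invariant_lead by metis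
        have zero: "(single 0 1 :: (3, 'a) mpoly) \<in> alg_gen (LM ` set bs)"
          using alg_gen.const[of 1 "LM ` set bs"] by simp
        have sum: "(single (sum g S) 1 :: (3, 'a) mpoly) \<in> alg_gen (LM ` set bs)"
          if "finite S" "\<And>i. i \<in> S \<Longrightarrow> single (g i) 1 \<in> alg_gen (LM ` set bs)" for g :: "nat \<Rightarrow> 3 monom" and S
          using that
        proof (induction S rule: finite_induct)
          case (insert i S)
          have "single (g i + sum g S) (1 :: 'a) = single (g i) 1 * single (sum g S) 1" by (simp add: mult_single)
          moreover have "single (g i) 1 \<in> alg_gen (LM ` set bs)" "single (sum g S) 1 \<in> alg_gen (LM ` set bs)"
            using insert by simp_all
          ultimately have "single (g i + sum g S) 1 \<in> alg_gen (LM ` set bs)"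
            by (simp only: alg_gen.mult)
          then show ?case using insert.hyps by simp
        qed (use zero in simp)
        have gen: "single (lead_of_gen i) 1 \<in> alg_gen (LM ` set bs)" if i: "i < 5" for i
        proof (rule alg_gen.gen)
          have "bs ! i \<in> set bs" using i by simp
          then show "single (lead_of_gen i) 1 \<in> LM ` set bs"
            using LM_eq[OF leads_gen(1)[OF i]] by (metis image_eqI)
        qed
        have "single (lead_of K) 1 \<in> alg_gen (LM ` set bs)"
          unfolding lead_of_def by (intro sum gen) simp_all
        then show "m \<in> alg_gen (LM ` set bs)" unfolding f(1) LM_eq[OF K(2)] .
      qed
    qed
  qed
qed

end

theorem theorem8p4:
  fixes p :: nat and M :: "'a::field ^ 4 ^ 2"
  assumes "prime p" and "p > 2" and "CHAR('a) = p"
    and "\<gamma> p M 1 2 3 4 = 0" and "\<gamma> p M 1 2 3 5 \<noteq> 0" and "\<gamma> p M 1 3 5 7 = 0"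
  defines "NY \<equiv> orbit_prod p M Y" and "NZ \<equiv> orbit_prod p M Z"
  defines "bs \<equiv> [X, h1 p M, h2 p M, NY, NZ]"
  shows "sagbi_basis {X, h1 p M, h2 p M, NY, NZ} (invariants p M) \<and>
    complete_intersection (invariants p M) \<and>
    (\<exists>R. subduction_relation bs (Poly_Mapping.single 3 2) (Poly_Mapping.single 1 (p\<^sup>2)) R) \<and>
    (\<exists>R. subduction_relation bs (Poly_Mapping.single 2 p) (Poly_Mapping.single 1 ((p ^ 3 + 1) div 2)) R) \<and>
    (\<forall>R1 R2.
       subduction_relation bs (Poly_Mapping.single 3 2) (Poly_Mapping.single 1 (p\<^sup>2)) R1 \<and>
       subduction_relation bs (Poly_Mapping.single 2 p) (Poly_Mapping.single 1 ((p ^ 3 + 1) div 2)) R2 \<longrightarrow>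
       presents bs [R1, R2] (invariants p M) \<and>
       regular_sequence (mpoly_ring (length bs)) [R1, R2])"
proof -
  interpret r: rank_four_action p M by standard (fact assms)+
  have b: "bs = r.bs" by (simp add: bs_def r.bs_def NY_def NZ_def)
  have "set bs = {X, h1 p M, h2 p M, NY, NZ}" by (simp add: bs_def)
  then have "sagbi_basis {X, h1 p M, h2 p M, NY, NZ} (invariants p M)" using r.sagbi b by simp
  moreover have "complete_intersection (invariants p M)"
    unfolding complete_intersection_def using r.relations_exist r.relations_present by blast
  ultimately show ?thesis
    unfolding b using r.relations_exist r.relations_present by (intro conjI allI impI) simp_all
qed

end
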